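(* Let $(M,g)$ be a compact real-analytic Riemannian manifold of dimension $n\ge2$ with boundary. Suppose that $\partial M$ is strictly convex at a point $x_0\in\partial M$. Let $z_0=(x_0,v_0)\in\partial_0SM$ and let $\mathcal G$ be a (sufficiently small) neighborhood of $z_0$ in $\partial_+SM$, such that the geodesic $x_z$ is admissible for every $z\in\mathcal G$. Let $\Phi,\Psi\in C^\infty(M,\mathbb C^{N\times N})$ be real-analytic Higgs fields. If \[ C_\Phi(z)=C_\Psi(z)\qquad\text{for all }z\in\mathcal G, \] then $\Phi=\Psi$ in $M$.
   Context: $(M,g)$ is connected and oriented. $(M,g)$ is a real-analytic Riemannian manifold if $M$ admits a real-analytic atlas and $g$ is real-analytic. $SM$ is the unit tangent bundle; with $\nu$ the inward unit normal to $\partial M$, $\partial_\pm SM=\{(x,v)\in SM: x\in\partial M,\ \pm\langle v,\nu(x)\rangle_g\ge0\}$ and $\partial_0SM=\partial_+SM\cap\partial_-SM=S(\partial M)$. $\partial M$ is strictly convex at $x\in\partial M$ if the second fundamental form $\Pi_x(v,w)=-(\nabla_v\nu,w)_g$ on $T_x\partial M$ is positive definite ($\nabla$ the Levi-Civita connection). For $z=(x,v)\in SM$, $x_z$ is the unit-speed geodesic with $(x_z(0),\dot x_z(0))=z$, and $\tau_+(z)$, $\tau_-(z)$ are the forward and backward exit times from $M$. The geodesic $x_z$ is admissible if $x_z(t)\in\mathrm{int}(M)$ for all $t\in(-\tau_-(z),\tau_+(z))$, $t\mapsto x_z(t)$ is injective, and $\tau_\pm(z)<\infty$; by strict convexity at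 $x_0$ this holds for all $z$ in any sufficiently small neighborhood of $z_0$ in $\partial_+SM$. A Higgs field is a smooth function $\Phi\in C^\infty(M,\mathbb C^{N\times N})$. **Nonabelian ray transform (scattering data).** For $z\in\mathcal G$ let $U\colon[0,\tau_+(z)]\to\mathrm{GL}(N,\mathbb C)$ be the unique solution of \[ \frac{d}{dt}U(t)+\Phi(x_z(t))\,U(t)=0,\qquad U(\tau_+(z))=\mathrm{Id}. \] Then $C_\Phi(z):=U(0)\in\mathrm{GL}(N,\mathbb C)$. *)

theory Defs
  imports "HOL-Analysis.Analysis"
begin

section \<open>Real-analytic and smooth functions on relatively open subsets of a half-space\<close>

text \<open>
  Analyticity at a point of \<open>S\<close> means that near this point the function is the restriction of the
  sum of a power series converging on a full ball, also when the point lies on the boundary of the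
  half-space. The series is indexed by multi-indices \<open>\<alpha> :: 'n \<Rightarrow> nat\<close>.
\<close>

definition real_analytic_on ::
  "(real^'n::finite) set \<Rightarrow> (real^'n \<Rightarrow> 'b::real_normed_vector) \<Rightarrow> bool" where
  "real_analytic_on S f \<longleftrightarrow>
     (\<forall>p\<in>S. \<exists>r>0. \<exists>(a :: ('n \<Rightarrow> nat) \<Rightarrow> 'b) F.
        (\<forall>y\<in>ball p r. ((\<lambda>\<alpha>. (\<Prod>i\<in>UNIV. (y $ i - p $ i) ^ \<alpha> i) *\<^sub>R a \<alpha>) has_sum F y) UNIV) \<and>
        (\<forall>y\<in>S \<inter> ball p r. f y = F y))"

primrec C_k_on ::
  "nat \<Rightarrow> (real^'n::finite) set \<Rightarrow> (real^'n \<Rightarrow> 'b::real_normed_vector) \<Rightarrow> bool" where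
  "C_k_on 0 V F \<longleftrightarrow> continuous_on V F"
| "C_k_on (Suc k) V F \<longleftrightarrow>
     F differentiable_on V \<and>
     (\<forall>i. C_k_on k V (\<lambda>y. frechet_derivative F (at y) (axis i 1)))"

text \<open>
  \<open>C_k_on\<close> is used on open sets only; on a relatively open subset of the half-space, smoothness
  means local extendability to a smooth function on an open set.
\<close>

definition smooth_fun_on ::
  "(real^'n::finite) set \<Rightarrow> (real^'n \<Rightarrow> 'b::real_normed_vector) \<Rightarrow> bool" where
  "smooth_fun_on S f \<longleftrightarrow>
     (\<forall>p\<in>S. \<exists>V F. open V \<and> p \<in> V \<and> (\<forall>k. C_k_on k V F) \<and> (\<forall>y\<in>S \<inter> V. f y = F y))"


section \<open>Real-analytic manifolds with boundary\<close>

text \<open>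
  The model space is the half-space where one (arbitrary but fixed) coordinate is nonnegative.
  A chart is its domain together with its coordinate map.
\<close>

definition normal_index :: "'n::finite" where
  "normal_index = (SOME k. True)"

definition half_space :: "(real^'n::finite) set" where
  "half_space = {y. 0 \<le> y $ normal_index}"

type_synonym ('m, 'n) chart = "'m set \<times> ('m \<Rightarrow> real^'n)"

abbreviation chart_image :: "('m, 'n::finite) chart \<Rightarrow> (real^'n) set" where
  "chart_image c \<equiv> snd c ` fst c"

abbreviation chart_inv :: "('m, 'n::finite) chart \<Rightarrow> real^'n \<Rightarrow> 'm" where
  "chart_inv c \<equiv> inv_into (fst c) (snd c)"

definition is_chart :: "'m topology \<Rightarrow> ('m, 'n::finite) chart \<Rightarrow> bool" where
  "is_chart M c \<longleftrightarrow>
     openin M (fst c) \<and>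
     openin (top_of_set half_space) (chart_image c) \<and>
     homeomorphic_map (subtopology M (fst c)) (top_of_set (chart_image c)) (snd c)"

definition real_analytic_atlas :: "'m topology \<Rightarrow> ('m, 'n::finite) chart set \<Rightarrow> bool" where
  "real_analytic_atlas M A \<longleftrightarrow>
     (\<forall>c\<in>A. is_chart M c) \<and>
     (\<Union>c\<in>A. fst c) = topspace M \<and>
     (\<forall>c\<in>A. \<forall>d\<in>A. real_analytic_on (snd c ` (fst c \<inter> fst d)) (snd d \<circ> chart_inv c))"

definition real_analytic_manifold :: "'m topology \<Rightarrow> ('m, 'n::finite) chart set \<Rightarrow> bool" where
  "real_analytic_manifold M A \<longleftrightarrow>
     Hausdorff_space M \<and> second_countable M \<and> real_analytic_atlas M A"

definition mfd_boundary :: "'m topology \<Rightarrow> ('m, 'n::finite) chart set \<Rightarrow> 'm set" where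
  "mfd_boundary M A = {x \<in> topspace M. \<exists>c\<in>A. x \<in> fst c \<and> snd c x $ normal_index = 0}"

definition mfd_interior :: "'m topology \<Rightarrow> ('m, 'n::finite) chart set \<Rightarrow> 'm set" where
  "mfd_interior M A = topspace M - mfd_boundary M A"

text \<open>
  The derivative at the point \<open>x\<close> of the change of coordinates from \<open>c\<close> to \<open>d\<close>. Derivatives within
  a relatively open subset of the half-space are unique, so the derivative is also meaningful at
  boundary points; the same remark applies to the partial derivatives of the metric below.
\<close>

definition transition_deriv ::
  "('m, 'n::finite) chart \<Rightarrow> ('m, 'n) chart \<Rightarrow> 'm \<Rightarrow> real^'n \<Rightarrow> real^'n" where
  "transition_deriv c d x =
     frechet_derivative (snd d \<circ> chart_inv c) (at (snd c x) within snd c ` (fst c \<inter> fst d))"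

text \<open>
  An orientation is given by an oriented atlas. In dimension at least 2 this is no restriction:
  reflecting a coordinate other than the normal one reverses the orientation of a chart.
\<close>

definition oriented_atlas :: "('m, 'n::finite) chart set \<Rightarrow> bool" where
  "oriented_atlas A \<longleftrightarrow>
     (\<forall>c\<in>A. \<forall>d\<in>A. \<forall>x\<in>fst c \<inter> fst d. 0 < det (matrix (transition_deriv c d x)))"

definition real_analytic_map ::
  "('m, 'n::finite) chart set \<Rightarrow> ('m \<Rightarrow> 'b::real_normed_vector) \<Rightarrow> bool" where
  "real_analytic_map A f \<longleftrightarrow> (\<forall>c\<in>A. real_analytic_on (chart_image c) (f \<circ> chart_inv c))"

definition smooth_map ::
  "('m, 'n::finite) chart set \<Rightarrow> ('m \<Rightarrow> 'b::real_normed_vector) \<Rightarrow> bool" where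
  "smooth_map A f \<longleftrightarrow> (\<forall>c\<in>A. smooth_fun_on (chart_image c) (f \<circ> chart_inv c))"


section \<open>Tangent vectors\<close>

text \<open>
  A tangent vector at \<open>x\<close> is the family of its coordinate vectors in all charts around \<open>x\<close>, related
  by the derivatives of the coordinate changes, and set to 0 at all other (irrelevant) arguments.
  Sums, multiples and the zero vector are formed pointwise.
\<close>

type_synonym ('m, 'n) tangent_vector = "('m, 'n) chart \<Rightarrow> real^'n"

definition tangent_space ::
  "('m, 'n::finite) chart set \<Rightarrow> 'm \<Rightarrow> ('m, 'n) tangent_vector set" where
  "tangent_space A x =
     {v. (\<forall>c\<in>A. \<forall>d\<in>A. x \<in> fst c \<inter> fst d \<longrightarrow> v d = transition_deriv c d x (v c)) \<and>
         (\<forall>c. \<not> (c \<in> A \<and> x \<in> fst c) \<longrightarrow> v c = 0)}"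

text \<open>The tangent vector at \<open>x\<close> whose coordinate vector in the chart \<open>c\<close> is \<open>u\<close>.\<close>

definition coord_vector ::
  "('m, 'n::finite) chart set \<Rightarrow> 'm \<Rightarrow> ('m, 'n) chart \<Rightarrow> real^'n \<Rightarrow> ('m, 'n) tangent_vector" where
  "coord_vector A x c u = (\<lambda>d. if d \<in> A \<and> x \<in> fst d then transition_deriv c d x u else 0)"

definition boundary_tangent_space ::
  "('m, 'n::finite) chart set \<Rightarrow> 'm \<Rightarrow> ('m, 'n) tangent_vector set" where
  "boundary_tangent_space A x =
     {v \<in> tangent_space A x. \<forall>c\<in>A. x \<in> fst c \<longrightarrow> v c $ normal_index = 0}"

text \<open>
  The topology of the tangent bundle \<open>TM\<close>: the sets corresponding in some chart to the open sets of
  position-velocity coordinates form a base.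
\<close>

definition tangent_bundle_topology ::
  "('m, 'n::finite) chart set \<Rightarrow> ('m \<times> ('m, 'n) tangent_vector) topology" where
  "tangent_bundle_topology A =
     topology_generated_by
       {{(x, v). x \<in> fst c \<and> v \<in> tangent_space A x \<and> (snd c x, v c) \<in> W} | c W.
          c \<in> A \<and> open W}"


section \<open>Riemannian metrics and the Levi-Civita connection\<close>

type_synonym ('m, 'n) metric =
  "'m \<Rightarrow> ('m, 'n) tangent_vector \<Rightarrow> ('m, 'n) tangent_vector \<Rightarrow> real"

definition inner_product_on_tangent_space ::
  "('m, 'n::finite) chart set \<Rightarrow> ('m, 'n) metric \<Rightarrow> 'm \<Rightarrow> bool" where
  "inner_product_on_tangent_space A g x \<longleftrightarrow>
     (\<forall>u\<in>tangent_space A x. \<forall>v\<in>tangent_space A x. \<forall>w\<in>tangent_space A x. \<forall>a b.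
        g x (\<lambda>c. a *\<^sub>R u c + b *\<^sub>R v c) w = a * g x u w + b * g x v w) \<and>
     (\<forall>v\<in>tangent_space A x. \<forall>w\<in>tangent_space A x. g x v w = g x w v) \<and>
     (\<forall>v\<in>tangent_space A x. v \<noteq> (\<lambda>_. 0) \<longrightarrow> 0 < g x v v)"

definition metric_matrix ::
  "('m, 'n::finite) chart set \<Rightarrow> ('m, 'n) metric \<Rightarrow> ('m, 'n) chart \<Rightarrow> real^'n \<Rightarrow> real^'n^'n" where
  "metric_matrix A g c y =
     (\<chi> i j. g (chart_inv c y) (coord_vector A (chart_inv c y) c (axis i 1))
                              (coord_vector A (chart_inv c y) c (axis j 1)))"

definition real_analytic_riemannian_manifold ::
  "'m topology \<Rightarrow> ('m, 'n::finite) chart set \<Rightarrow> ('m, 'n) metric \<Rightarrow> bool" where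
  "real_analytic_riemannian_manifold M A g \<longleftrightarrow>
     real_analytic_manifold M A \<and>
     (\<forall>x\<in>topspace M. inner_product_on_tangent_space A g x) \<and>
     (\<forall>c\<in>A. real_analytic_on (chart_image c) (metric_matrix A g c))"

definition metric_pderiv ::
  "('m, 'n::finite) chart set \<Rightarrow> ('m, 'n) metric \<Rightarrow> ('m, 'n) chart \<Rightarrow> real^'n \<Rightarrow>
   'n \<Rightarrow> 'n \<Rightarrow> 'n \<Rightarrow> real" where
  "metric_pderiv A g c y l i j =
     frechet_derivative (metric_matrix A g c) (at y within chart_image c) (axis l 1) $ i $ j"

definition christoffel ::
  "('m, 'n::finite) chart set \<Rightarrow> ('m, 'n) metric \<Rightarrow> ('m, 'n) chart \<Rightarrow> real^'n \<Rightarrow>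
   'n \<Rightarrow> 'n \<Rightarrow> 'n \<Rightarrow> real" where
  "christoffel A g c y k i j =
     (1/2) * (\<Sum>l\<in>UNIV. matrix_inv (metric_matrix A g c y) $ k $ l *
       (metric_pderiv A g c y i j l + metric_pderiv A g c y j i l - metric_pderiv A g c y l i j))"

definition christoffel_vec ::
  "('m, 'n::finite) chart set \<Rightarrow> ('m, 'n) metric \<Rightarrow> ('m, 'n) chart \<Rightarrow> real^'n \<Rightarrow>
   real^'n \<Rightarrow> real^'n \<Rightarrow> real^'n" where
  "christoffel_vec A g c y u w =
     (\<chi> k. \<Sum>i\<in>UNIV. \<Sum>j\<in>UNIV. christoffel A g c y k i j * u $ i * w $ j)"


section \<open>Unit tangent bundle and convexity of the boundary\<close>

definition unit_tangent_bundle ::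
  "'m topology \<Rightarrow> ('m, 'n::finite) chart set \<Rightarrow> ('m, 'n) metric \<Rightarrow>
   ('m \<times> ('m, 'n) tangent_vector) set" where
  "unit_tangent_bundle M A g = {(x, v). x \<in> topspace M \<and> v \<in> tangent_space A x \<and> g x v v = 1}"

definition inward_normal ::
  "('m, 'n::finite) chart set \<Rightarrow> ('m, 'n) metric \<Rightarrow> 'm \<Rightarrow> ('m, 'n) tangent_vector" where
  "inward_normal A g x =
     (THE v. v \<in> tangent_space A x \<and> g x v v = 1 \<and>
             (\<forall>w\<in>boundary_tangent_space A x. g x v w = 0) \<and>
             (\<forall>c\<in>A. x \<in> fst c \<longrightarrow> 0 < v c $ normal_index))"

definition inward_boundary ::
  "'m topology \<Rightarrow> ('m, 'n::finite) chart set \<Rightarrow> ('m, 'n) metric \<Rightarrow>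
   ('m \<times> ('m, 'n) tangent_vector) set" (* the set \<partial>_+ SM *) where
  "inward_boundary M A g =
     {(x, v) \<in> unit_tangent_bundle M A g. x \<in> mfd_boundary M A \<and> g x v (inward_normal A g x) \<ge> 0}"

definition outward_boundary ::
  "'m topology \<Rightarrow> ('m, 'n::finite) chart set \<Rightarrow> ('m, 'n) metric \<Rightarrow>
   ('m \<times> ('m, 'n) tangent_vector) set" (* the set \<partial>_- SM *) where
  "outward_boundary M A g =
     {(x, v) \<in> unit_tangent_bundle M A g. x \<in> mfd_boundary M A \<and> - g x v (inward_normal A g x) \<ge> 0}"

definition glancing_boundary ::
  "'m topology \<Rightarrow> ('m, 'n::finite) chart set \<Rightarrow> ('m, 'n) metric \<Rightarrow>
   ('m \<times> ('m, 'n) tangent_vector) set" (* the set \<partial>_0 SM *) where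
  "glancing_boundary M A g = inward_boundary M A g \<inter> outward_boundary M A g"

text \<open>
  The covariant derivative of the inward unit normal field in the direction of a vector \<open>v\<close> tangent
  to the boundary at \<open>x\<close>. The coordinate line through \<open>x\<close> in the direction \<open>v\<close> stays in the boundary
  for small times, hence the ordinary derivative along it only involves the normal field on the
  boundary.
\<close>

definition normal_cov_deriv ::
  "('m, 'n::finite) chart set \<Rightarrow> ('m, 'n) metric \<Rightarrow> 'm \<Rightarrow> ('m, 'n) tangent_vector \<Rightarrow>
   ('m, 'n) tangent_vector" where
  "normal_cov_deriv A g x v =
     (\<lambda>c. if c \<in> A \<and> x \<in> fst c
          then vector_derivative
                 (\<lambda>t. inward_normal A g (chart_inv c (snd c x + t *\<^sub>R v c)) c) (at 0)
               + christoffel_vec A g c (snd c x) (v c) (inward_normal A g x c)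
          else 0)"

definition second_fundamental_form ::
  "('m, 'n::finite) chart set \<Rightarrow> ('m, 'n) metric \<Rightarrow> ('m, 'n) metric" where
  "second_fundamental_form A g x v w = - g x (normal_cov_deriv A g x v) w"

definition strictly_convex_boundary_at ::
  "'m topology \<Rightarrow> ('m, 'n::finite) chart set \<Rightarrow> ('m, 'n) metric \<Rightarrow> 'm \<Rightarrow> bool" where
  "strictly_convex_boundary_at M A g x \<longleftrightarrow>
     x \<in> mfd_boundary M A \<and>
     (\<forall>v\<in>boundary_tangent_space A x. v \<noteq> (\<lambda>_. 0) \<longrightarrow> 0 < second_fundamental_form A g x v v)"


section \<open>Geodesics and exit times\<close>

text \<open>
  A geodesic on a closed interval \<open>I\<close> is given by its position \<open>\<gamma>\<close> and its velocity \<open>w\<close>. Recording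
  the velocity makes initial conditions meaningful on the degenerate interval \<open>{0}\<close>, which occurs
  for instance for tangential directions at a strictly convex boundary point. At end points of a
  nondegenerate interval the derivatives are one-sided.
\<close>

definition geodesic_on ::
  "'m topology \<Rightarrow> ('m, 'n::finite) chart set \<Rightarrow> ('m, 'n) metric \<Rightarrow> real set \<Rightarrow>
   (real \<Rightarrow> 'm) \<Rightarrow> (real \<Rightarrow> ('m, 'n) tangent_vector) \<Rightarrow> bool" where
  "geodesic_on M A g I \<gamma> w \<longleftrightarrow>
     continuous_map (top_of_set I) M \<gamma> \<and>
     (\<forall>t\<in>I. w t \<in> tangent_space A (\<gamma> t)) \<and>
     (\<forall>t\<in>I. \<forall>c\<in>A. \<gamma> t \<in> fst c \<longrightarrow>
        ((\<lambda>s. snd c (\<gamma> s)) has_vector_derivative w t c) (at t within I) \<and>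
        ((\<lambda>s. w s c) has_vector_derivative
            - christoffel_vec A g c (snd c (\<gamma> t)) (w t c) (w t c)) (at t within I))"

definition geodesic_from ::
  "'m topology \<Rightarrow> ('m, 'n::finite) chart set \<Rightarrow> ('m, 'n) metric \<Rightarrow>
   'm \<times> ('m, 'n) tangent_vector \<Rightarrow> real set \<Rightarrow> (real \<Rightarrow> 'm) \<Rightarrow> bool" where
  "geodesic_from M A g z I \<gamma> \<longleftrightarrow> (\<exists>w. geodesic_on M A g I \<gamma> w \<and> (\<gamma> 0, w 0) = z)"

definition forward_exit_time ::
  "'m topology \<Rightarrow> ('m, 'n::finite) chart set \<Rightarrow> ('m, 'n) metric \<Rightarrow>
   'm \<times> ('m, 'n) tangent_vector \<Rightarrow> ereal" where
  "forward_exit_time M A g z = Sup (ereal ` {T. 0 \<le> T \<and> (\<exists>\<gamma>. geodesic_from M A g z {0..T} \<gamma>)})"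

definition backward_exit_time ::
  "'m topology \<Rightarrow> ('m, 'n::finite) chart set \<Rightarrow> ('m, 'n) metric \<Rightarrow>
   'm \<times> ('m, 'n) tangent_vector \<Rightarrow> ereal" where
  "backward_exit_time M A g z = Sup (ereal ` {T. 0 \<le> T \<and> (\<exists>\<gamma>. geodesic_from M A g z {-T..0} \<gamma>)})"

text \<open>The point at time \<open>t\<close>, which may be negative, of the geodesic with initial data \<open>z\<close>.\<close>

definition geodesic_point ::
  "'m topology \<Rightarrow> ('m, 'n::finite) chart set \<Rightarrow> ('m, 'n) metric \<Rightarrow>
   'm \<times> ('m, 'n) tangent_vector \<Rightarrow> real \<Rightarrow> 'm" where
  "geodesic_point M A g z t =
     (THE x. \<exists>\<gamma>. geodesic_from M A g z (closed_segment 0 t) \<gamma> \<and> \<gamma> t = x)"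

definition admissible ::
  "'m topology \<Rightarrow> ('m, 'n::finite) chart set \<Rightarrow> ('m, 'n) metric \<Rightarrow>
   'm \<times> ('m, 'n) tangent_vector \<Rightarrow> bool" where
  "admissible M A g z \<longleftrightarrow>
     (\<forall>t. - backward_exit_time M A g z < ereal t \<and> ereal t < forward_exit_time M A g z \<longrightarrow>
          geodesic_point M A g z t \<in> mfd_interior M A) \<and>
     inj_on (geodesic_point M A g z)
       {t. - backward_exit_time M A g z \<le> ereal t \<and> ereal t \<le> forward_exit_time M A g z} \<and>
     forward_exit_time M A g z < \<infinity> \<and> backward_exit_time M A g z < \<infinity>"

section \<open>Higgs fields and their scattering data\<close>

definition higgs_field ::
  "('m, 'n::finite) chart set \<Rightarrow> ('m \<Rightarrow> complex^'N^'N::finite) \<Rightarrow> bool" where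
  "higgs_field A \<Phi> \<longleftrightarrow> smooth_map A \<Phi>"

definition scattering_data ::
  "'m topology \<Rightarrow> ('m, 'n::finite) chart set \<Rightarrow> ('m, 'n) metric \<Rightarrow>
   ('m \<Rightarrow> complex^'N^'N::finite) \<Rightarrow> 'm \<times> ('m, 'n) tangent_vector \<Rightarrow> complex^'N^'N" where
  "scattering_data M A g \<Phi> z =
     (let \<tau> = real_of_ereal (forward_exit_time M A g z) in
      THE C. \<exists>U. (\<forall>t\<in>{0..\<tau>}. invertible (U t) \<and>
                     (U has_vector_derivative - (\<Phi> (geodesic_point M A g z t) ** U t))
                       (at t within {0..\<tau>})) \<and>
                 U \<tau> = mat 1 \<and> C = U 0)"

definition neighborhood_in :: "'a topology \<Rightarrow> 'a set \<Rightarrow> 'a \<Rightarrow> 'a set \<Rightarrow> bool" where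
  "neighborhood_in T S z G \<longleftrightarrow> G \<subseteq> S \<and> (\<exists>W. openin (subtopology T S) W \<and> z \<in> W \<and> W \<subseteq> G)"

end

theory Submission
  imports Defs
begin

text \<open>
  Suppose that the analytic field \<open>f = \<Phi> - \<Psi>\<close> does not vanish near \<open>x\<^sub>0\<close>. In a chart at \<open>x\<^sub>0\<close>,
  with boundary \<open>y\<^sub>n = 0\<close>, one can factor \<open>f = y\<^sub>n\<^sup>k h\<close> where the analytic function \<open>h\<close> does not
  vanish identically on the boundary near \<open>x\<^sub>0\<close> (\<open>psum_factor_hyperplane\<close>). Choose a boundary point
  \<open>x\<^sub>1\<close> near \<open>x\<^sub>0\<close> with \<open>h(x\<^sub>1) = H\<^sub>0 \<noteq> 0\<close> and a unit vector at \<open>x\<^sub>1\<close> near \<open>v\<^sub>0\<close> that points only slightly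
  inward. Strict convexity at \<open>x\<^sub>0\<close> says that the \<open>n\<close>-th component of \<open>\<Gamma>(v\<^sub>0, v\<^sub>0)\<close> is positive
  (\<open>strictly_convex_coords\<close>), so along the geodesic the function \<open>y\<^sub>n\<close> is uniformly concave: it
  is positive until the exit time \<open>\<tau>\<close>, and \<open>\<tau>\<close> is at most a constant times the inward component of
  the initial velocity (\<open>short_geodesic\<close>). Along so short a geodesic all factors except \<open>y\<^sub>n\<^sup>k\<close> are
  almost constant. The difference \<open>D\<close> of the two attenuation matrices vanishes at both ends, but
  satisfies \<open>D' = - \<Phi> D - y\<^sub>n\<^sup>k h U\<close> with \<open>U\<close> near the identity, so its inner product with
  \<open>H\<^sub>0\<close> decreases by about \<open>\<bar>H\<^sub>0\<bar>\<^sup>2 \<integral> y\<^sub>n\<^sup>k\<close>, while the term with \<open>\<Phi>\<close> only contributes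
  \<open>O(\<tau>) \<integral> y\<^sub>n\<^sup>k\<close>. This is a contradiction for small \<open>\<tau>\<close> (\<open>attenuation_distinguishes\<close>), whence
  \<open>\<Phi> = \<Psi>\<close> near \<open>x\<^sub>0\<close> (\<open>boundary_determination\<close>). Since \<open>M\<close> is connected, the identity theorem for
  analytic functions finishes the proof (\<open>analytic_identity\<close>).

  Most of the text makes this rigorous from first principles. Power series in several variables
  are differentiated term by term; iterating this gives smoothness, the symmetry of second
  derivatives and the identity theorem. Short geodesics are constructed by Picard iteration in one
  chart. A geodesic has to satisfy the geodesic equation in every chart, which rests on the
  transformation law of the Christoffel symbols (\<open>christoffel_change\<close>). The same law shows that
  the covariant derivative of the normal field is a tangent vector, which is what makes the second
  fundamental form computable in coordinates.
\<close>

section \<open>Power series in several variables\<close>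

definition monomial :: "('n::finite \<Rightarrow> nat) \<Rightarrow> real^'n \<Rightarrow> real" where
  "monomial \<alpha> x = (\<Prod>i\<in>UNIV. x $ i ^ \<alpha> i)"

definition psum :: "(('n::finite \<Rightarrow> nat) \<Rightarrow> 'b::real_normed_vector) \<Rightarrow> real^'n \<Rightarrow> 'b" where
  "psum a x = (\<Sum>\<^sub>\<infinity>\<alpha>. monomial \<alpha> x *\<^sub>R a \<alpha>)"

definition converges :: "real \<Rightarrow> (('n::finite \<Rightarrow> nat) \<Rightarrow> 'b::real_normed_vector) \<Rightarrow> bool" where
  "converges r a \<longleftrightarrow> 0 < r \<and> (\<forall>x\<in>ball 0 r. (\<lambda>\<alpha>. monomial \<alpha> x *\<^sub>R a \<alpha>) summable_on UNIV)"

text \<open>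
  The coefficients of the partial derivative in the direction \<open>i\<close>.
\<close>

definition coeff_deriv ::
  "'n \<Rightarrow> (('n::finite \<Rightarrow> nat) \<Rightarrow> 'b::real_normed_vector) \<Rightarrow> ('n \<Rightarrow> nat) \<Rightarrow> 'b" where
  "coeff_deriv i a = (\<lambda>\<alpha>. real (Suc (\<alpha> i)) *\<^sub>R a (\<alpha>(i := Suc (\<alpha> i))))"

lemma coeff_deriv_commute: "coeff_deriv i (coeff_deriv j a) = coeff_deriv j (coeff_deriv i a)"
  by (cases "i = j") (auto simp: coeff_deriv_def fun_eq_iff fun_upd_twist)

text \<open>
  Every finite set of multi-indices lies in a cube, over which the sum factorises into partial sums
  of the one-dimensional series.
\<close>

lemma summable_on_prod_multiindex:
  fixes f :: "'n::finite \<Rightarrow> nat \<Rightarrow> real"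
  assumes nn: "\<And>i k. 0 \<le> f i k" and sm: "\<And>i. summable (f i)"
  shows "(\<lambda>\<alpha>. \<Prod>i\<in>UNIV. f i (\<alpha> i)) summable_on UNIV"
proof (rule nonneg_bdd_above_summable_on)
  show "0 \<le> (\<Prod>i\<in>UNIV. f i (\<alpha> i))" for \<alpha> :: "'n \<Rightarrow> nat" by (simp add: nn prod_nonneg)
  show "bdd_above (sum (\<lambda>\<alpha>. \<Prod>i\<in>UNIV. f i (\<alpha> i)) ` {F. F \<subseteq> UNIV \<and> finite F})"
  proof (rule bdd_aboveI2)
    fix F :: "('n \<Rightarrow> nat) set" assume "F \<in> {F. F \<subseteq> UNIV \<and> finite F}"
    then have fin: "finite F" by simp
    define m where "m = Max ((\<lambda>(\<alpha>,i). \<alpha> i) ` (F \<times> UNIV) \<union> {0})"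
    have "\<alpha> i \<le> m" if "\<alpha> \<in> F" for \<alpha> i
      unfolding m_def using that fin by (intro Max_ge) force+
    then have sub: "F \<subseteq> PiE UNIV (\<lambda>_. {..m})" by auto
    have "sum (\<lambda>\<alpha>. \<Prod>i\<in>UNIV. f i (\<alpha> i)) F \<le> sum (\<lambda>\<alpha>. \<Prod>i\<in>UNIV. f i (\<alpha> i)) (PiE UNIV (\<lambda>_. {..m}))"
      by (rule sum_mono2[OF _ sub]) (auto intro: finite_PiE simp: nn prod_nonneg)
    also have "\<dots> = (\<Prod>i\<in>UNIV. \<Sum>k\<le>m. f i k)" by (subst prod_sum_PiE) auto
    also have "\<dots> \<le> (\<Prod>i\<in>UNIV. suminf (f i))"
      by (intro prod_mono) (auto simp: nn sm sum_nonneg intro!: sum_le_suminf)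
    finally show "sum (\<lambda>\<alpha>. \<Prod>i\<in>UNIV. f i (\<alpha> i)) F \<le> (\<Prod>i\<in>UNIV. suminf (f i))" .
  qed
qed

text \<open>
  Outside some finite set a single term is the difference of two partial sums that are both within
  distance 1 of the limit. Since no absolute convergence is involved, this works in every normed
  space.
\<close>

lemma summable_terms_bounded:
  fixes f :: "'a \<Rightarrow> 'b::real_normed_vector"
  assumes "f summable_on A"
  obtains K where "0 \<le> K" "\<And>x. x \<in> A \<Longrightarrow> norm (f x) \<le> K"
proof -
  obtain S where "(f has_sum S) A" using assms by (auto simp: summable_on_def)
  then have "\<forall>\<^sub>F F in finite_subsets_at_top A. dist (sum f F) S < 1"
    unfolding has_sum_def by (rule tendstoD) simp
  then obtain F0 where F0: "finite F0" "F0 \<subseteq> A"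
    and d: "\<And>F. finite F \<Longrightarrow> F0 \<subseteq> F \<Longrightarrow> F \<subseteq> A \<Longrightarrow> dist (sum f F) S < 1"
    by (auto simp: eventually_finite_subsets_at_top)
  have out: "norm (f x) \<le> 2" if "x \<in> A" "x \<notin> F0" for x
  proof -
    have e: "f x = sum f (insert x F0) - sum f F0" using that F0 by simp
    have "norm (f x) = dist (sum f (insert x F0)) (sum f F0)" unfolding dist_norm e ..
    also have "\<dots> \<le> dist (sum f (insert x F0)) S + dist (sum f F0) S" by (rule dist_triangle2)
    also have "\<dots> \<le> 1 + 1" using d[of "insert x F0"] d[of F0] F0 that by (intro add_mono) force+
    finally show ?thesis by simp
  qed
  show thesis
  proof (rule that[of "2 + (\<Sum>x\<in>F0. norm (f x))"])
    show "0 \<le> 2 + (\<Sum>x\<in>F0. norm (f x))" by (simp add: sum_nonneg)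
    fix x assume "x \<in> A"
    show "norm (f x) \<le> 2 + (\<Sum>x\<in>F0. norm (f x))"
    proof (cases "x \<in> F0")
      case True
      then have "norm (f x) \<le> (\<Sum>x\<in>F0. norm (f x))" using F0 by (intro member_le_sum) auto
      then show ?thesis by simp
    next
      case False
      with out[OF \<open>x \<in> A\<close>] have "norm (f x) \<le> 2" by simp
      then show ?thesis using sum_nonneg[of F0 "\<lambda>x. norm (f x)"] by simp
    qed
  qed
qed

lemma abs_monomial_mono:
  assumes "\<And>i. \<bar>x $ i\<bar> \<le> \<sigma> i"
  shows "\<bar>monomial \<alpha> x\<bar> \<le> (\<Prod>i\<in>UNIV. \<sigma> i ^ \<alpha> i)"
  unfolding monomial_def abs_prod using assms
  by (intro prod_mono) (auto simp: power_abs intro: power_mono)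

lemma monomial_split: "monomial \<alpha> x = x $ i ^ \<alpha> i * (\<Prod>j\<in>UNIV - {i}. x $ j ^ \<alpha> j)"
  unfolding monomial_def by (simp add: prod.remove)

lemma monomial_upd: "monomial (\<alpha>(i := k)) x = x $ i ^ k * (\<Prod>j\<in>UNIV - {i}. x $ j ^ \<alpha> j)"
  unfolding monomial_split[of _ _ i] by simp

text \<open>
  At a point \<open>\<rho>\<close> with positive coordinates that exceed in absolute value those of all points near \<open>x\<close>, the terms of
  the series are bounded. Comparison with \<open>\<rho>\<close> shows that the terms decay geometrically, uniformly
  near \<open>x\<close>, and so do their partial derivatives.
\<close>

lemma converges_term_bounds:
  fixes a :: "('n::finite \<Rightarrow> nat) \<Rightarrow> 'b::real_normed_vector" and x :: "real^'n"
  assumes cv: "converges r a" and x: "x \<in> ball 0 r"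
  obtains \<epsilon> K \<theta> where "0 < \<epsilon>" "cball x \<epsilon> \<subseteq> ball 0 r" "0 \<le> K" "0 \<le> \<theta>" "\<theta> < 1"
    "\<And>y \<alpha>. y \<in> cball x \<epsilon> \<Longrightarrow> norm (monomial \<alpha> y *\<^sub>R a \<alpha>) \<le> K * (\<Prod>i\<in>UNIV. \<theta> ^ \<alpha> i)"
    "\<And>y \<alpha> i. y \<in> cball x \<epsilon> \<Longrightarrow>
       norm ((real (\<alpha> i) * monomial (\<alpha>(i := \<alpha> i - 1)) y) *\<^sub>R a \<alpha>) \<le> K * (real (\<alpha> i) * (\<Prod>i\<in>UNIV. \<theta> ^ \<alpha> i))"
proof -
  define n where "n = real CARD('n)"
  have n: "n \<ge> 1" unfolding n_def using zero_less_card_finite[where 'a='n] by linarith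
  define \<epsilon> where "\<epsilon> = (r - norm x) / (4 * n)"
  have xr: "norm x < r" using x by simp
  have \<epsilon>: "\<epsilon> > 0" unfolding \<epsilon>_def using xr n by simp
  have \<epsilon>n: "2 * \<epsilon> * n < r - norm x" unfolding \<epsilon>_def using xr n by (simp add: field_simps)
  define \<sigma> where "\<sigma> = (\<lambda>i. \<bar>x $ i\<bar> + \<epsilon>)"
  define \<rho> :: "real^'n" where "\<rho> = (\<chi> i. \<sigma> i + \<epsilon>)"
  have \<sigma>0: "\<sigma> i \<ge> \<epsilon>" for i unfolding \<sigma>_def by simp
  have "norm \<rho> \<le> norm ((\<chi> i. \<bar>x $ i\<bar>)::real^'n) + norm ((\<chi> i. 2 * \<epsilon>)::real^'n)"
    unfolding \<rho>_def \<sigma>_def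
    by (rule order_trans[OF _ norm_triangle_ineq]) (simp add: vec_eq_iff plus_vec_def algebra_simps)
  also have "norm ((\<chi> i. \<bar>x $ i\<bar>)::real^'n) = norm x" by (simp add: norm_vec_def)
  also have "norm ((\<chi> i. 2 * \<epsilon>)::real^'n) \<le> 2 * \<epsilon> * n"
    using norm_le_l1_cart[of "(\<chi> i. 2 * \<epsilon>)::real^'n"] \<epsilon> by (simp add: n_def mult.commute)
  finally have \<rho>r: "\<rho> \<in> ball 0 r" using \<epsilon>n by simp
  obtain K0 where K0: "0 \<le> K0" "\<And>\<alpha>. norm (monomial \<alpha> \<rho> *\<^sub>R a \<alpha>) \<le> K0"
    using summable_terms_bounded[of "\<lambda>\<alpha>. monomial \<alpha> \<rho> *\<^sub>R a \<alpha>" UNIV] cv \<rho>r unfolding converges_def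
    by (metis UNIV_I)
  have \<rho>pos: "\<rho> $ i > 0" for i unfolding \<rho>_def \<sigma>_def using \<epsilon> by simp
  have mp: "monomial \<alpha> \<rho> \<ge> 0" for \<alpha> unfolding monomial_def using \<rho>pos by (simp add: less_imp_le prod_nonneg)
  define R where "R = norm x + 2 * \<epsilon>"
  have R: "R \<ge> 2 * \<epsilon>" "R > 0" unfolding R_def using \<epsilon> by (auto simp: add_nonneg_pos)
  have \<rho>R: "\<rho> $ i \<le> R" for i unfolding \<rho>_def \<sigma>_def R_def using component_le_norm_cart[of x i] by simp
  \<comment> \<open>The ratio of \<open>\<sigma> i = \<rho> $ i - \<epsilon>\<close> to \<open>\<rho> $ i\<close> is largest where \<open>\<rho> $ i\<close> is, and this is at most \<open>R\<close>.\<close>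
  define \<theta> where "\<theta> = (R - \<epsilon>) / R"
  have \<theta>: "0 \<le> \<theta>" "\<theta> < 1" unfolding \<theta>_def using R \<epsilon> by (auto simp: field_simps)
  have \<sigma>\<rho>: "\<sigma> i \<le> \<theta> * \<rho> $ i" for i
  proof -
    have "\<epsilon> * \<rho> $ i \<le> \<epsilon> * R" using \<rho>R \<epsilon> by simp
    moreover have "R * \<sigma> i = R * \<rho> $ i - R * \<epsilon>" by (simp add: \<rho>_def algebra_simps)
    ultimately have "R * \<sigma> i \<le> R * \<rho> $ i - \<epsilon> * \<rho> $ i" by (simp add: mult.commute)
    then have "R * \<sigma> i \<le> (R - \<epsilon>) * \<rho> $ i" by (simp add: left_diff_distrib)
    then show ?thesis unfolding \<theta>_def using R by (simp add: field_simps)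
  qed
  have \<sigma>m: "(\<Prod>i\<in>UNIV. \<sigma> i ^ \<alpha> i) * norm (a \<alpha>) \<le> K0 * (\<Prod>i\<in>UNIV. \<theta> ^ \<alpha> i)" for \<alpha>
  proof -
    have "(\<Prod>i\<in>UNIV. \<sigma> i ^ \<alpha> i) \<le> (\<Prod>i\<in>UNIV. (\<theta> * \<rho> $ i) ^ \<alpha> i)"
      using \<sigma>\<rho> \<sigma>0 \<epsilon> by (intro prod_mono) (meson less_le_trans less_imp_le power_mono zero_le_power)
    also have "\<dots> = (\<Prod>i\<in>UNIV. \<theta> ^ \<alpha> i) * monomial \<alpha> \<rho>"
      by (simp add: power_mult_distrib prod.distrib monomial_def)
    finally have "(\<Prod>i\<in>UNIV. \<sigma> i ^ \<alpha> i) * norm (a \<alpha>) \<le> ((\<Prod>i\<in>UNIV. \<theta> ^ \<alpha> i) * monomial \<alpha> \<rho>) * norm (a \<alpha>)"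
      by (rule mult_right_mono) simp
    also have "\<dots> = (\<Prod>i\<in>UNIV. \<theta> ^ \<alpha> i) * norm (monomial \<alpha> \<rho> *\<^sub>R a \<alpha>)" using mp by simp
    also have "\<dots> \<le> (\<Prod>i\<in>UNIV. \<theta> ^ \<alpha> i) * K0"
      using K0(2) \<theta> by (intro mult_left_mono) (auto intro!: prod_nonneg)
    finally show ?thesis by (simp add: mult.commute)
  qed
  have yb: "\<bar>y $ i\<bar> \<le> \<sigma> i" if "y \<in> cball x \<epsilon>" for y i
  proof -
    have "\<bar>y $ i\<bar> \<le> \<bar>x $ i\<bar> + \<bar>(y - x) $ i\<bar>" by simp
    moreover have "\<bar>(y - x) $ i\<bar> \<le> norm (y - x)" by (rule component_le_norm_cart)
    moreover have "norm (y - x) \<le> \<epsilon>" using that by (simp add: dist_norm norm_minus_commute)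
    ultimately show ?thesis unfolding \<sigma>_def by linarith
  qed
  show thesis
  proof (rule that[of \<epsilon> "K0 + K0 / \<epsilon>" \<theta>])
    show "cball x \<epsilon> \<subseteq> ball 0 r"
    proof
      fix y assume "y \<in> cball x \<epsilon>"
      then have "norm y \<le> norm x + \<epsilon>"
        using norm_triangle_ineq[of x "y - x"] by (simp add: dist_norm norm_minus_commute)
      moreover have "\<epsilon> \<le> 2 * \<epsilon> * n" using mult_mono[of "\<epsilon>" "2*\<epsilon>" 1 n] n \<epsilon> by simp
      ultimately show "y \<in> ball 0 r" using \<epsilon>n by simp
    qed
    have P0: "0 \<le> (\<Prod>i\<in>UNIV. \<theta> ^ \<alpha> i)" for \<alpha> :: "'n \<Rightarrow> nat" using \<theta> by (simp add: prod_nonneg)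
    fix y \<alpha> assume y: "y \<in> cball x \<epsilon>"
    have "norm (monomial \<alpha> y *\<^sub>R a \<alpha>) \<le> (\<Prod>i\<in>UNIV. \<sigma> i ^ \<alpha> i) * norm (a \<alpha>)"
      using abs_monomial_mono[of y \<sigma> \<alpha>] yb[OF y] by (simp add: mult_right_mono)
    also note \<sigma>m
    also have "K0 * (\<Prod>i\<in>UNIV. \<theta> ^ \<alpha> i) \<le> (K0 + K0 / \<epsilon>) * (\<Prod>i\<in>UNIV. \<theta> ^ \<alpha> i)"
      using K0(1) \<epsilon> P0 by (intro mult_right_mono) auto
    finally show "norm (monomial \<alpha> y *\<^sub>R a \<alpha>) \<le> (K0 + K0 / \<epsilon>) * (\<Prod>i\<in>UNIV. \<theta> ^ \<alpha> i)" .
    fix i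
    show "norm ((real (\<alpha> i) * monomial (\<alpha>(i := \<alpha> i - 1)) y) *\<^sub>R a \<alpha>)
        \<le> (K0 + K0 / \<epsilon>) * (real (\<alpha> i) * (\<Prod>i\<in>UNIV. \<theta> ^ \<alpha> i))"
    proof (cases "\<alpha> i = 0")
      case True then show ?thesis by simp
    next
      case False
      let ?\<beta> = "\<alpha>(i := \<alpha> i - 1)"
      have "(\<Prod>j\<in>UNIV. \<sigma> j ^ \<alpha> j) = \<sigma> i ^ \<alpha> i * (\<Prod>j\<in>UNIV - {i}. \<sigma> j ^ \<alpha> j)" by (simp add: prod.remove)
      moreover have "(\<Prod>j\<in>UNIV. \<sigma> j ^ ?\<beta> j) = \<sigma> i ^ (\<alpha> i - 1) * (\<Prod>j\<in>UNIV - {i}. \<sigma> j ^ \<alpha> j)"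
        by (simp add: prod.remove[of UNIV i])
      ultimately have eq: "(\<Prod>j\<in>UNIV. \<sigma> j ^ \<alpha> j) = \<sigma> i * (\<Prod>j\<in>UNIV. \<sigma> j ^ ?\<beta> j)"
        using False by (simp add: power_eq_if)
      have nn: "0 \<le> (\<Prod>j\<in>UNIV. \<sigma> j ^ ?\<beta> j)"
        using \<sigma>0 \<epsilon> by (intro prod_nonneg) (meson less_le_trans less_imp_le zero_le_power)
      have "\<epsilon> * (\<Prod>j\<in>UNIV. \<sigma> j ^ ?\<beta> j) \<le> (\<Prod>j\<in>UNIV. \<sigma> j ^ \<alpha> j)"
        unfolding eq using \<sigma>0 nn by (intro mult_right_mono)
      then have "\<epsilon> * (\<Prod>j\<in>UNIV. \<sigma> j ^ ?\<beta> j) * norm (a \<alpha>) \<le> K0 * (\<Prod>i\<in>UNIV. \<theta> ^ \<alpha> i)"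
        using \<sigma>m[of \<alpha>] by (meson mult_right_mono norm_ge_zero order_trans)
      moreover have "\<bar>monomial ?\<beta> y\<bar> \<le> (\<Prod>j\<in>UNIV. \<sigma> j ^ ?\<beta> j)" by (rule abs_monomial_mono[OF yb[OF y]])
      then have "\<epsilon> * \<bar>monomial ?\<beta> y\<bar> * norm (a \<alpha>) \<le> \<epsilon> * (\<Prod>j\<in>UNIV. \<sigma> j ^ ?\<beta> j) * norm (a \<alpha>)"
        using \<epsilon> by (intro mult_right_mono mult_left_mono) auto
      ultimately have "\<epsilon> * \<bar>monomial ?\<beta> y\<bar> * norm (a \<alpha>) \<le> K0 * (\<Prod>i\<in>UNIV. \<theta> ^ \<alpha> i)" by linarith
      then have "\<bar>monomial ?\<beta> y\<bar> * norm (a \<alpha>) \<le> K0 / \<epsilon> * (\<Prod>i\<in>UNIV. \<theta> ^ \<alpha> i)"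
        using \<epsilon> by (simp add: field_simps)
      also have "\<dots> \<le> (K0 + K0 / \<epsilon>) * (\<Prod>i\<in>UNIV. \<theta> ^ \<alpha> i)"
        using K0(1) P0 by (intro mult_right_mono) auto
      finally have "real (\<alpha> i) * (\<bar>monomial ?\<beta> y\<bar> * norm (a \<alpha>))
          \<le> real (\<alpha> i) * ((K0 + K0 / \<epsilon>) * (\<Prod>i\<in>UNIV. \<theta> ^ \<alpha> i))"
        by (rule mult_left_mono) simp
      then show ?thesis by (simp add: abs_mult ac_simps)
    qed
  qed (use \<epsilon> \<theta> K0 in auto)
qed

lemma has_derivative_monomial:
  "(monomial \<alpha> has_derivative (\<lambda>h. \<Sum>i\<in>UNIV. h $ i * (real (\<alpha> i) * monomial (\<alpha>(i := \<alpha> i - 1)) x))) (at x within S)"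
proof -
  have "((\<lambda>x. \<Prod>i\<in>UNIV. x $ i ^ \<alpha> i) has_derivative
     (\<lambda>h. \<Sum>i\<in>UNIV. (real (\<alpha> i) * h $ i * x $ i ^ (\<alpha> i - 1)) * (\<Prod>j\<in>UNIV - {i}. x $ j ^ \<alpha> j))) (at x within S)"
    by (intro has_derivative_prod has_derivative_power bounded_linear.has_derivative[OF bounded_linear_vec_nth] has_derivative_ident)
  then show ?thesis
    unfolding monomial_upd by (simp add: ac_simps flip: monomial_def)
qed

lemma summable_on_geometric_multiindex:
  assumes "0 \<le> \<theta>" "\<theta> < (1::real)"
  shows "(\<lambda>\<alpha>::'n::finite \<Rightarrow> nat. \<Prod>i\<in>UNIV. \<theta> ^ \<alpha> i) summable_on UNIV"
  by (rule summable_on_prod_multiindex[where f = "\<lambda>i k. \<theta> ^ k"]) (use assms in \<open>auto intro: summable_geometric\<close>)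

lemma summable_on_geometric_deriv_multiindex:
  fixes i :: "'n::finite"
  assumes "0 \<le> \<theta>" "\<theta> < (1::real)"
  shows "(\<lambda>\<alpha>. real (\<alpha> i) * (\<Prod>j\<in>UNIV. \<theta> ^ \<alpha> j)) summable_on UNIV"
proof -
  let ?f = "\<lambda>j k. (if j = i then real k else 1) * \<theta> ^ k"
  have "summable (\<lambda>k. real k * \<theta> ^ k)"
  proof (rule summable_comparison_test'[of "\<lambda>k. real (Suc k) * \<theta> ^ k" 0])
    show "summable (\<lambda>k. real (Suc k) * \<theta> ^ k)"
      by (rule sums_summable, rule geometric_deriv_sums) (use assms in simp)
    show "norm (real k * \<theta> ^ k) \<le> real (Suc k) * \<theta> ^ k" for k
      using assms by (simp add: abs_mult mult_right_mono)
  qed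
  then have sm: "summable (?f j)" for j
    using assms summable_geometric[of \<theta>] by (cases "j = i") simp_all
  have "(\<lambda>\<alpha>. \<Prod>j\<in>UNIV. ?f j (\<alpha> j)) summable_on UNIV"
    by (rule summable_on_prod_multiindex[where f = ?f, OF _ sm]) (use assms in simp)
  moreover have "(\<Prod>j\<in>UNIV. ?f j (\<alpha> j)) = real (\<alpha> i) * (\<Prod>j\<in>UNIV. \<theta> ^ \<alpha> j)" for \<alpha> :: "'n \<Rightarrow> nat"
    by (simp add: prod.distrib prod.delta)
  ultimately show ?thesis by simp
qed

text \<open>
  Shifting the \<open>i\<close>-th exponent by one; the multi-indices that are not hit carry the factor
  \<open>\<alpha> i = 0\<close>.
\<close>

lemma coeff_deriv_reindex:
  fixes a :: "('n::finite \<Rightarrow> nat) \<Rightarrow> 'b::real_normed_vector"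
  shows "((\<lambda>\<alpha>. monomial \<alpha> y *\<^sub>R coeff_deriv i a \<alpha>) has_sum S) UNIV \<longleftrightarrow>
     ((\<lambda>\<alpha>. (real (\<alpha> i) * monomial (\<alpha>(i := \<alpha> i - 1)) y) *\<^sub>R a \<alpha>) has_sum S) UNIV" (is "?L \<longleftrightarrow> ?R")
proof -
  let ?f = "\<lambda>\<alpha>. (real (\<alpha> i) * monomial (\<alpha>(i := \<alpha> i - 1)) y) *\<^sub>R a \<alpha>"
  let ?h = "\<lambda>\<alpha>. \<alpha>(i := Suc (\<alpha> i))"
  have inj: "inj ?h"
  proof (rule injI)
    fix x y assume e: "?h x = ?h y"
    have "x j = y j" for j using fun_cong[OF e, of j] by (auto split: if_splits)
    then show "x = y" by auto
  qed
  have rng: "\<alpha> \<in> range ?h" if "\<alpha> i \<noteq> 0" for \<alpha>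
    using that by (intro image_eqI[of _ _ "\<alpha>(i := \<alpha> i - 1)"]) auto
  have "?R \<longleftrightarrow> (?f has_sum S) (range ?h)"
    using rng by (intro has_sum_cong_neutral) auto
  also have "\<dots> \<longleftrightarrow> ((?f \<circ> ?h) has_sum S) UNIV" by (rule has_sum_reindex[OF inj])
  also have "?f \<circ> ?h = (\<lambda>\<alpha>. monomial \<alpha> y *\<^sub>R coeff_deriv i a \<alpha>)"
    by (simp add: o_def coeff_deriv_def[abs_def] mult.commute)
  finally show ?thesis ..
qed

lemma converges_radius_pos: "converges r a \<Longrightarrow> 0 < r" by (simp add: converges_def)

text \<open>
  The geometric bounds justify differentiation term by term. The differentiated series converges
  on the same ball, so that the step can be repeated: this is the source of all smoothness below.
\<close>

lemma
  fixes a :: "('n::finite \<Rightarrow> nat) \<Rightarrow> 'b::banach"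
  assumes cv: "converges r a"
  shows converges_coeff_deriv: "converges r (coeff_deriv i a)"
    and has_derivative_psum: "x \<in> ball 0 r \<Longrightarrow>
      (psum a has_derivative (\<lambda>h. \<Sum>i\<in>UNIV. h $ i *\<^sub>R psum (coeff_deriv i a) x)) (at x)"
proof -
  have main: "(\<lambda>\<alpha>. monomial \<alpha> x *\<^sub>R coeff_deriv i a \<alpha>) summable_on UNIV \<and>
      (psum a has_derivative (\<lambda>h. \<Sum>i\<in>UNIV. h $ i *\<^sub>R psum (coeff_deriv i a) x)) (at x)"
    if x: "x \<in> ball 0 r" for x i
  proof -
    from converges_term_bounds[OF cv x] obtain \<epsilon> K \<theta> where e: "0 < \<epsilon>" "cball x \<epsilon> \<subseteq> ball 0 r" "0 \<le> K" "0 \<le> \<theta>" "\<theta> < 1"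
      and b0: "\<And>y \<alpha>. y \<in> cball x \<epsilon> \<Longrightarrow> norm (monomial \<alpha> y *\<^sub>R a \<alpha>) \<le> K * (\<Prod>i\<in>UNIV. \<theta> ^ \<alpha> i)"
      and b1: "\<And>y \<alpha> i. y \<in> cball x \<epsilon> \<Longrightarrow>
       norm ((real (\<alpha> i) * monomial (\<alpha>(i := \<alpha> i - 1)) y) *\<^sub>R a \<alpha>) \<le> K * (real (\<alpha> i) * (\<Prod>i\<in>UNIV. \<theta> ^ \<alpha> i))"
      by metis
    define s where "s = (\<lambda>i y \<alpha>. (real (\<alpha> i) * monomial (\<alpha>(i := \<alpha> i - 1)) y) *\<^sub>R a \<alpha>)"
    define B where "B = (\<lambda>(i::'n) \<alpha>. K * (real (\<alpha> i) * (\<Prod>i\<in>UNIV. \<theta> ^ \<alpha> i)))"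
    have Bs: "B i summable_on UNIV" for i
      unfolding B_def by (rule summable_on_cmult_right, rule summable_on_geometric_deriv_multiindex[OF e(4,5)])
    have ssum: "s i y summable_on UNIV" if "y \<in> cball x \<epsilon>" for i y
    proof (rule abs_summable_summable, rule summable_on_comparison_test[OF Bs[of i]])
      show "norm (s i y \<alpha>) \<le> B i \<alpha>" for \<alpha> using b1[OF that] by (simp only: s_def B_def)
    qed simp
    have sS: "(s i y has_sum psum (coeff_deriv i a) y) UNIV" if "y \<in> cball x \<epsilon>" for i y
    proof -
      have "(s i y has_sum (infsum (s i y) UNIV)) UNIV" using ssum[OF that] by simp
      then have 1: "((\<lambda>\<alpha>. monomial \<alpha> y *\<^sub>R coeff_deriv i a \<alpha>) has_sum (infsum (s i y) UNIV)) UNIV"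
        unfolding s_def by (subst coeff_deriv_reindex)
      then have "psum (coeff_deriv i a) y = infsum (s i y) UNIV" unfolding psum_def by (rule infsumI)
      then show ?thesis using ssum[OF that] by simp
    qed
    have inf: "infinite (UNIV :: ('n \<Rightarrow> nat) set)"
    proof -
      have "inj (\<lambda>k::nat. (\<lambda>_::'n. k))" by (auto simp: inj_def fun_eq_iff)
      then show ?thesis using finite_imageD infinite_UNIV_nat by (metis finite_subset subset_UNIV)
    qed
    have "countable (UNIV :: ('n \<Rightarrow> nat) set)"
      using countable_PiE[of "UNIV::'n set" "\<lambda>_. UNIV::nat set"] by simp
    \<comment> \<open>An enumeration of the multi-indices turns the unordered sums into ordinary series, for which
      term-by-term differentiation under uniform convergence is available.\<close>
    then obtain e :: "nat \<Rightarrow> 'n \<Rightarrow> nat" where bij: "bij_betw e UNIV UNIV"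
      using inf countableE_infinite by (metis bij_betw_inv_into)
    have to_sums: "(\<lambda>k. f (e k)) sums S" if "(f has_sum S) UNIV" for f S
      using that has_sum_reindex_bij_betw[OF bij, of f S] by (intro has_sum_imp_sums) simp
    have ul: "uniform_limit (cball x \<epsilon>) (\<lambda>n y. \<Sum>k<n. s i y (e k)) (\<lambda>y. psum (coeff_deriv i a) y) sequentially" for i
    proof -
      have "uniform_limit (cball x \<epsilon>) (\<lambda>n y. \<Sum>k<n. s i y (e k)) (\<lambda>y. suminf (\<lambda>k. s i y (e k))) sequentially"
      proof (rule Weierstrass_m_test)
        show "norm (s i y (e k)) \<le> B i (e k)" if "y \<in> cball x \<epsilon>" for k y
          using b1[OF that] by (simp add: s_def B_def)
        show "summable (\<lambda>k. B i (e k))"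
          using to_sums[OF has_sum_infsum[OF Bs]] by (simp add: sums_iff)
      qed
      moreover have "suminf (\<lambda>k. s i y (e k)) = psum (coeff_deriv i a) y" if "y \<in> cball x \<epsilon>" for y
        using to_sums[OF sS[OF that]] by (simp add: sums_iff)
      ultimately show ?thesis by (subst uniform_limit_cong') simp_all
    qed
    let ?T = "\<lambda>k y. monomial (e k) y *\<^sub>R a (e k)"
    let ?g' = "\<lambda>y h. \<Sum>i\<in>UNIV. h $ i *\<^sub>R psum (coeff_deriv i a) y"
    have T: "(\<lambda>k. ?T k y) sums psum a y" if "y \<in> cball x \<epsilon>" for y
    proof -
      have "(\<lambda>\<alpha>. monomial \<alpha> y *\<^sub>R a \<alpha>) summable_on UNIV" using cv that e(2) by (auto simp: converges_def)
      then show ?thesis unfolding psum_def by (intro to_sums has_sum_infsum)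
    qed
    have "\<exists>g. \<forall>y\<in>cball x \<epsilon>. (\<lambda>k. ?T k y) sums g y \<and> (g has_derivative ?g' y) (at y within cball x \<epsilon>)"
    proof (rule has_derivative_series[where f' = "\<lambda>k y h. \<Sum>i\<in>UNIV. h $ i *\<^sub>R s i y (e k)"])
      show "convex (cball x \<epsilon>)" by simp
      show "x \<in> cball x \<epsilon>" using e by simp
      show "(\<lambda>k. ?T k x) sums psum a x" by (rule T) (use e in simp)
      show "(?T k has_derivative (\<lambda>h. \<Sum>i\<in>UNIV. h $ i *\<^sub>R s i y (e k))) (at y within cball x \<epsilon>)" for k y
        by (rule has_derivative_eq_rhs[OF has_derivative_scaleR_left[OF has_derivative_monomial]])
          (simp add: s_def scaleR_left.sum)
      fix d :: real assume d: "d > 0"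
      define d' where "d' = d / real CARD('n)"
      have d': "d' > 0" using d by (simp add: d'_def)
      have "\<forall>\<^sub>F n in sequentially. \<forall>i. \<forall>y\<in>cball x \<epsilon>. dist (\<Sum>k<n. s i y (e k)) (psum (coeff_deriv i a) y) < d'"
        using ul d' by (auto simp: uniform_limit_iff intro: eventually_all_finite)
      then show "\<forall>\<^sub>F n in sequentially. \<forall>y\<in>cball x \<epsilon>. \<forall>h.
          norm ((\<Sum>k<n. \<Sum>i\<in>UNIV. h $ i *\<^sub>R s i y (e k)) - ?g' y h) \<le> d * norm h"
      proof eventually_elim
        case (elim n)
        show ?case
        proof (intro ballI allI)
          fix y h assume y: "y \<in> cball x \<epsilon>"
          have "(\<Sum>k<n. \<Sum>i\<in>UNIV. h $ i *\<^sub>R s i y (e k)) - ?g' y h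
              = (\<Sum>i\<in>UNIV. h $ i *\<^sub>R ((\<Sum>k<n. s i y (e k)) - psum (coeff_deriv i a) y))"
            by (subst sum.swap) (simp add: scaleR_diff_right sum_subtractf scaleR_sum_right)
          also have "norm \<dots> \<le> (\<Sum>i\<in>(UNIV::'n set). norm h * d')"
          proof (rule sum_norm_le)
            fix i
            have "norm ((\<Sum>k<n. s i y (e k)) - psum (coeff_deriv i a) y) \<le> d'"
              using elim y by (simp add: dist_norm less_imp_le)
            then show "norm (h $ i *\<^sub>R ((\<Sum>k<n. s i y (e k)) - psum (coeff_deriv i a) y)) \<le> norm h * d'"
              using component_le_norm_cart[of h i] by (simp add: mult_mono)
          qed
          also have "\<dots> = d * norm h" by (simp add: d'_def)
          finally show "norm ((\<Sum>k<n. \<Sum>i\<in>UNIV. h $ i *\<^sub>R s i y (e k)) - ?g' y h) \<le> d * norm h" .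
        qed
      qed
    qed
    then obtain G where G: "\<And>y. y \<in> cball x \<epsilon> \<Longrightarrow> (\<lambda>k. ?T k y) sums G y"
      "\<And>y. y \<in> cball x \<epsilon> \<Longrightarrow> (G has_derivative ?g' y) (at y within cball x \<epsilon>)" by blast
    have "G y = psum a y" if "y \<in> cball x \<epsilon>" for y using G(1)[OF that] T[OF that] sums_unique2 by blast
    then have "(psum a has_derivative ?g' x) (at x within cball x \<epsilon>)"
      using G(2)[of x] e(1) by (intro has_derivative_transform[of x "cball x \<epsilon>" "psum a" G]) auto
    then have "(psum a has_derivative ?g' x) (at x)"
      using e(1) at_within_interior[of x "cball x \<epsilon>"] by simp
    moreover have "(\<lambda>\<alpha>. monomial \<alpha> x *\<^sub>R coeff_deriv i a \<alpha>) summable_on UNIV"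
      using sS[of x i, unfolded s_def, folded coeff_deriv_reindex] e(1) unfolding summable_on_def by auto
    ultimately show ?thesis by blast
  qed
  show "converges r (coeff_deriv i a)" using main[of _ i] cv unfolding converges_def by blast
  show "x \<in> ball 0 r \<Longrightarrow>
      (psum a has_derivative (\<lambda>h. \<Sum>i\<in>UNIV. h $ i *\<^sub>R psum (coeff_deriv i a) x)) (at x)" using main by blast
qed

lemma continuous_on_psum:
  fixes a :: "('n::finite \<Rightarrow> nat) \<Rightarrow> 'b::banach"
  assumes "converges r a"
  shows "continuous_on (ball 0 r) (psum a)"
  by (rule has_derivative_continuous_on, rule has_derivative_at_withinI, rule has_derivative_psum[OF assms])

lemma psum_0: "psum a 0 = a (\<lambda>_. 0)"
proof -
  have "psum a 0 = (\<Sum>\<^sub>\<infinity>\<alpha>\<in>{\<lambda>_. 0}. monomial \<alpha> 0 *\<^sub>R a \<alpha>)"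
    unfolding psum_def by (rule infsum_cong_neutral) (auto simp: monomial_def fun_eq_iff zero_power)
  also have "\<dots> = a (\<lambda>_. 0)" by (simp add: monomial_def)
  finally show ?thesis .
qed

text \<open>
  By induction on the order: the constant coefficient is a limit of zeros, and every other
  coefficient is a nonzero multiple of a coefficient of lower order of some partial derivative, which
  vanishes on \<open>V\<close> as well. The set \<open>V\<close> only has to accumulate at the centre. This covers centres on
  the boundary of the half-space, with \<open>V\<close> inside, and is the step needed for analytic continuation.
\<close>

lemma psum_zero_coeffs_zero:
  fixes a :: "('n::finite \<Rightarrow> nat) \<Rightarrow> 'b::banach"
  assumes "converges r a" "open V" "0 \<in> closure V" "\<And>x. x \<in> V \<Longrightarrow> x \<in> ball 0 r \<Longrightarrow> psum a x = 0"
  shows "a \<alpha> = 0"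
  using assms
proof (induction "\<Sum>i\<in>UNIV. \<alpha> i" arbitrary: a \<alpha>)
  case 0
  then have \<alpha>: "\<alpha> = (\<lambda>_. 0)" by (auto simp: fun_eq_iff)
  have r: "0 < r" using 0 by (simp add: converges_def)
  have "0 \<in> ball 0 r \<inter> closure V" using 0(4) r by simp
  then have "0 \<in> closure (ball 0 r \<inter> V)" using open_Int_closure_subset[OF open_ball] by blast
  then obtain q where q: "\<And>n. q n \<in> ball 0 r \<inter> V" "q \<longlonglongrightarrow> 0" unfolding closure_sequential by blast
  have "isCont (psum a) 0"
    using continuous_on_psum[OF 0(2)] r by (simp add: continuous_on_eq_continuous_at)
  then have "(\<lambda>n. psum a (q n)) \<longlonglongrightarrow> psum a 0" using q(2) by (rule isCont_tendsto_compose)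
  moreover have "(\<lambda>n. psum a (q n)) = (\<lambda>_. 0)" using q(1) 0(5) by (intro ext) blast
  ultimately have "psum a 0 = 0" by (simp add: LIMSEQ_const_iff)
  then show ?case unfolding \<alpha> psum_0 .
next
  case (Suc m)
  then obtain i where i: "\<alpha> i \<noteq> 0" by (metis sum.neutral nat.distinct(1))
  define \<beta> where "\<beta> = \<alpha>(i := \<alpha> i - 1)"
  have \<alpha>: "\<alpha> = \<beta>(i := Suc (\<beta> i))" using i by (auto simp: \<beta>_def fun_eq_iff)
  have "(\<Sum>j\<in>UNIV. \<alpha> j) = \<alpha> i + (\<Sum>j\<in>UNIV - {i}. \<alpha> j)" by (simp add: sum.remove)
  moreover have "(\<Sum>j\<in>UNIV. \<beta> j) = \<beta> i + (\<Sum>j\<in>UNIV - {i}. \<beta> j)" by (simp add: sum.remove)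
  moreover have "(\<Sum>j\<in>UNIV - {i}. \<beta> j) = (\<Sum>j\<in>UNIV - {i}. \<alpha> j)" by (rule sum.cong) (auto simp: \<beta>_def)
  moreover have "\<alpha> i = Suc (\<beta> i)" using i by (simp add: \<beta>_def)
  ultimately have m: "m = (\<Sum>j\<in>UNIV. \<beta> j)" using Suc(2) by linarith
  have "coeff_deriv i a \<beta> = 0"
  proof (rule Suc(1)[OF m])
    show "converges r (coeff_deriv i a)" using Suc(3) by (rule converges_coeff_deriv)
    fix x assume x: "x \<in> V" "x \<in> ball 0 r"
    have "(psum a has_derivative (\<lambda>h. \<Sum>i\<in>UNIV. h $ i *\<^sub>R psum (coeff_deriv i a) x)) (at x)"
      by (rule has_derivative_psum[OF Suc(3) x(2)])
    moreover have "(psum a has_derivative (\<lambda>h. 0)) (at x)"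
    proof (rule has_derivative_transform_within_open[of "\<lambda>_. 0" _ _ _ "V \<inter> ball 0 r"])
      show "open (V \<inter> ball 0 r)" using Suc(4) by (intro open_Int) auto
      show "0 = psum a y" if "y \<in> V \<inter> ball 0 r" for y using Suc(6)[of y] that by simp
    qed (use x in auto)
    ultimately have "(\<lambda>h::real^'n. \<Sum>j\<in>UNIV. h $ j *\<^sub>R psum (coeff_deriv j a) x) = (\<lambda>h. 0)"
      by (rule has_derivative_unique)
    from fun_cong[OF this, of "axis i 1"]
    have "(\<Sum>j\<in>UNIV. (if j = i then psum (coeff_deriv j a) x else 0)) = 0"
      by (simp add: axis_def if_distrib[of "\<lambda>c. c *\<^sub>R _"] cong: if_cong)
    then show "psum (coeff_deriv i a) x = 0" by simp
  qed (rule Suc(4) Suc(5))+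
  then show ?case unfolding \<alpha> coeff_deriv_def by simp
qed

text \<open>
  At points off the hyperplane the terms of the quotient are those of \<open>a\<close> divided by a constant; all
  other points are dominated by such points.
\<close>

lemma converges_shift:
  fixes a :: "('n::finite \<Rightarrow> nat) \<Rightarrow> 'b::banach" and j :: 'n
  assumes cv: "converges r a" and low: "\<And>\<alpha>. \<alpha> j < k \<Longrightarrow> a \<alpha> = 0"
  defines "b \<equiv> \<lambda>\<alpha>. a (\<alpha>(j := \<alpha> j + k))"
  shows "converges r b" and "x \<in> ball 0 r \<Longrightarrow> psum a x = (x $ j ^ k) *\<^sub>R psum b x"
proof -
  let ?h = "\<lambda>\<alpha>. \<alpha>(j := \<alpha> j + k)"
  have inj: "inj ?h"
  proof (rule injI)
    fix x y assume e: "?h x = ?h y"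
    have "x i = y i" for i using fun_cong[OF e, of i] by (auto split: if_splits)
    then show "x = y" by auto
  qed
  have rng: "a \<alpha> = 0" if "\<alpha> \<notin> range ?h" for \<alpha>
  proof (rule low, rule ccontr)
    assume "\<not> \<alpha> j < k"
    then have "\<alpha> = ?h (\<alpha>(j := \<alpha> j - k))" by auto
    then show False using that by blast
  qed
  have eq: "((\<lambda>\<alpha>. monomial \<alpha> x *\<^sub>R a \<alpha>) has_sum S) UNIV \<longleftrightarrow>
      ((\<lambda>\<alpha>. (x $ j ^ k) *\<^sub>R (monomial \<alpha> x *\<^sub>R b \<alpha>)) has_sum S) UNIV" for x S
  proof -
    have "((\<lambda>\<alpha>. monomial \<alpha> x *\<^sub>R a \<alpha>) has_sum S) UNIV \<longleftrightarrow> ((\<lambda>\<alpha>. monomial \<alpha> x *\<^sub>R a \<alpha>) has_sum S) (range ?h)"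
      using rng by (intro has_sum_cong_neutral) auto
    also have "\<dots> \<longleftrightarrow> (((\<lambda>\<alpha>. monomial \<alpha> x *\<^sub>R a \<alpha>) \<circ> ?h) has_sum S) UNIV" by (rule has_sum_reindex[OF inj])
    also have "(\<lambda>\<alpha>. monomial \<alpha> x *\<^sub>R a \<alpha>) \<circ> ?h = (\<lambda>\<alpha>. (x $ j ^ k) *\<^sub>R (monomial \<alpha> x *\<^sub>R b \<alpha>))"
      by (auto simp: fun_eq_iff b_def monomial_upd monomial_split[of _ _ j] power_add ac_simps)
    finally show ?thesis .
  qed
  show cb: "converges r b"
    unfolding converges_def
  proof (intro conjI ballI)
    show "0 < r" using cv by (simp add: converges_def)
    fix x :: "real^'n" assume x: "x \<in> ball 0 r"
    from converges_term_bounds[OF cv x] obtain \<epsilon> K \<theta> where e: "0 < \<epsilon>" "0 \<le> K" "0 \<le> \<theta>" "\<theta> < 1"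
      and bd: "\<And>y \<alpha>. y \<in> cball x \<epsilon> \<Longrightarrow> norm (monomial \<alpha> y *\<^sub>R a \<alpha>) \<le> K * (\<Prod>i\<in>UNIV. \<theta> ^ \<alpha> i)"
      by metis
    \<comment> \<open>Moving away from the hyperplane \<open>x $ j = 0\<close>, where the division is impossible, only enlarges the terms.\<close>
    define y where "y = x + (if x $ j < 0 then - \<epsilon> else \<epsilon>) *\<^sub>R axis j 1"
    have y: "y \<in> cball x \<epsilon>" using e by (simp add: y_def dist_norm)
    have yj: "\<bar>x $ j\<bar> \<le> \<bar>y $ j\<bar>" "0 < \<bar>y $ j\<bar>" using e by (auto simp: y_def)
    have yi: "\<bar>x $ i\<bar> \<le> \<bar>y $ i\<bar>" for i using yj(1) by (cases "i = j") (auto simp: y_def axis_def)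
    show "(\<lambda>\<alpha>. monomial \<alpha> x *\<^sub>R b \<alpha>) summable_on UNIV"
    proof (rule abs_summable_summable, rule summable_on_comparison_test)
      show "(\<lambda>\<alpha>::'n \<Rightarrow> nat. K / \<bar>y $ j\<bar> ^ k * (\<Prod>i\<in>UNIV. \<theta> ^ \<alpha> i)) summable_on UNIV"
        by (rule summable_on_cmult_right, rule summable_on_geometric_multiindex[OF e(3,4)])
      fix \<beta> :: "'n \<Rightarrow> nat"
      have "\<bar>y $ j\<bar> ^ k * norm (monomial \<beta> x *\<^sub>R b \<beta>) \<le> \<bar>y $ j\<bar> ^ k * norm (monomial \<beta> y *\<^sub>R b \<beta>)"
        using yi by (auto intro!: mult_left_mono mult_right_mono prod_mono power_mono
            simp: monomial_def abs_prod power_abs)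
      also have "\<dots> = norm (monomial (?h \<beta>) y *\<^sub>R a (?h \<beta>))"
        by (simp add: b_def monomial_upd monomial_split[of \<beta> y j] power_add abs_mult power_abs)
      also have "\<dots> \<le> K * (\<Prod>i\<in>UNIV. \<theta> ^ (?h \<beta>) i)" by (rule bd[OF y])
      also have "\<dots> \<le> K * (\<Prod>i\<in>UNIV. \<theta> ^ \<beta> i)"
        using e by (intro mult_left_mono prod_mono) (auto intro: power_decreasing)
      finally show "norm (monomial \<beta> x *\<^sub>R b \<beta>) \<le> K / \<bar>y $ j\<bar> ^ k * (\<Prod>i\<in>UNIV. \<theta> ^ \<beta> i)"
        using yj(2) by (simp add: field_simps)
    qed simp
  qed
  assume "x \<in> ball 0 r"
  then have "((\<lambda>\<alpha>. monomial \<alpha> x *\<^sub>R b \<alpha>) has_sum psum b x) UNIV"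
    using cb by (auto simp: converges_def psum_def)
  then have "((\<lambda>\<alpha>. (x $ j ^ k) *\<^sub>R (monomial \<alpha> x *\<^sub>R b \<alpha>)) has_sum ((x $ j ^ k) *\<^sub>R psum b x)) UNIV"
    by (rule has_sum_bounded_linear[OF bounded_linear_scaleR_right])
  then show "psum a x = (x $ j ^ k) *\<^sub>R psum b x"
    unfolding eq[symmetric] psum_def by (rule infsumI)
qed

lemma psum_restrict_hyperplane:
  fixes b :: "('n::finite \<Rightarrow> nat) \<Rightarrow> 'b::banach" and j :: 'n
  assumes cv: "converges r b"
  defines "b0 \<equiv> \<lambda>\<alpha>. if \<alpha> j = 0 then b \<alpha> else 0"
  shows "converges r b0" and "psum b0 x = psum b (\<chi> i. if i = j then 0 else x $ i)"
proof -
  let ?P = "\<lambda>x::real^'n. (\<chi> i. if i = j then 0 else x $ i)::real^'n"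
  have t: "monomial \<alpha> (?P x) *\<^sub>R b \<alpha> = monomial \<alpha> x *\<^sub>R b0 \<alpha>" for x \<alpha>
    unfolding monomial_split[of \<alpha> _ j] by (cases "\<alpha> j") (auto simp: b0_def intro!: prod.cong)
  have nP: "norm (?P x) \<le> norm x" for x
    unfolding norm_vec_def by (intro L2_set_mono) auto
  have "?P x \<in> ball 0 r" if "x \<in> ball 0 r" for x using nP[of x] that by simp
  then show "converges r b0" using cv unfolding converges_def by (simp add: t[symmetric])
  show "psum b0 x = psum b (?P x)" by (simp add: psum_def t)
qed

text \<open>
  Here \<open>k\<close> is the least exponent of \<open>x $ j\<close> in a term with nonzero coefficient. If the quotient
  vanished near the origin on the hyperplane, then the series of its restriction, extended
  constantly in the direction \<open>j\<close>, would have zero coefficients, against the choice of \<open>k\<close>.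
\<close>

lemma psum_factor_hyperplane:
  fixes a :: "('n::finite \<Rightarrow> nat) \<Rightarrow> 'b::banach" and j :: 'n
  assumes cv: "converges r a" and nz: "a \<alpha>0 \<noteq> 0"
  obtains k b where "converges r b" "\<And>x. x \<in> ball 0 r \<Longrightarrow> psum a x = (x $ j ^ k) *\<^sub>R psum b x"
    "\<And>\<epsilon>. 0 < \<epsilon> \<Longrightarrow> \<exists>q. norm q < \<epsilon> \<and> q $ j = 0 \<and> psum b q \<noteq> 0"
proof -
  define k where "k = (LEAST k. \<exists>\<alpha>. \<alpha> j = k \<and> a \<alpha> \<noteq> 0)"
  have "\<exists>k \<alpha>. \<alpha> j = k \<and> a \<alpha> \<noteq> 0" using nz by blast
  then have "\<exists>\<alpha>. \<alpha> j = k \<and> a \<alpha> \<noteq> 0" unfolding k_def by (rule LeastI_ex)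
  then obtain \<alpha> where \<alpha>: "\<alpha> j = k" "a \<alpha> \<noteq> 0" by blast
  have low: "\<And>\<alpha>. \<alpha> j < k \<Longrightarrow> a \<alpha> = 0" using not_less_Least unfolding k_def by blast
  define b where "b = (\<lambda>\<alpha>. a (\<alpha>(j := \<alpha> j + k)))"
  define b0 where "b0 = (\<lambda>\<alpha>. if \<alpha> j = 0 then b \<alpha> else 0)"
  note sh = converges_shift[where j=j and k=k, OF cv low, folded b_def]
  have cb0: "converges r b0" "\<And>x. psum b0 x = psum b (\<chi> i. if i = j then 0 else x $ i)"
    unfolding b0_def using psum_restrict_hyperplane[where j=j, OF sh(1)] by auto
  show thesis
  proof (rule that[of b k, OF sh])
    fix \<epsilon> :: real assume \<epsilon>: "0 < \<epsilon>"
    show "\<exists>q. norm q < \<epsilon> \<and> q $ j = 0 \<and> psum b q \<noteq> 0"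
    proof (rule ccontr)
      assume no: "\<not> ?thesis"
      have "b0 (\<alpha>(j := 0)) = 0"
      proof (rule psum_zero_coeffs_zero[OF cb0(1), of "ball 0 \<epsilon>"])
        show "0 \<in> closure (ball (0::real^'n) \<epsilon>)" using \<epsilon> closure_subset by fastforce
        fix x :: "real^'n" assume x: "x \<in> ball 0 \<epsilon>"
        have "norm ((\<chi> i. if i = j then 0 else x $ i)::real^'n) \<le> norm x"
          unfolding norm_vec_def by (intro L2_set_mono) auto
        then have "norm ((\<chi> i. if i = j then 0 else x $ i)::real^'n) < \<epsilon>" using x by simp
        then show "psum b0 x = 0" using no unfolding cb0(2) by auto
      qed simp
      moreover have "\<alpha>(j := k) = \<alpha>" using \<alpha>(1) by auto
      ultimately show False using \<alpha> by (simp add: b0_def b_def)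
    qed
  qed
qed

section \<open>Ordinary differential equations\<close>

text \<open>
  The weight \<open>exp (- 2 * L * t)\<close> turns the squared distance of two solutions into a nonincreasing
  function.
\<close>

lemma ode_unique:
  fixes x y :: "real \<Rightarrow> 'a::real_inner"
  assumes x: "\<And>t. t \<in> {a..b} \<Longrightarrow> (x has_vector_derivative f t (x t)) (at t within {a..b})"
    and y: "\<And>t. t \<in> {a..b} \<Longrightarrow> (y has_vector_derivative f t (y t)) (at t within {a..b})"
    and lip: "\<And>t. t \<in> {a..b} \<Longrightarrow> norm (f t (x t) - f t (y t)) \<le> L * norm (x t - y t)"
    and init: "x a = y a" and t: "t \<in> {a..b}"
  shows "x t = y t"
proof -
  define z where "z = (\<lambda>t. x t - y t)"
  define \<phi> where "\<phi> = (\<lambda>t. exp (- 2 * L * t) * (z t \<bullet> z t))"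
  have z: "(z has_vector_derivative f t (x t) - f t (y t)) (at t within {a..b})" if "t \<in> {a..b}" for t
    unfolding z_def by (intro has_vector_derivative_diff x y that)
  have \<phi>': "(\<phi> has_real_derivative
      exp (- 2 * L * t) * (2 * ((f t (x t) - f t (y t)) \<bullet> z t) - 2 * L * (z t \<bullet> z t))) (at t within {a..b})"
    if "t \<in> {a..b}" for t
    unfolding \<phi>_def has_field_derivative_def
    apply (rule has_derivative_eq_rhs)
     apply (rule derivative_eq_intros refl z[OF that, unfolded has_vector_derivative_def])+
    apply (auto simp: fun_eq_iff algebra_simps inner_commute)
    done
  have "\<phi> t \<le> \<phi> a"
  proof (rule DERIV_nonpos_imp_decreasing_open[of a t \<phi>])
    show "a \<le> t" using t by simp
    show "continuous_on {a..t} \<phi>"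
      by (rule continuous_on_subset[of "{a..b}"], rule DERIV_continuous_on, rule \<phi>') (use t in auto)
    fix s assume s: "a < s" "s < t"
    then have sab: "s \<in> {a..b}" "a < s" "s < b" using t by auto
    have "(f s (x s) - f s (y s)) \<bullet> z s \<le> norm (f s (x s) - f s (y s)) * norm (z s)"
      by (rule norm_cauchy_schwarz)
    also have "\<dots> \<le> (L * norm (z s)) * norm (z s)"
      using lip[OF sab(1)] by (intro mult_right_mono) (auto simp: z_def)
    also have "\<dots> = L * (z s \<bullet> z s)" by (simp add: dot_square_norm power2_eq_square)
    finally have "2 * ((f s (x s) - f s (y s)) \<bullet> z s) - 2 * L * (z s \<bullet> z s) \<le> 0" by simp
    then have "exp (- 2 * L * s) * (2 * ((f s (x s) - f s (y s)) \<bullet> z s) - 2 * L * (z s \<bullet> z s)) \<le> 0"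
      by (simp add: mult_le_0_iff)
    then show "\<exists>d. (\<phi> has_real_derivative d) (at s) \<and> d \<le> 0"
      using \<phi>'[OF sab(1)] sab by (metis at_within_Icc_at)
  qed
  also have "\<phi> a = 0" by (simp add: \<phi>_def z_def init)
  finally have "z t \<bullet> z t \<le> 0" by (simp add: \<phi>_def mult_le_0_iff)
  then have "z t \<bullet> z t = 0" using inner_ge_zero[of "z t"] by linarith
  then show ?thesis by (simp add: z_def)
qed

text \<open>
  The Picard operator is a contraction of the space of bounded continuous functions on the whole
  real line, where the upper limit of integration is clipped to the interval.
\<close>

lemma ode_exists:
  fixes f :: "real \<Rightarrow> 'a::euclidean_space \<Rightarrow> 'a"
  assumes T: "0 \<le> T" and LT: "0 \<le> L" "L * T < 1"
    and cont: "continuous_on ({0..T} \<times> UNIV) (\<lambda>(t, x). f t x)"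
    and lip: "\<And>t x y. t \<in> {0..T} \<Longrightarrow> norm (f t x - f t y) \<le> L * norm (x - y)"
  obtains x where "x 0 = x0"
    "\<And>t. t \<in> {0..T} \<Longrightarrow> (x has_vector_derivative f t (x t)) (at t within {0..T})"
proof -
  define clip where "clip = (\<lambda>t::real. max 0 (min T t))"
  have clip: "clip t \<in> {0..T}" for t using T by (auto simp: clip_def)
  have clipc: "continuous_on UNIV clip" unfolding clip_def by (intro continuous_intros)
  define P where "P = (\<lambda>(u :: real \<Rightarrow>\<^sub>C 'a) t. x0 + integral {0..clip t} (\<lambda>s. f s (apply_bcontfun u s)))"
  have fc: "continuous_on {0..T} (\<lambda>s. f s (apply_bcontfun u s))" for u :: "real \<Rightarrow>\<^sub>C 'a"
  proof -
    have "continuous_on {0..T} (\<lambda>s. (s, apply_bcontfun u s))"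
      by (intro continuous_intros continuous_on_apply_bcontfun)
    from continuous_on_compose2[OF cont this] show ?thesis by auto
  qed
  have fint: "(\<lambda>s. f s (apply_bcontfun u s)) integrable_on {0..t}" if "t \<in> {0..T}" for u :: "real \<Rightarrow>\<^sub>C 'a" and t
    by (rule integrable_continuous_real, rule continuous_on_subset[OF fc]) (use that in auto)
  have Pc: "P u \<in> bcontfun" for u
  proof -
    have c1: "continuous_on {0..T} (\<lambda>t. x0 + integral {0..t} (\<lambda>s. f s (apply_bcontfun u s)))"
      by (intro continuous_intros indefinite_integral_continuous_1 integrable_continuous_real fc)
    have eq: "P u = (\<lambda>t. x0 + integral {0..t} (\<lambda>s. f s (apply_bcontfun u s))) \<circ> clip" by (simp add: P_def o_def)
    have "continuous_on UNIV (P u)" unfolding eq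
      by (intro continuous_on_compose clipc continuous_on_subset[OF c1]) (use clip in auto)
    moreover have "bounded (range (P u))"
    proof (rule bounded_subset[OF compact_imp_bounded[OF compact_continuous_image[OF c1]]])
      show "range (P u) \<subseteq> (\<lambda>t. x0 + integral {0..t} (\<lambda>s. f s (apply_bcontfun u s))) ` {0..T}"
        unfolding eq using clip by auto
    qed simp
    ultimately show ?thesis by (simp add: bcontfun_def)
  qed
  have ap: "apply_bcontfun (Bcontfun (P u)) = P u" for u using Pc by (simp add: Bcontfun_inverse)
  have "\<exists>!u. Bcontfun (P u) = u"
  proof (rule banach_fix_type[of "L * T"])
    show "0 \<le> L * T" "L * T < 1" using T LT by auto
    show "\<forall>u v. dist (Bcontfun (P u)) (Bcontfun (P v)) \<le> L * T * dist u v"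
    proof (intro allI dist_bound)
      fix u v t
      have ct: "clip t \<in> {0..T}" by (rule clip)
      have "dist (P u t) (P v t) = norm (integral {0..clip t} (\<lambda>s. f s (apply_bcontfun u s) - f s (apply_bcontfun v s)))"
        unfolding P_def dist_norm by (subst integral_diff[OF fint[OF ct] fint[OF ct]]) simp
      also have "\<dots> \<le> L * dist u v * (clip t - 0)"
      proof (rule integral_bound)
        show "0 \<le> clip t" using ct by simp
        show "continuous_on {0..clip t} (\<lambda>s. f s (apply_bcontfun u s) - f s (apply_bcontfun v s))"
          by (intro continuous_on_diff continuous_on_subset[OF fc]) (use ct in auto)
        fix s assume "s \<in> {0..clip t}"
        then have "norm (f s (apply_bcontfun u s) - f s (apply_bcontfun v s)) \<le> L * norm (apply_bcontfun u s - apply_bcontfun v s)"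
          using ct by (intro lip) auto
        also have "\<dots> \<le> L * dist u v" using LT(1) dist_bounded[of u s v] by (intro mult_left_mono) (auto simp: dist_norm)
        finally show "norm (f s (apply_bcontfun u s) - f s (apply_bcontfun v s)) \<le> L * dist u v" .
      qed
      also have "\<dots> \<le> L * dist u v * T" using ct LT(1) by (intro mult_left_mono) auto
      finally show "dist (apply_bcontfun (Bcontfun (P u)) t) (apply_bcontfun (Bcontfun (P v)) t) \<le> L * T * dist u v"
        unfolding ap by (simp add: ac_simps)
    qed
  qed
  then obtain u where "Bcontfun (P u) = u" by blast
  then have u: "apply_bcontfun u t = P u t" for t by (metis ap)
  show thesis
  proof (rule that[of "apply_bcontfun u"])
    show "apply_bcontfun u 0 = x0" unfolding u using T by (simp add: P_def clip_def)
    fix t assume t: "t \<in> {0..T}"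
    have "((\<lambda>t. x0 + integral {0..t} (\<lambda>s. f s (apply_bcontfun u s))) has_vector_derivative 0 + f t (apply_bcontfun u t)) (at t within {0..T})"
      by (intro has_vector_derivative_add has_vector_derivative_const integral_has_vector_derivative fc t)
    then have "((\<lambda>t. x0 + integral {0..t} (\<lambda>s. f s (apply_bcontfun u s))) has_vector_derivative f t (apply_bcontfun u t)) (at t within {0..T})" by simp
    then show "(apply_bcontfun u has_vector_derivative f t (apply_bcontfun u t)) (at t within {0..T})"
      by (rule has_vector_derivative_transform[OF t, rotated]) (subst u, simp add: P_def clip_def)
  qed
qed

subsection \<open>Linear matrix equations\<close>

lemma bounded_bilinear_matrix_mult:
  "bounded_bilinear ((**) :: complex^'n^'m::finite \<Rightarrow> complex^'p^'n::finite \<Rightarrow> complex^'p::finite^'m)"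
proof -
  have "bilinear ((**) :: complex^'n^'m \<Rightarrow> complex^'p^'n \<Rightarrow> complex^'p^'m)"
    unfolding bilinear_def
    by (auto intro!: linearI simp: matrix_matrix_mult_def vec_eq_iff sum.distrib algebra_simps scaleR_sum_right)
  then show ?thesis by (simp add: bilinear_conv_bounded_bilinear)
qed

lemma matrix_mult_norm_bound:
  obtains \<kappa> where "0 < \<kappa>"
    "\<And>(A :: complex^'N^'N::finite) B :: complex^'N^'N. norm (A ** B) \<le> \<kappa> * norm A * norm B"
proof -
  interpret bounded_bilinear "(**) :: complex^'N^'N::finite \<Rightarrow> complex^'N^'N \<Rightarrow> complex^'N^'N"
    by (rule bounded_bilinear_matrix_mult)
  from pos_bounded obtain K where "0 < K" "\<And>(A :: complex^'N^'N) B :: complex^'N^'N. norm (A ** B) \<le> norm A * norm B * K"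
    by blast
  then show thesis by (intro that[of K]) (auto simp: ac_simps)
qed

text \<open>
  If \<open>U *v x = 0\<close>, then \<open>x\<close> is the image of itself under \<open>mat 1 - U\<close>, hence 0.
\<close>

lemma invertible_near_one:
  obtains \<delta> where "0 < \<delta>" "\<And>U :: complex^'N^'N::finite. norm (U - mat 1) < \<delta> \<Longrightarrow> invertible U"
proof -
  have "bilinear ((*v) :: complex^'N^'N \<Rightarrow> complex^'N \<Rightarrow> complex^'N)"
    unfolding bilinear_def
    by (auto intro!: linearI simp: matrix_vector_mult_def vec_eq_iff sum.distrib algebra_simps scaleR_sum_right)
  then interpret bounded_bilinear "(*v) :: complex^'N^'N::finite \<Rightarrow> complex^'N \<Rightarrow> complex^'N"
    by (simp add: bilinear_conv_bounded_bilinear)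
  from pos_bounded obtain K where K: "0 < K" "\<And>(A :: complex^'N^'N) x. norm (A *v x) \<le> norm A * norm x * K"
    by blast
  show thesis
  proof (rule that[of "1 / K"])
    show "0 < 1 / K" using K by simp
    fix U :: "complex^'N^'N" assume U: "norm (U - mat 1) < 1 / K"
    have "x = 0" if "U *v x = 0" for x
    proof (rule ccontr)
      assume "x \<noteq> 0"
      have "(U - mat 1) *v x = - x" using that by (simp add: matrix_vector_mult_diff_rdistrib)
      then have "norm x \<le> norm (U - mat 1) * norm x * K" using K(2)[of "U - mat 1" x] by simp
      also have "\<dots> < 1 / K * norm x * K" using U K(1) \<open>x \<noteq> 0\<close> by (intro mult_strict_right_mono) auto
      finally show False using K(1) by simp
    qed
    then have "\<exists>B. B ** U = mat 1" by (subst matrix_left_invertible_ker) blast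
    then show "invertible U" by (simp add: invertible_left_inverse)
  qed
qed

text \<open>
  Reversing time turns the terminal value problem for the attenuation matrix into an initial value
  problem. The bound for the distance to the identity will give both invertibility and the
  approximation needed for \<open>attenuation_distinguishes\<close>.
\<close>

lemma linear_ode_terminal:
  fixes A :: "real \<Rightarrow> complex^'N^'N::finite"
  assumes \<kappa>: "0 < \<kappa>" "\<And>(A :: complex^'N^'N) B :: complex^'N^'N. norm (A ** B) \<le> \<kappa> * norm A * norm B"
    and \<tau>: "0 \<le> \<tau>" and cont: "continuous_on {0..\<tau>} A"
    and K: "0 \<le> K" "\<And>t. t \<in> {0..\<tau>} \<Longrightarrow> norm (A t) \<le> K" and small: "\<kappa> * K * \<tau> \<le> 1/2"
  obtains U where "U \<tau> = mat 1"
    "\<And>t. t \<in> {0..\<tau>} \<Longrightarrow> (U has_vector_derivative - (A t ** U t)) (at t within {0..\<tau>})"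
    "\<And>t. t \<in> {0..\<tau>} \<Longrightarrow> norm (U t - mat 1) \<le> 2 * \<kappa> * K * \<tau> * norm (mat 1 :: complex^'N^'N)"
proof -
  interpret mm: bounded_bilinear "(**) :: complex^'N^'N::finite \<Rightarrow> complex^'N^'N \<Rightarrow> complex^'N^'N"
    by (rule bounded_bilinear_matrix_mult)
  define f where "f = (\<lambda>s (V::complex^'N^'N). A (\<tau> - s) ** V)"
  have cA: "continuous_on {0..\<tau>} (\<lambda>s. A (\<tau> - s))"
    by (rule continuous_on_compose2[OF cont]) (auto intro!: continuous_intros)
  obtain V where V0: "V 0 = mat 1"
    and V: "\<And>s. s \<in> {0..\<tau>} \<Longrightarrow> (V has_vector_derivative f s (V s)) (at s within {0..\<tau>})"
  proof (rule ode_exists[of \<tau> "\<kappa> * K" f])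
    show "0 \<le> \<tau>" "0 \<le> \<kappa> * K" "\<kappa> * K * \<tau> < 1" using \<tau> \<kappa> K small by auto
    show "continuous_on ({0..\<tau>} \<times> UNIV) (\<lambda>(t, x). f t x)"
      unfolding f_def case_prod_beta
      by (intro mm.continuous_on continuous_on_compose2[OF cA] continuous_intros) auto
    show "norm (f t x - f t y) \<le> \<kappa> * K * norm (x - y)" if "t \<in> {0..\<tau>}" for t x y
    proof -
      have "norm (f t x - f t y) \<le> \<kappa> * norm (A (\<tau> - t)) * norm (x - y)"
        unfolding f_def mm.diff_right[symmetric] by (rule \<kappa>)
      also have "\<dots> \<le> \<kappa> * K * norm (x - y)" using \<kappa>(1) K(2)[of "\<tau> - t"] that
        by (intro mult_right_mono mult_left_mono) auto
      finally show ?thesis .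
    qed
  qed blast
  define U where "U = (\<lambda>t. V (\<tau> - t))"
  have U: "(U has_vector_derivative - (A t ** U t)) (at t within {0..\<tau>})" if t: "t \<in> {0..\<tau>}" for t
  proof -
    have "((\<lambda>t. \<tau> - t) has_vector_derivative -1) (at t within {0..\<tau>})"
      by (auto intro!: derivative_eq_intros)
    moreover have "(V has_vector_derivative f (\<tau> - t) (V (\<tau> - t))) (at (\<tau> - t) within (\<lambda>t. \<tau> - t) ` {0..\<tau>})"
      by (rule has_vector_derivative_within_subset[OF V]) (use t in auto)
    ultimately have "(V \<circ> (\<lambda>t. \<tau> - t) has_vector_derivative (-1) *\<^sub>R f (\<tau> - t) (V (\<tau> - t))) (at t within {0..\<tau>})"
      by (rule vector_diff_chain_within)
    then show ?thesis by (simp add: U_def o_def f_def)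
  qed
  have cU: "continuous_on {0..\<tau>} U"
    using U by (meson continuous_on_eq_continuous_within has_vector_derivative_continuous)
  \<comment> \<open>At the time of maximal distance from the identity, the mean value estimate of this distance
    contains the distance itself with a factor at most 1/2 and can be solved for it.\<close>
  have "\<exists>s\<in>{0..\<tau>}. \<forall>t\<in>{0..\<tau>}. norm (U t - mat 1) \<le> norm (U s - mat 1)"
    by (rule continuous_attains_sup) (use \<tau> cU in \<open>auto intro!: continuous_intros\<close>)
  then obtain s where s: "s \<in> {0..\<tau>}" "\<And>t. t \<in> {0..\<tau>} \<Longrightarrow> norm (U t - mat 1) \<le> norm (U s - mat 1)" by blast
  define m where "m = norm (U s - mat 1)"
  have m: "m \<le> 2 * \<kappa> * K * \<tau> * norm (mat 1 :: complex^'N^'N)"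
  proof -
    let ?n = "norm (mat 1 :: complex^'N^'N)"
    have "norm (U \<tau> - U s) \<le> \<kappa> * K * (?n + m) * norm (\<tau> - s)"
    proof (rule differentiable_bound[where S = "{0..\<tau>}" and f' = "\<lambda>t h. h *\<^sub>R - (A t ** U t)"])
      show "convex {0..\<tau>}" by simp
      show "\<tau> \<in> {0..\<tau>}" "s \<in> {0..\<tau>}" using s \<tau> by auto
      fix t assume t: "t \<in> {0..\<tau>}"
      show "(U has_derivative (\<lambda>h. h *\<^sub>R - (A t ** U t))) (at t within {0..\<tau>})"
        using U[OF t] by (simp add: has_vector_derivative_def)
      have "norm (A t ** U t) \<le> \<kappa> * norm (A t) * norm (U t)" by (rule \<kappa>)
      also have "\<dots> \<le> \<kappa> * K * (?n + m)"
      proof (intro mult_mono)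
        show "norm (U t) \<le> ?n + m"
          using norm_triangle_ineq[of "mat 1" "U t - mat 1"] s(2)[OF t] by (simp add: m_def)
      qed (use \<kappa> K t in auto)
      finally have le: "norm (A t ** U t) \<le> \<kappa> * K * (?n + m)" .
      show "onorm (\<lambda>h. h *\<^sub>R - (A t ** U t)) \<le> \<kappa> * K * (?n + m)"
      proof (rule onorm_le)
        fix h :: real
        show "norm (h *\<^sub>R - (A t ** U t)) \<le> \<kappa> * K * (?n + m) * norm h"
          using mult_left_mono[OF le, of "\<bar>h\<bar>"] by (simp add: ac_simps)
      qed
    qed
    moreover have "U \<tau> = mat 1" by (simp add: U_def V0)
    ultimately have "m \<le> \<kappa> * K * (?n + m) * (\<tau> - s)" using s(1) by (simp add: m_def norm_minus_commute)
    also have "\<dots> \<le> \<kappa> * K * (?n + m) * \<tau>" using s(1) \<kappa> K by (intro mult_left_mono) (auto simp: m_def)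
    finally have "m \<le> \<kappa> * K * \<tau> * ?n + (\<kappa> * K * \<tau>) * m" by (simp add: algebra_simps)
    moreover have "(\<kappa> * K * \<tau>) * m \<le> 1/2 * m" using small by (intro mult_right_mono) (auto simp: m_def)
    ultimately show ?thesis by simp
  qed
  show thesis
  proof (rule that[of U])
    show "U \<tau> = mat 1" by (simp add: U_def V0)
    show "norm (U t - mat 1) \<le> 2 * \<kappa> * K * \<tau> * norm (mat 1 :: complex^'N^'N)" if "t \<in> {0..\<tau>}" for t
      using s(2)[OF that] m by (simp add: m_def)
  qed (rule U)
qed

lemma bound_from_derivative_bound:
  fixes D :: "real \<Rightarrow> 'a::real_inner" and I :: "real \<Rightarrow> real"
  assumes ab: "a \<le> b"
    and D: "\<And>t. t \<in> {a..b} \<Longrightarrow> (D has_vector_derivative D' t) (at t within {a..b})"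
    and I: "\<And>t. t \<in> {a..b} \<Longrightarrow> (I has_vector_derivative I' t) (at t within {a..b})"
    and le: "\<And>t. a < t \<Longrightarrow> t < b \<Longrightarrow> norm (D' t) \<le> I' t"
  shows "norm (D b - D a) \<le> I b - I a"
proof (cases "a = b")
  case False
  then have "a < b" using ab by simp
  then show ?thesis
  proof (rule differentiable_bound_general)
    show "continuous_on {a..b} D" "continuous_on {a..b} I"
      using D I by (meson continuous_on_eq_continuous_within has_vector_derivative_continuous)+
    fix t assume t: "a < t" "t < b"
    then have e: "at t within {a..b} = at t" by (simp add: at_within_Icc_at)
    show "(D has_vector_derivative D' t) (at t)" "(I has_vector_derivative I' t) (at t)"
      using D[of t] I[of t] t e by auto
    show "norm (D' t) \<le> I' t" using le t by auto
  qed
qed simp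

text \<open>
  The difference \<open>D\<close> of the two solutions is bounded by \<open>3 * norm H0\<close> times the integral \<open>I \<tau>\<close> of
  \<open>m\<close>. Therefore the term \<open>A1 t ** D t\<close> changes the inner product of \<open>D\<close> with \<open>H0\<close> by less than
  \<open>(norm H0)\<^sup>2 / 2 * I \<tau>\<close> altogether, whereas the term with \<open>m\<close> lowers it by at least this amount.
  Since \<open>D\<close> vanishes at both ends, this is impossible.
\<close>

lemma attenuation_distinguishes:
  fixes A1 A2 H U1 U2 :: "real \<Rightarrow> complex^'N^'N::finite" and H0 :: "complex^'N^'N" and m :: "real \<Rightarrow> real"
  assumes \<kappa>: "0 < \<kappa>" "\<And>(A :: complex^'N^'N) B :: complex^'N^'N. norm (A ** B) \<le> \<kappa> * norm A * norm B"
    and \<tau>: "0 < \<tau>"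
    and K: "0 \<le> K" "\<And>t. t \<in> {0..\<tau>} \<Longrightarrow> norm (A1 t) \<le> K" and small: "\<kappa> * K * \<tau> < 1/6"
    and U1: "\<And>t. t \<in> {0..\<tau>} \<Longrightarrow> (U1 has_vector_derivative - (A1 t ** U1 t)) (at t within {0..\<tau>})"
    and U2: "\<And>t. t \<in> {0..\<tau>} \<Longrightarrow> (U2 has_vector_derivative - (A2 t ** U2 t)) (at t within {0..\<tau>})"
    and diff: "\<And>t. t \<in> {0..\<tau>} \<Longrightarrow> A1 t - A2 t = m t *\<^sub>R H t"
    and m: "continuous_on {0..\<tau>} m" "\<And>t. t \<in> {0..\<tau>} \<Longrightarrow> 0 \<le> m t" "\<And>t. 0 < t \<Longrightarrow> t < \<tau> \<Longrightarrow> 0 < m t"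
    and H: "\<And>t. t \<in> {0..\<tau>} \<Longrightarrow> norm (H t ** U2 t - H0) \<le> norm H0 / 2" and H0: "H0 \<noteq> 0"
    and ends: "U1 \<tau> = U2 \<tau>" "U1 0 = U2 0"
  shows False
proof -
  interpret mm: bounded_bilinear "(**) :: complex^'N^'N::finite \<Rightarrow> complex^'N^'N \<Rightarrow> complex^'N^'N"
    by (rule bounded_bilinear_matrix_mult)
  define D where "D = (\<lambda>t. U1 t - U2 t)"
  define D' where "D' = (\<lambda>t. - (A1 t ** D t) - m t *\<^sub>R (H t ** U2 t))"
  define I where "I = (\<lambda>t. integral {0..t} m)"
  have D: "(D has_vector_derivative D' t) (at t within {0..\<tau>})" if t: "t \<in> {0..\<tau>}" for t
  proof -
    have A2: "A2 t = A1 t - m t *\<^sub>R H t" using diff[OF t] by (simp add: algebra_simps)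
    have "- (A1 t ** U1 t) - - (A2 t ** U2 t) = D' t"
      unfolding A2 D'_def D_def by (simp add: mm.diff_left mm.diff_right mm.scaleR_left)
    then show ?thesis using has_vector_derivative_diff[OF U1[OF t] U2[OF t]] by (simp add: D_def)
  qed
  have I: "(I has_vector_derivative m t) (at t within {0..\<tau>})" if "t \<in> {0..\<tau>}" for t
    unfolding I_def by (rule integral_has_vector_derivative[OF m(1) that])
  have I0: "I 0 = 0" by (simp add: I_def)
  have cD: "continuous_on {0..\<tau>} D"
    using D by (meson continuous_on_eq_continuous_within has_vector_derivative_continuous)
  have "\<exists>s\<in>{0..\<tau>}. \<forall>t\<in>{0..\<tau>}. norm (D t) \<le> norm (D s)"
    by (rule continuous_attains_sup) (use \<tau> cD in \<open>auto intro!: continuous_intros\<close>)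
  then obtain s where s: "s \<in> {0..\<tau>}" "\<And>t. t \<in> {0..\<tau>} \<Longrightarrow> norm (D t) \<le> norm (D s)" by blast
  define B where "B = norm (D s)"
  define h where "h = norm H0"
  have h: "h > 0" using H0 by (simp add: h_def)
  have AD: "norm (A1 t ** D t) \<le> \<kappa> * K * B" if "t \<in> {0..\<tau>}" for t
  proof -
    have "norm (A1 t ** D t) \<le> \<kappa> * norm (A1 t) * norm (D t)" by (rule \<kappa>)
    also have "\<dots> \<le> \<kappa> * K * B" using \<kappa> K s(2) that by (intro mult_mono) (auto simp: B_def)
    finally show ?thesis .
  qed
  have HU: "norm (H t ** U2 t) \<le> 3/2 * h" if "t \<in> {0..\<tau>}" for t
    using H[OF that] norm_triangle_ineq[of H0 "H t ** U2 t - H0"] by (simp add: h_def)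
  have mono: "I a \<le> I b" if "0 \<le> a" "a \<le> b" "b \<le> \<tau>" for a b
  proof -
    have "norm ((\<lambda>_. 0::real) b - (\<lambda>_. 0) a) \<le> I b - I a"
      by (rule bound_from_derivative_bound[of a b "\<lambda>_. 0::real" "\<lambda>_. 0" I m])
        (use that m(2) in \<open>auto intro: has_vector_derivative_within_subset[OF I]\<close>)
    then show ?thesis by simp
  qed
  have D'b: "norm (D' t) \<le> \<kappa> * K * B + 3/2 * h * m t" if t: "t \<in> {0..\<tau>}" for t
  proof -
    have "norm (D' t) \<le> norm (A1 t ** D t) + norm (m t *\<^sub>R (H t ** U2 t))"
      unfolding D'_def by (metis norm_minus_cancel norm_triangle_ineq4)
    also have "norm (m t *\<^sub>R (H t ** U2 t)) \<le> m t * (3/2 * h)"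
      using mult_left_mono[OF HU[OF t] m(2)[OF t]] m(2)[OF t] by simp
    finally show ?thesis using AD[OF t] by (simp add: ac_simps)
  qed
  \<comment> \<open>The estimate is made at the time \<open>s\<close> where \<open>D\<close> is largest, so that the contribution of
    \<open>A1 t ** D t\<close> can be absorbed in the left-hand side.\<close>
  have "norm (D s - D 0) \<le> (\<lambda>t. \<kappa> * K * B * t + 3/2 * h * I t) s - (\<lambda>t. \<kappa> * K * B * t + 3/2 * h * I t) 0"
  proof (rule bound_from_derivative_bound[where D' = D' and I' = "\<lambda>t. \<kappa> * K * B * 1 + 3/2 * h * m t"])
    show "0 \<le> s" using s by simp
    fix t assume t: "t \<in> {0..s}"
    then have t': "t \<in> {0..\<tau>}" and sub: "{0..s} \<subseteq> {0..\<tau>}" using s(1) by auto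
    show "(D has_vector_derivative D' t) (at t within {0..s})"
      by (rule has_vector_derivative_within_subset[OF D[OF t'] sub])
    have "(I has_vector_derivative m t) (at t within {0..s})"
      by (rule has_vector_derivative_within_subset[OF I[OF t'] sub])
    then show "((\<lambda>t. \<kappa> * K * B * t + 3/2 * h * I t) has_vector_derivative \<kappa> * K * B * 1 + 3/2 * h * m t) (at t within {0..s})"
      by (auto intro!: derivative_eq_intros simp: has_real_derivative_iff_has_vector_derivative[symmetric])
  next
    fix t assume "0 < t" "t < s"
    then show "norm (D' t) \<le> \<kappa> * K * B * 1 + 3/2 * h * m t" using D'b[of t] s(1) by auto
  qed
  then have "B \<le> \<kappa> * K * B * s + 3/2 * h * I s" using ends I0 by (simp add: B_def D_def)
  also have "\<dots> \<le> \<kappa> * K * B * \<tau> + 3/2 * h * I \<tau>"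
    using s(1) \<kappa> K h mono[of s \<tau>] by (intro add_mono mult_left_mono) (auto simp: B_def)
  also have "\<kappa> * K * B * \<tau> = (\<kappa> * K * \<tau>) * B" by simp
  also have "(\<kappa> * K * \<tau>) * B \<le> 1/2 * B" using small by (intro mult_right_mono) (auto simp: B_def)
  finally have B: "B \<le> 3 * h * I \<tau>" by simp
  have I\<tau>: "0 < I \<tau>"
  proof -
    have "m (\<tau>/2) > 0" using m(3) \<tau> by simp
    have "integral {0..\<tau>} m \<noteq> 0"
      using integral_eq_0_iff[OF m(1) \<tau> m(2)] \<open>m (\<tau>/2) > 0\<close> \<tau> by (auto dest!: bspec[of _ _ "\<tau>/2"])
    moreover have "integral {0..\<tau>} m \<ge> 0" using mono[of 0 \<tau>] \<tau> I0 by (simp add: I_def)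
    ultimately show ?thesis by (simp add: I_def)
  qed
  have "norm ((\<lambda>t. 0::real) \<tau> - (\<lambda>t. 0) 0) \<le>
     (\<lambda>t. - (D t \<bullet> H0) + \<kappa> * K * B * h * t - h\<^sup>2 / 2 * I t) \<tau> - (\<lambda>t. - (D t \<bullet> H0) + \<kappa> * K * B * h * t - h\<^sup>2 / 2 * I t) 0"
  proof (rule bound_from_derivative_bound[where D = "\<lambda>_. 0::real" and D' = "\<lambda>_. 0" and
      I = "\<lambda>t. - (D t \<bullet> H0) + \<kappa> * K * B * h * t - h\<^sup>2 / 2 * I t" and I' = "\<lambda>t. - (D' t \<bullet> H0) + \<kappa> * K * B * h * 1 - h\<^sup>2 / 2 * m t"])
    show "0 \<le> \<tau>" using \<tau> by simp
    fix t assume t: "t \<in> {0..\<tau>}"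
    show "((\<lambda>t. 0) has_vector_derivative (0::real)) (at t within {0..\<tau>})" by simp
    have "((\<lambda>t. D t \<bullet> H0) has_vector_derivative D' t \<bullet> H0) (at t within {0..\<tau>})"
      by (rule bounded_linear.has_vector_derivative[OF bounded_linear_inner_left D[OF t]])
    then show "((\<lambda>t. - (D t \<bullet> H0) + \<kappa> * K * B * h * t - h\<^sup>2 / 2 * I t) has_vector_derivative
         - (D' t \<bullet> H0) + \<kappa> * K * B * h * 1 - h\<^sup>2 / 2 * m t) (at t within {0..\<tau>})"
      using I[OF t]
      by (auto intro!: derivative_eq_intros simp: has_real_derivative_iff_has_vector_derivative[symmetric])
  next
    fix t assume "0 < t" "t < \<tau>"
    then have t: "t \<in> {0..\<tau>}" by auto
    have "- (D' t \<bullet> H0) = (A1 t ** D t) \<bullet> H0 + m t * ((H t ** U2 t) \<bullet> H0)"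
      by (simp add: D'_def inner_diff_left)
    moreover have "- (\<kappa> * K * B * h) \<le> (A1 t ** D t) \<bullet> H0"
    proof -
      have "\<bar>(A1 t ** D t) \<bullet> H0\<bar> \<le> norm (A1 t ** D t) * h" unfolding h_def by (rule Cauchy_Schwarz_ineq2)
      also have "\<dots> \<le> \<kappa> * K * B * h" using AD[OF t] h by (intro mult_right_mono) auto
      finally show ?thesis by simp
    qed
    moreover have "h\<^sup>2 / 2 \<le> (H t ** U2 t) \<bullet> H0"
    proof -
      have "\<bar>(H t ** U2 t - H0) \<bullet> H0\<bar> \<le> norm (H t ** U2 t - H0) * h" unfolding h_def by (rule Cauchy_Schwarz_ineq2)
      also have "\<dots> \<le> h / 2 * h" using H[OF t] h by (intro mult_right_mono) (auto simp: h_def)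
      finally have "- (h\<^sup>2 / 2) \<le> (H t ** U2 t - H0) \<bullet> H0" by (simp add: power2_eq_square)
      moreover have "(H t ** U2 t) \<bullet> H0 = (H t ** U2 t - H0) \<bullet> H0 + h\<^sup>2"
        by (simp add: inner_diff_left h_def dot_square_norm)
      ultimately show ?thesis by simp
    qed
    then have "m t * (h\<^sup>2 / 2) \<le> m t * ((H t ** U2 t) \<bullet> H0)" using m(2)[OF t] by (intro mult_left_mono)
    ultimately show "norm (0::real) \<le> - (D' t \<bullet> H0) + \<kappa> * K * B * h * 1 - h\<^sup>2 / 2 * m t"
      by (simp add: ac_simps)
  qed
  then have "h\<^sup>2 / 2 * I \<tau> \<le> \<kappa> * K * B * h * \<tau>" using ends I0 by (simp add: D_def)
  also have "\<dots> \<le> \<kappa> * K * (3 * h * I \<tau>) * h * \<tau>"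
    using B \<kappa> K h \<tau> by (intro mult_right_mono mult_left_mono) auto
  also have "\<dots> = (\<kappa> * K * \<tau>) * (3 * h\<^sup>2 * I \<tau>)" by (simp add: power2_eq_square)
  also have "\<dots> < 1/6 * (3 * h\<^sup>2 * I \<tau>)" using small h I\<tau> by (intro mult_strict_right_mono) auto
  finally show False by simp
qed

section \<open>Analytic functions on the half-space\<close>

text \<open>
  The differential of \<open>psum a\<close> at \<open>x\<close>, applied to \<open>h\<close>; \<open>ddsum\<close> below is the second differential.
\<close>

definition dsum :: "(('n::finite \<Rightarrow> nat) \<Rightarrow> 'b::real_normed_vector) \<Rightarrow> real^'n \<Rightarrow> real^'n \<Rightarrow> 'b" where
  "dsum a x h = (\<Sum>i\<in>UNIV. h $ i *\<^sub>R psum (coeff_deriv i a) x)"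

definition ddsum ::
  "(('n::finite \<Rightarrow> nat) \<Rightarrow> 'b::real_normed_vector) \<Rightarrow> real^'n \<Rightarrow> real^'n \<Rightarrow> real^'n \<Rightarrow> 'b" where
  "ddsum a x h k = (\<Sum>j\<in>UNIV. k $ j *\<^sub>R dsum (coeff_deriv j a) x h)"

text \<open>
  The symmetry of second derivatives is the symmetry of \<open>coeff_deriv\<close> on coefficients.
\<close>

lemma ddsum_commute: "ddsum a x h k = ddsum a x k h"
  unfolding ddsum_def dsum_def scaleR_sum_right
  by (subst sum.swap) (simp add: coeff_deriv_commute mult.commute)

lemma linear_dsum: "linear (dsum a x)"
  unfolding dsum_def by (auto intro!: linearI simp: sum.distrib scaleR_add_left scaleR_sum_right)

lemma dsum_axis: "dsum a x (axis i 1) = psum (coeff_deriv i a) x"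
  unfolding dsum_def by (simp add: axis_def if_distrib[of "\<lambda>c. c *\<^sub>R _"] cong: if_cong)

lemma has_derivative_psum':
  fixes a :: "('n::finite \<Rightarrow> nat) \<Rightarrow> 'b::banach"
  assumes "converges r a" "x \<in> ball p r"
  shows "((\<lambda>y. psum a (y - p)) has_derivative dsum a (x - p)) (at x within S)"
proof -
  have "x - p \<in> ball 0 r" using assms(2) by (simp add: dist_norm norm_minus_commute)
  then have "(psum a has_derivative dsum a (x - p)) (at (x - p) within (\<lambda>y. y - p) ` S)"
    using has_derivative_psum[OF assms(1)] by (simp add: dsum_def[abs_def] has_derivative_at_withinI)
  moreover have "((\<lambda>y. y - p) has_derivative (\<lambda>h. h)) (at x within S)"
    by (auto intro!: derivative_eq_intros)
  ultimately show ?thesis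
    using diff_chain_within[of "\<lambda>y. y - p" "\<lambda>h. h" x S "psum a" "dsum a (x - p)"] by (simp add: o_def)
qed

lemma has_derivative_dsum:
  fixes a :: "('n::finite \<Rightarrow> nat) \<Rightarrow> 'b::banach"
  assumes "converges r a" "x \<in> ball p r"
  shows "((\<lambda>y. dsum a (y - p) h) has_derivative (\<lambda>k. ddsum a (x - p) k h)) (at x within S)"
  unfolding dsum_def[of a] ddsum_def
  by (intro has_derivative_sum has_derivative_scaleR_right has_derivative_psum'[OF converges_coeff_deriv[OF assms(1)] assms(2)])

lemma converges_mono: "converges r a \<Longrightarrow> 0 < s \<Longrightarrow> s \<le> r \<Longrightarrow> converges s a"
  by (auto simp: converges_def)

lemma half_space_openin_ball:
  assumes "openin (top_of_set half_space) S" "p \<in> S"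
  obtains r where "0 < r" "half_space \<inter> ball p r \<subseteq> S"
proof -
  obtain T where T: "open T" "S = half_space \<inter> T" using assms(1) by (auto simp: openin_open)
  with assms(2) obtain r where "0 < r" "ball p r \<subseteq> T" by (metis IntD2 openE)
  with T show thesis by (intro that[of r]) auto
qed

text \<open>
  Every point of the half-space can be moved a little in all positive coordinate directions without
  leaving it, hence derivatives within relatively open sets are unique.
\<close>

lemma half_space_derivative_unique:
  fixes f :: "real^'n::finite \<Rightarrow> 'b::real_normed_vector"
  assumes S: "openin (top_of_set half_space) S" "p \<in> S"
    and f: "(f has_derivative f') (at p within S)" "(f has_derivative f'') (at p within S)"
  shows "f' = f''"
proof (rule frechet_derivative_unique_within[OF f])
  obtain r where r: "0 < r" "half_space \<inter> ball p r \<subseteq> S" by (rule half_space_openin_ball[OF S])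
  have p: "p \<in> half_space" using S openin_imp_subset by blast
  fix i :: "real^'n" and e :: real assume i: "i \<in> Basis" and e: "e > 0"
  obtain k where k: "i = axis k 1" using i by (auto simp: Basis_vec_def)
  define d where "d = min (e / 2) (r / 2)"
  have d: "0 < d" "d < e" "d < r" using e r(1) by (auto simp: d_def min_def)
  have "p + d *\<^sub>R i \<in> half_space \<inter> ball p r"
    using p d by (auto simp: k half_space_def axis_def dist_norm norm_axis_1[unfolded axis_def])
  then show "\<exists>d. 0 < \<bar>d\<bar> \<and> \<bar>d\<bar> < e \<and> p + d *\<^sub>R i \<in> S" using r(2) d by (intro exI[of _ d]) auto
qed

text \<open>
  Shrinking the ball makes the series represent the function on the whole half-ball. All derivatives
  within the half-space can thus be computed from those of a function on a full ball.
\<close>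

lemma real_analytic_local_series:
  fixes f :: "real^'n::finite \<Rightarrow> 'b::real_normed_vector"
  assumes an: "real_analytic_on S f" and S: "openin (top_of_set half_space) S" "p \<in> S"
  obtains r a where "converges r a" "half_space \<inter> ball p r \<subseteq> S"
    "\<And>y. y \<in> half_space \<inter> ball p r \<Longrightarrow> f y = psum a (y - p)"
proof -
  obtain r1 where r1: "0 < r1" "half_space \<inter> ball p r1 \<subseteq> S" by (rule half_space_openin_ball[OF S])
  obtain r2 a F where r2: "0 < r2"
    and F: "\<And>y. y \<in> ball p r2 \<Longrightarrow> ((\<lambda>\<alpha>. (\<Prod>i\<in>UNIV. (y $ i - p $ i) ^ \<alpha> i) *\<^sub>R a \<alpha>) has_sum F y) UNIV"
    and fF: "\<And>y. y \<in> S \<inter> ball p r2 \<Longrightarrow> f y = F y"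
    using an S(2) unfolding real_analytic_on_def by meson
  have F': "((\<lambda>\<alpha>. monomial \<alpha> (y - p) *\<^sub>R a \<alpha>) has_sum F y) UNIV" if "y \<in> ball p r2" for y
    using F[OF that] by (simp add: monomial_def)
  define r where "r = min r1 r2"
  have r: "0 < r" "r \<le> r1" "r \<le> r2" using r1 r2 by (auto simp: r_def)
  show thesis
  proof (rule that[of r a])
    show "converges r a" unfolding converges_def
    proof (intro conjI ballI)
      show "0 < r" by (rule r)
      fix x assume "x \<in> ball (0::real^'n) r"
      then have "x + p \<in> ball p r2" using r by (simp add: dist_norm)
      from F'[OF this] show "(\<lambda>\<alpha>. monomial \<alpha> x *\<^sub>R a \<alpha>) summable_on UNIV" by (auto simp: summable_on_def)
    qed
    show sub: "half_space \<inter> ball p r \<subseteq> S" using r r1 by fastforce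
    fix y assume y: "y \<in> half_space \<inter> ball p r"
    then have y2: "y \<in> ball p r2" using r by auto
    have "f y = F y" using fF y sub y2 by blast
    also have "\<dots> = psum a (y - p)" using F'[OF y2] unfolding psum_def by (simp add: infsumI)
    finally show "f y = psum a (y - p)" .
  qed
qed

lemma has_derivative_local_series:
  fixes f :: "real^'n::finite \<Rightarrow> 'b::banach"
  assumes S: "openin (top_of_set half_space) S"
    and rep: "converges r a" "half_space \<inter> ball p r \<subseteq> S"
    "\<And>y. y \<in> half_space \<inter> ball p r \<Longrightarrow> f y = psum a (y - p)"
    and y: "y \<in> half_space \<inter> ball p r"
  shows "(f has_derivative dsum a (y - p)) (at y within S)"
    and "frechet_derivative f (at y within S) = dsum a (y - p)"
proof -
  have e: "at y within S = at y within (half_space \<inter> ball p r)"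
  proof -
    have "S \<inter> ball p r = half_space \<inter> ball p r" using rep(2) openin_imp_subset[OF S] by blast
    then show ?thesis using y by (intro at_within_nhd[of y "ball p r"]) auto
  qed
  show d: "(f has_derivative dsum a (y - p)) (at y within S)" unfolding e
    by (rule has_derivative_transform[OF y _ has_derivative_psum'[OF rep(1)]]) (use rep(3) y in auto)
  then have "(f has_derivative frechet_derivative f (at y within S)) (at y within S)"
    using frechet_derivative_works differentiable_def by blast
  moreover have "y \<in> S" using y rep(2) by blast
  ultimately show "frechet_derivative f (at y within S) = dsum a (y - p)"
    using half_space_derivative_unique[OF S] d by blast
qed

section \<open>Charts and coordinate changes\<close>

locale analytic_atlas =
  fixes M :: "'m topology" and A :: "('m, 'n::finite) chart set"
  assumes atlas: "real_analytic_atlas M A" and hausdorff: "Hausdorff_space M"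
begin

abbreviation overlap :: "('m, 'n) chart \<Rightarrow> ('m, 'n) chart \<Rightarrow> (real^'n) set" where
  "overlap c d \<equiv> snd c ` (fst c \<inter> fst d)"

abbreviation coord_change :: "('m, 'n) chart \<Rightarrow> ('m, 'n) chart \<Rightarrow> real^'n \<Rightarrow> real^'n" where
  "coord_change c d \<equiv> snd d \<circ> chart_inv c"

lemma chart: "c \<in> A \<Longrightarrow> is_chart M c" using atlas by (simp add: real_analytic_atlas_def)

lemma chart_openin: "c \<in> A \<Longrightarrow> openin M (fst c)" using chart by (simp add: is_chart_def)

lemma chart_domain_subset: "c \<in> A \<Longrightarrow> fst c \<subseteq> topspace M" using chart_openin openin_subset by blast

lemma chart_exists:
  assumes "x \<in> topspace M" obtains c where "c \<in> A" "x \<in> fst c"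
  using assms that atlas unfolding real_analytic_atlas_def by blast

lemma chart_homeo: "c \<in> A \<Longrightarrow> homeomorphic_map (subtopology M (fst c)) (top_of_set (chart_image c)) (snd c)"
  using chart by (simp add: is_chart_def)

lemma chart_image_openin: "c \<in> A \<Longrightarrow> openin (top_of_set half_space) (chart_image c)"
  using chart by (simp add: is_chart_def)

lemma topspace_chart: "c \<in> A \<Longrightarrow> topspace (subtopology M (fst c)) = fst c"
  using chart_domain_subset[of c] by (simp add: Int_absorb1)

lemma chart_inj: "c \<in> A \<Longrightarrow> inj_on (snd c) (fst c)"
  using homeomorphic_imp_injective_map[OF chart_homeo] topspace_chart by metis

lemma chart_inv_left [simp]: "c \<in> A \<Longrightarrow> x \<in> fst c \<Longrightarrow> chart_inv c (snd c x) = x"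
  using chart_inj by (simp add: inv_into_f_f)

lemma chart_inv_in: "y \<in> chart_image c \<Longrightarrow> chart_inv c y \<in> fst c"
  by (rule inv_into_into)

lemma chart_inv_right: "y \<in> chart_image c \<Longrightarrow> snd c (chart_inv c y) = y"
  by (rule f_inv_into_f)

lemma chart_in_half_space: "c \<in> A \<Longrightarrow> x \<in> fst c \<Longrightarrow> snd c x \<in> half_space"
  using openin_imp_subset[OF chart_image_openin] by blast

lemma chart_continuous: "c \<in> A \<Longrightarrow> continuous_map (subtopology M (fst c)) euclidean (snd c)"
  using homeomorphic_imp_continuous_map[OF chart_homeo] continuous_map_into_fulltopology by blast

lemma chart_inv_continuous: "c \<in> A \<Longrightarrow> continuous_map (top_of_set (chart_image c)) M (chart_inv c)"
proof -
  assume c: "c \<in> A"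
  obtain h where h: "homeomorphic_maps (subtopology M (fst c)) (top_of_set (chart_image c)) (snd c) h"
    using chart_homeo[OF c] homeomorphic_map_maps by blast
  then have hc: "continuous_map (top_of_set (chart_image c)) M h"
    unfolding homeomorphic_maps_def using continuous_map_into_fulltopology by blast
  have hx: "h (snd c x) = x" if "x \<in> fst c" for x
    using h that topspace_chart[OF c] by (auto simp: homeomorphic_maps_def)
  show ?thesis
  proof (rule continuous_map_eq[OF hc])
    fix y assume "y \<in> topspace (top_of_set (chart_image c))"
    then have y: "y \<in> chart_image c" by simp
    then show "h y = chart_inv c y" using hx c by auto
  qed
qed

lemma chart_open_image:
  assumes c: "c \<in> A" and U: "openin M U"
  shows "openin (top_of_set half_space) (snd c ` (fst c \<inter> U))"
proof -
  have "openin (subtopology M (fst c)) (fst c \<inter> U)"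
    using U by (auto simp: openin_subtopology)
  then have "openin (top_of_set (chart_image c)) (snd c ` (fst c \<inter> U))"
    using homeomorphic_imp_open_map[OF chart_homeo[OF c]] by (auto simp: open_map_def)
  then show ?thesis using chart_image_openin[OF c] openin_trans by blast
qed

lemma overlap_openin: "c \<in> A \<Longrightarrow> d \<in> A \<Longrightarrow> openin (top_of_set half_space) (overlap c d)"
  using chart_open_image chart_openin by blast

lemma coord_change_analytic: "c \<in> A \<Longrightarrow> d \<in> A \<Longrightarrow> real_analytic_on (overlap c d) (coord_change c d)"
  using atlas by (simp add: real_analytic_atlas_def)

text \<open>
  One series around \<open>x\<close> describes the coordinate change and, by its differential, also
  \<open>transition_deriv\<close> at all points of \<open>c\<close> near \<open>x\<close>. The last conclusion is the form in which
  coordinate changes enter everywhere below.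
\<close>

lemma coord_change_series:
  assumes "c \<in> A" "d \<in> A" "x \<in> fst c" "x \<in> fst d"
  obtains r a where "converges r a" "half_space \<inter> ball (snd c x) r \<subseteq> overlap c d"
    "\<And>y. y \<in> half_space \<inter> ball (snd c x) r \<Longrightarrow> coord_change c d y = psum a (y - snd c x)"
    "\<And>x'. x' \<in> fst c \<Longrightarrow> snd c x' \<in> ball (snd c x) r \<Longrightarrow>
       x' \<in> fst d \<and> snd d x' = psum a (snd c x' - snd c x) \<and>
       transition_deriv c d x' = dsum a (snd c x' - snd c x)"
proof -
  have xo: "snd c x \<in> overlap c d" using assms by blast
  obtain r a where r: "converges r a" "half_space \<inter> ball (snd c x) r \<subseteq> overlap c d"
    "\<And>y. y \<in> half_space \<inter> ball (snd c x) r \<Longrightarrow> coord_change c d y = psum a (y - snd c x)"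
    using real_analytic_local_series[OF coord_change_analytic overlap_openin xo] assms by metis
  show thesis
  proof (rule that[OF r])
    fix x' assume x': "x' \<in> fst c" "snd c x' \<in> ball (snd c x) r"
    then have y: "snd c x' \<in> half_space \<inter> ball (snd c x) r" using chart_in_half_space assms by blast
    then have "snd c x' \<in> overlap c d" using r(2) by blast
    then have "x' \<in> fst d" using chart_inj[OF assms(1)] x'(1) by (auto dest: inj_onD)
    moreover have "snd d x' = psum a (snd c x' - snd c x)" using r(3)[OF y] x' assms by simp
    moreover have "transition_deriv c d x' = dsum a (snd c x' - snd c x)"
      unfolding transition_deriv_def by (rule has_derivative_local_series(2)[OF overlap_openin r y]) (use assms in auto)
    ultimately show "x' \<in> fst d \<and> snd d x' = psum a (snd c x' - snd c x) \<and>
       transition_deriv c d x' = dsum a (snd c x' - snd c x)" by blast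
  qed
qed

lemma transition_deriv_works:
  assumes "c \<in> A" "d \<in> A" "x \<in> fst c" "x \<in> fst d"
  shows "(coord_change c d has_derivative transition_deriv c d x) (at (snd c x) within overlap c d)"
proof -
  obtain r a where r: "converges r a" "half_space \<inter> ball (snd c x) r \<subseteq> overlap c d"
    "\<And>y. y \<in> half_space \<inter> ball (snd c x) r \<Longrightarrow> coord_change c d y = psum a (y - snd c x)"
    by (rule coord_change_series[OF assms]) blast
  have y: "snd c x \<in> half_space \<inter> ball (snd c x) r"
    using chart_in_half_space assms converges_radius_pos[OF r(1)] by auto
  show ?thesis unfolding transition_deriv_def
    using has_derivative_local_series[OF overlap_openin r y] assms by metis
qed

lemma linear_transition_deriv:
  assumes "c \<in> A" "d \<in> A" "x \<in> fst c" "x \<in> fst d"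
  shows "linear (transition_deriv c d x)"
  using transition_deriv_works[OF assms] has_derivative_linear by blast

text \<open>
  The chain rule on the common domain of the three charts.
\<close>

lemma transition_deriv_cocycle:
  assumes c: "c \<in> A" "x \<in> fst c" and d: "d \<in> A" "x \<in> fst d" and e: "e \<in> A" "x \<in> fst e"
  shows "transition_deriv d e x (transition_deriv c d x u) = transition_deriv c e x u"
proof -
  let ?S = "snd c ` (fst c \<inter> (fst d \<inter> fst e))"
  have S: "openin (top_of_set half_space) ?S"
    using chart_open_image[OF c(1)] chart_openin[OF d(1)] chart_openin[OF e(1)] by blast
  have xS: "snd c x \<in> ?S" using c d e by blast
  have 1: "(coord_change c d has_derivative transition_deriv c d x) (at (snd c x) within ?S)"
    by (rule has_derivative_subset[OF transition_deriv_works]) (use c d e in auto)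
  have "(coord_change d e has_derivative transition_deriv d e x) (at (coord_change c d (snd c x)) within coord_change c d ` ?S)"
    using has_derivative_subset[OF transition_deriv_works[of d e x], of "coord_change c d ` ?S"] c d e by fastforce
  from diff_chain_within[OF 1 this]
  have 2: "(coord_change d e \<circ> coord_change c d has_derivative transition_deriv d e x \<circ> transition_deriv c d x) (at (snd c x) within ?S)" .
  have "(coord_change c e has_derivative transition_deriv d e x \<circ> transition_deriv c d x) (at (snd c x) within ?S)"
    by (rule has_derivative_transform[OF xS _ 2]) (use c d in auto)
  moreover have "(coord_change c e has_derivative transition_deriv c e x) (at (snd c x) within ?S)"
    by (rule has_derivative_subset[OF transition_deriv_works]) (use c d e in auto)
  ultimately have "transition_deriv d e x \<circ> transition_deriv c d x = transition_deriv c e x"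
    by (rule half_space_derivative_unique[OF S xS])
  then show ?thesis by (metis comp_apply)
qed

lemma transition_deriv_self:
  assumes c: "c \<in> A" "x \<in> fst c"
  shows "transition_deriv c c x u = u"
proof -
  have "(coord_change c c has_derivative (\<lambda>u. u)) (at (snd c x) within overlap c c)"
    by (rule has_derivative_transform[OF _ _ has_derivative_ident]) (use c in auto)
  then have "transition_deriv c c x = (\<lambda>u. u)"
    using half_space_derivative_unique[OF overlap_openin[OF c(1) c(1)] _ transition_deriv_works[OF c(1) c(1) c(2) c(2)]] c by blast
  then show ?thesis by simp
qed

lemma transition_deriv_inverse:
  assumes "c \<in> A" "x \<in> fst c" "d \<in> A" "x \<in> fst d"
  shows "transition_deriv d c x (transition_deriv c d x u) = u"
  by (subst transition_deriv_cocycle) (use assms in \<open>simp_all add: transition_deriv_self\<close>)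

subsection \<open>Tangent vectors\<close>

lemma tangent_space_change:
  assumes "v \<in> tangent_space A x" "c \<in> A" "x \<in> fst c" "d \<in> A" "x \<in> fst d"
  shows "v d = transition_deriv c d x (v c)"
  using assms unfolding tangent_space_def by blast

lemma coord_vector_in_tangent_space:
  assumes "c \<in> A" "x \<in> fst c"
  shows "coord_vector A x c u \<in> tangent_space A x"
  unfolding tangent_space_def coord_vector_def using assms by (auto simp: transition_deriv_cocycle)

lemma coord_vector_self [simp]: "c \<in> A \<Longrightarrow> x \<in> fst c \<Longrightarrow> coord_vector A x c u c = u"
  by (simp add: coord_vector_def transition_deriv_self)

lemma coord_vector_apply: "d \<in> A \<Longrightarrow> x \<in> fst d \<Longrightarrow> coord_vector A x c u d = transition_deriv c d x u"
  by (simp add: coord_vector_def)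

lemma tangent_vector_eqI:
  assumes "v \<in> tangent_space A x" "w \<in> tangent_space A x" "c \<in> A" "x \<in> fst c" "v c = w c"
  shows "v = w"
proof
  fix d show "v d = w d"
  proof (cases "d \<in> A \<and> x \<in> fst d")
    case True
    then show ?thesis
      using tangent_space_change[OF assms(1,3,4)] tangent_space_change[OF assms(2,3,4)] assms(5) by metis
  next
    case False
    then have "v d = 0" "w d = 0" using assms(1,2) unfolding tangent_space_def by blast+
    then show ?thesis by simp
  qed
qed

lemma coord_vector_of_tangent:
  assumes "v \<in> tangent_space A x" "c \<in> A" "x \<in> fst c"
  shows "coord_vector A x c (v c) = v"
  using assms by (intro tangent_vector_eqI[OF coord_vector_in_tangent_space]) auto

lemma coord_vector_lincomb:
  assumes "c \<in> A" "x \<in> fst c"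
  shows "(\<lambda>d. a *\<^sub>R coord_vector A x c u d + b *\<^sub>R coord_vector A x c w d) = coord_vector A x c (a *\<^sub>R u + b *\<^sub>R w)"
proof
  fix d show "a *\<^sub>R coord_vector A x c u d + b *\<^sub>R coord_vector A x c w d = coord_vector A x c (a *\<^sub>R u + b *\<^sub>R w) d"
  proof (cases "d \<in> A \<and> x \<in> fst d")
    case True
    then have "linear (transition_deriv c d x)" using assms by (intro linear_transition_deriv) auto
    with True show ?thesis by (simp add: coord_vector_def linear_add linear_cmul)
  qed (auto simp: coord_vector_def)
qed

subsection \<open>The boundary in different charts\<close>

text \<open>
  Otherwise a neighbourhood of the point in the coordinates \<open>d\<close> would be open in the whole space, and
  by invariance of domain so would be its image in the coordinates \<open>c\<close>; but the latter lies in the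
  half-space and contains one of its boundary points.
\<close>

lemma boundary_chart_independent:
  assumes c: "c \<in> A" "x \<in> fst c" and d: "d \<in> A" "x \<in> fst d" and bd: "snd c x $ normal_index = 0"
  shows "snd d x $ normal_index = 0"
proof (rule ccontr)
  assume "snd d x $ normal_index \<noteq> 0"
  moreover have "snd d x \<in> half_space" using chart_in_half_space d by blast
  ultimately have pos: "snd d x $ normal_index > 0" by (simp add: half_space_def)
  obtain r where r: "0 < r" "half_space \<inter> ball (snd d x) r \<subseteq> overlap d c"
    using half_space_openin_ball[OF overlap_openin[OF d(1) c(1)]] c d by blast
  define W where "W = ball (snd d x) r \<inter> {y. y $ normal_index > 0}"
  have W: "open W" "snd d x \<in> W" "W \<subseteq> overlap d c"
    using r pos by (auto simp: W_def half_space_def intro!: open_Int open_halfspace_component_gt_cart)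
  have diff: "coord_change d c differentiable (at y within overlap d c)" if "y \<in> overlap d c" for y
    using that transition_deriv_works[OF d(1) c(1)] by (auto simp: differentiable_def)
  have "continuous_on W (coord_change d c)"
    by (rule continuous_on_subset[OF _ W(3)])
      (metis diff differentiable_imp_continuous_within continuous_on_eq_continuous_within)
  moreover have "inj_on (coord_change d c) W"
  proof (rule inj_onI)
    fix y z assume yz: "y \<in> W" "z \<in> W" and eq: "coord_change d c y = coord_change d c z"
    from yz W(3) obtain x1 x2 where x: "x1 \<in> fst d \<inter> fst c" "y = snd d x1" "x2 \<in> fst d \<inter> fst c" "z = snd d x2" by blast
    then have "snd c x1 = snd c x2" using eq d by simp
    then show "y = z" using x chart_inj[OF c(1)] by (auto dest: inj_onD)
  qed
  ultimately have "open (coord_change d c ` W)" using W(1) invariance_of_domain by blast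
  moreover have sx: "snd c x \<in> coord_change d c ` W" using W(2) d by force
  ultimately obtain e where e: "0 < e" "ball (snd c x) e \<subseteq> coord_change d c ` W" by (meson openE)
  have "snd c x - (e/2) *\<^sub>R axis normal_index 1 \<in> ball (snd c x) e" using e by (simp add: dist_norm)
  then have "snd c x - (e/2) *\<^sub>R axis normal_index 1 \<in> coord_change d c ` overlap d c" using e(2) W(3) by blast
  then have "snd c x - (e/2) *\<^sub>R axis normal_index 1 \<in> half_space"
    using chart_in_half_space[OF c(1)] d by auto
  then show False using bd e(1) by (simp add: half_space_def)
qed

lemma mfd_boundary_iff:
  assumes "c \<in> A" "x \<in> fst c"
  shows "x \<in> mfd_boundary M A \<longleftrightarrow> snd c x $ normal_index = 0"
  using assms boundary_chart_independent chart_domain_subset unfolding mfd_boundary_def by blast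

text \<open>
  The normal component of the coordinate change vanishes on the boundary and is nonnegative inside.
  Hence its differential kills the directions tangent to the boundary and is nonnegative on the inner
  normal direction. It is not zero because the differential is invertible.
\<close>

lemma transition_deriv_normal:
  assumes c: "c \<in> A" "x \<in> fst c" and d: "d \<in> A" "x \<in> fst d" and bd: "snd c x $ normal_index = 0"
  obtains a where "0 < a" "\<And>u. transition_deriv c d x u $ normal_index = a * u $ normal_index"
proof -
  let ?n = "normal_index :: 'n" and ?p = "snd c x" and ?D = "transition_deriv c d x"
  have lin: "linear ?D" using c d by (intro linear_transition_deriv)
  obtain r a where r: "converges r a" "half_space \<inter> ball ?p r \<subseteq> overlap c d"
    "\<And>y. y \<in> half_space \<inter> ball ?p r \<Longrightarrow> coord_change c d y = psum a (y - ?p)"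
    and rx: "\<And>x'. x' \<in> fst c \<Longrightarrow> snd c x' \<in> ball (snd c x) r \<Longrightarrow>
       x' \<in> fst d \<and> snd d x' = psum a (snd c x' - snd c x) \<and>
       transition_deriv c d x' = dsum a (snd c x' - snd c x)"
    using coord_change_series[OF c(1) d(1) c(2) d(2)] by metis
  have r0: "0 < r" by (rule converges_radius_pos[OF r(1)])
  have dp: "?D = dsum a 0" using rx[of x] c r0 by simp
  have p0: "psum a 0 $ ?n = 0" using rx[of x] c r0 boundary_chart_independent[OF c d bd] by simp
  \<comment> \<open>One-sided difference quotients suffice and keep the points in the half-space.\<close>
  have lim: "((\<lambda>t. (psum a (t *\<^sub>R u) $ ?n) / t) \<longlongrightarrow> ?D u $ ?n) (at_right 0)" for u
  proof -
    have 1: "((\<lambda>y. psum a (y - 0)) has_derivative dsum a (0 - 0)) (at ((\<lambda>t. t *\<^sub>R u) 0))"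
      using has_derivative_psum'[OF r(1), of 0 0] r0 by simp
    have 2: "((\<lambda>t. t *\<^sub>R u) has_derivative (\<lambda>t. t *\<^sub>R u)) (at 0)" by (auto intro!: derivative_eq_intros)
    have "((\<lambda>t. psum a (t *\<^sub>R u)) has_derivative (\<lambda>t. dsum a 0 (t *\<^sub>R u))) (at 0)"
      using diff_chain_at[OF 2 1] by (simp add: o_def)
    from bounded_linear.has_derivative[OF bounded_linear_vec_nth this, of ?n]
    have "((\<lambda>t. psum a (t *\<^sub>R u) $ ?n) has_real_derivative (?D u $ ?n)) (at 0)"
      unfolding has_field_derivative_def dp[symmetric]
      by (simp add: linear_cmul[OF lin] mult.commute[of _ "?D u $ ?n"] fun_eq_iff)
    then have "((\<lambda>t. (psum a (t *\<^sub>R u) $ ?n - psum a (0 *\<^sub>R u) $ ?n) / (t - 0)) \<longlongrightarrow> ?D u $ ?n) (at 0)"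
      unfolding has_field_derivative_iff by simp
    then show ?thesis using p0 by (auto intro: tendsto_mono[rotated] simp: at_within_le_at)
  qed
  have val: "eventually (\<lambda>t. 0 \<le> psum a (t *\<^sub>R u) $ ?n \<and> (u $ ?n = 0 \<longrightarrow> psum a (t *\<^sub>R u) $ ?n = 0)) (at_right 0)"
    if u: "0 \<le> u $ ?n" for u
  proof -
    have "((\<lambda>t::real. t *\<^sub>R u) \<longlongrightarrow> 0 *\<^sub>R u) (at_right 0)" by (intro tendsto_intros)
    then have "eventually (\<lambda>t. dist (t *\<^sub>R u) 0 < r) (at_right 0)"
      using tendstoD[OF _ r0] by (simp only: scaleR_zero_left)
    moreover have "eventually (\<lambda>t::real. t > 0) (at_right 0)" by (rule eventually_at_right_less)
    ultimately show ?thesis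
    proof eventually_elim
      case (elim t)
      let ?y = "?p + t *\<^sub>R u"
      have y: "?y \<in> half_space \<inter> ball ?p r"
        using elim u bd by (simp add: half_space_def dist_norm)
      then obtain x' where x': "x' \<in> fst c" "x' \<in> fst d" "?y = snd c x'" using r(2) by blast
      then have e: "snd d x' = psum a (t *\<^sub>R u)" using rx[of x'] y by (metis IntD2 add_diff_cancel_left')
      have "snd d x' \<in> half_space" using chart_in_half_space d x' by blast
      moreover have "snd d x' $ ?n = 0" if "u $ ?n = 0"
      proof -
        have "snd c x' $ ?n = 0" unfolding x'(3)[symmetric] using bd that by simp
        then show ?thesis using boundary_chart_independent[of c x' d] c d x' by blast
      qed
      ultimately show ?case unfolding e by (simp add: half_space_def)
    qed
  qed
  have zero: "?D u $ ?n = 0" if u: "u $ ?n = 0" for u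
  proof -
    have "((\<lambda>t. (psum a (t *\<^sub>R u) $ ?n) / t) \<longlongrightarrow> 0) (at_right 0)"
      proof (rule tendsto_eventually)
      have "0 \<le> u $ ?n" using u by simp
      from val[OF this] show "eventually (\<lambda>t. (psum a (t *\<^sub>R u) $ ?n) / t = 0) (at_right 0)"
        by eventually_elim (simp add: u)
    qed
    then show ?thesis using tendsto_unique[OF trivial_limit_at_right_real lim[of u]] by blast
  qed
  define a0 where "a0 = ?D (axis ?n 1) $ ?n"
  have "0 \<le> a0" unfolding a0_def
  proof (rule tendsto_lowerbound[OF lim])
    show "eventually (\<lambda>t. 0 \<le> psum a (t *\<^sub>R axis ?n 1) $ ?n / t) (at_right 0)"
    proof -
      have "(0::real) \<le> (axis ?n 1 :: real^'n) $ ?n" by (simp add: axis_def)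
      from val[OF this] eventually_at_right_less[of "0::real"] show ?thesis
        by eventually_elim simp
    qed
  qed simp
  have rep: "?D u $ ?n = a0 * u $ ?n" for u
  proof -
    have "?D (u - (u $ ?n) *\<^sub>R axis ?n 1) = ?D u - (u $ ?n) *\<^sub>R ?D (axis ?n 1)"
      by (simp add: linear_diff[OF lin] linear_cmul[OF lin])
    moreover have "?D (u - (u $ ?n) *\<^sub>R axis ?n 1) $ ?n = 0" by (rule zero) (simp add: axis_def)
    ultimately show ?thesis by (simp add: a0_def)
  qed
  have "a0 \<noteq> 0"
  proof
    assume "a0 = 0"
    then have "?D (transition_deriv d c x (axis ?n 1)) $ ?n = 0" using rep by simp
    then show False using transition_deriv_inverse[OF d c] by simp
  qed
  with \<open>0 \<le> a0\<close> rep show thesis by (intro that[of a0]) auto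
qed

end

section \<open>Metric and Levi-Civita connection in coordinates\<close>

lemma axis_expansion: "(\<Sum>i\<in>UNIV. u $ i *\<^sub>R axis i 1) = (u :: real^'n::finite)"
  using basis_expansion[of u] by (simp add: scalar_mult_eq_scaleR)

lemma matrix_inv_right:
  fixes G :: "real^'n^'n::finite"
  assumes "invertible G" shows "G ** matrix_inv G = mat 1"
  using assms unfolding invertible_def matrix_inv_def by (metis (mono_tags, lifting) someI_ex)

definition gform :: "real^'n^'n::finite \<Rightarrow> real^'n \<Rightarrow> real^'n \<Rightarrow> real" where
  "gform G u w = u \<bullet> (G *v w)"

lemma gform_sum: "gform G u w = (\<Sum>i\<in>UNIV. \<Sum>j\<in>UNIV. u $ i * w $ j * G $ i $ j)"
  unfolding gform_def inner_vec_def matrix_vector_mult_def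
  by (simp add: sum_distrib_left ac_simps)

lemma gform_simps:
  "gform G (u + u') w = gform G u w + gform G u' w"
  "gform G (u - u') w = gform G u w - gform G u' w"
  "gform G (a *\<^sub>R u) w = a * gform G u w"
  "gform G u (w + w') = gform G u w + gform G u w'"
  "gform G u (w - w') = gform G u w - gform G u w'"
  "gform G u (a *\<^sub>R w) = a * gform G u w"
  "gform G 0 w = 0" "gform G u 0 = 0" "gform G (- u) w = - gform G u w"
  by (simp_all add: gform_def inner_add_left inner_diff_left inner_add_right inner_diff_right
      matrix_vector_right_distrib matrix_vector_mult_diff_distrib matrix_vector_mult_scaleR algebra_simps)

lemma bounded_bilinear_matrix_vector_real:
  "bounded_bilinear ((*v) :: real^'n^'n::finite \<Rightarrow> real^'n \<Rightarrow> real^'n)"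
proof -
  have "bilinear ((*v) :: real^'n^'n \<Rightarrow> real^'n \<Rightarrow> real^'n)"
    unfolding bilinear_def
    by (auto intro!: linearI simp: matrix_vector_mult_def vec_eq_iff sum.distrib algebra_simps scaleR_sum_right sum_distrib_left)
  then show ?thesis by (simp add: bilinear_conv_bounded_bilinear)
qed

lemma has_derivative_gform:
  fixes G :: "'a::real_normed_vector \<Rightarrow> real^'n^'n::finite"
  assumes "(G has_derivative G') (at x within S)" "(u has_derivative u') (at x within S)" "(w has_derivative w') (at x within S)"
  shows "((\<lambda>x. gform (G x) (u x) (w x)) has_derivative
    (\<lambda>h. gform (G' h) (u x) (w x) + gform (G x) (u' h) (w x) + gform (G x) (u x) (w' h))) (at x within S)"
proof -
  have "((\<lambda>x. G x *v w x) has_derivative (\<lambda>h. G x *v w' h + G' h *v w x)) (at x within S)"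
    by (rule bounded_bilinear.FDERIV[OF bounded_bilinear_matrix_vector_real assms(1,3)])
  from bounded_bilinear.FDERIV[OF bounded_bilinear_inner assms(2) this]
  show ?thesis unfolding gform_def by (rule has_derivative_eq_rhs) (auto simp: fun_eq_iff inner_add_right)
qed

definition posdef :: "real^'n^'n::finite \<Rightarrow> bool" where
  "posdef G \<longleftrightarrow> (\<forall>i j. G $ i $ j = G $ j $ i) \<and> (\<forall>u. u \<noteq> 0 \<longrightarrow> 0 < gform G u u)"

lemma gform_commute:
  assumes "posdef G" shows "gform G u w = gform G w u"
proof -
  have "gform G u w = (\<Sum>j\<in>UNIV. \<Sum>i\<in>UNIV. u $ i * w $ j * G $ i $ j)"
    unfolding gform_sum by (rule sum.swap)
  also have "\<dots> = gform G w u"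
    unfolding gform_sum using assms by (intro sum.cong refl) (simp add: posdef_def mult.commute[of "u $ _"])
  finally show ?thesis .
qed

lemma posdef_eqI:
  assumes "posdef G" "\<And>w. gform G u w = gform G u' w" shows "u = u'"
proof (rule ccontr)
  assume "u \<noteq> u'"
  then have "0 < gform G (u - u') (u - u')" using assms(1) by (simp add: posdef_def)
  then show False using assms(2) by (simp add: gform_simps(2))
qed

lemma posdef_invertible:
  assumes "posdef G" shows "invertible G"
proof -
  have "u = 0" if "G *v u = 0" for u
    using assms that by (force simp: posdef_def gform_def)
  then have "\<exists>B. B ** G = mat 1" by (subst matrix_left_invertible_ker) blast
  then show ?thesis by (simp add: invertible_left_inverse)
qed

lemma gform_matrix_inv:
  assumes "posdef G" shows "gform G (matrix_inv G *v q) w = q \<bullet> w"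
proof -
  have "gform G (matrix_inv G *v q) w = gform G w (matrix_inv G *v q)" by (rule gform_commute[OF assms])
  also have "\<dots> = w \<bullet> ((G ** matrix_inv G) *v q)" by (simp add: gform_def matrix_vector_mul_assoc)
  also have "\<dots> = q \<bullet> w" using matrix_inv_right[OF posdef_invertible[OF assms]] by (simp add: inner_commute)
  finally show ?thesis .
qed

text \<open>
  Cramer's rule, which transfers differentiability and Lipschitz continuity from a matrix to its
  inverse.
\<close>

lemma matrix_inv_cramer:
  fixes G :: "real^'n^'n::finite"
  assumes "invertible G"
  shows "(matrix_inv G *v b) $ k = det (\<chi> i j. if j = k then b $ i else G $ i $ j) / det G"
proof -
  have "det G \<noteq> 0" using assms by (simp add: invertible_det_nz)
  moreover have "G *v (matrix_inv G *v b) = b"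
    by (simp add: matrix_vector_mul_assoc matrix_inv_right[OF assms])
  ultimately have "matrix_inv G *v b = (\<chi> k. det (\<chi> i j. if j = k then b $ i else G $ i $ j) / det G)"
    by (simp add: cramer)
  then show ?thesis by simp
qed

lemma differentiable_vec_lambda:
  fixes f :: "'i::finite \<Rightarrow> 'a::real_normed_vector \<Rightarrow> real"
  assumes "\<And>i. f i differentiable (at x)"
  shows "(\<lambda>y. \<chi> i. f i y) differentiable (at x)"
proof -
  have "(\<lambda>y. \<chi> i. f i y) = (\<lambda>y. \<Sum>i\<in>UNIV. f i y *\<^sub>R axis i 1)"
  proof
    fix y show "(\<chi> i. f i y) = (\<Sum>i\<in>UNIV. f i y *\<^sub>R axis i 1)"
      using axis_expansion[of "\<chi> i. f i y"] by simp
  qed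
  moreover have "(\<lambda>y. \<Sum>i\<in>UNIV. f i y *\<^sub>R (axis i 1 :: real^'i)) differentiable (at x)"
    by (intro differentiable_sum finite differentiable_scaleR assms differentiable_const ballI)
  ultimately show ?thesis by simp
qed

lemma differentiable_det:
  fixes G :: "'a::real_normed_vector \<Rightarrow> real^'n^'n::finite"
  assumes "\<And>i j. (\<lambda>y. G y $ i $ j) differentiable (at x)"
  shows "(\<lambda>y. det (G y)) differentiable (at x)"
proof -
  obtain D where D: "\<And>i j. ((\<lambda>y. G y $ i $ j) has_derivative D i j) (at x)"
    using assms unfolding differentiable_def by metis
  have "(\<lambda>y. \<Prod>i\<in>UNIV. G y $ i $ p i) differentiable (at x)" for p
    unfolding differentiable_def by (rule exI, rule has_derivative_prod, rule D)
  then show ?thesis unfolding det_def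
    by (intro differentiable_sum differentiable_mult differentiable_const) (auto simp: finite_permutations)
qed

lemma has_derivative_dsum_arg:
  fixes a :: "('n::finite \<Rightarrow> nat) \<Rightarrow> 'b::banach" and k :: "real^'n \<Rightarrow> real^'n"
  assumes "converges r a" "x \<in> ball p r" and k: "(k has_derivative k') (at x within S)"
  shows "((\<lambda>y. dsum a (y - p) (k y)) has_derivative
    (\<lambda>h. ddsum a (x - p) h (k x) + dsum a (x - p) (k' h))) (at x within S)"
proof -
  have "((\<lambda>y. \<Sum>i\<in>UNIV. k y $ i *\<^sub>R psum (coeff_deriv i a) (y - p)) has_derivative
      (\<lambda>h. \<Sum>i\<in>UNIV. k x $ i *\<^sub>R dsum (coeff_deriv i a) (x - p) h + k' h $ i *\<^sub>R psum (coeff_deriv i a) (x - p))) (at x within S)"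
    by (intro has_derivative_sum has_derivative_scaleR bounded_linear.has_derivative[OF bounded_linear_vec_nth k]
        has_derivative_psum'[OF converges_coeff_deriv[OF assms(1)] assms(2)])
  then show ?thesis by (simp add: dsum_def[of a] ddsum_def sum.distrib)
qed

lemma has_vector_derivative_line:
  fixes F :: "'a::real_normed_vector \<Rightarrow> 'b::real_normed_vector"
  assumes "(F has_derivative F') (at p)"
  shows "((\<lambda>t. F (p + t *\<^sub>R u)) has_vector_derivative F' u) (at 0)"
proof -
  have lin: "linear F'" using assms has_derivative_linear by blast
  have "((\<lambda>t. p + t *\<^sub>R u) has_derivative (\<lambda>t. t *\<^sub>R u)) (at 0)" by (auto intro!: derivative_eq_intros)
  moreover have "(F has_derivative F') (at (p + 0 *\<^sub>R u))" using assms by simp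
  ultimately have "(F \<circ> (\<lambda>t. p + t *\<^sub>R u) has_derivative F' \<circ> (\<lambda>t. t *\<^sub>R u)) (at 0)" by (rule diff_chain_at)
  then show ?thesis by (simp add: has_vector_derivative_def o_def linear_cmul[OF lin])
qed

lemma has_vector_derivative_transform_nhds:
  fixes f h :: "real \<Rightarrow> 'a::real_normed_vector"
  assumes f: "(f has_vector_derivative f') (at x)" and ev: "eventually (\<lambda>t. f t = h t) (nhds x)"
  shows "(h has_vector_derivative f') (at x)"
proof -
  obtain W where W: "open W" "x \<in> W" "\<And>t. t \<in> W \<Longrightarrow> f t = h t"
    using ev unfolding eventually_nhds by blast
  show ?thesis
    using has_derivative_transform_within_open[OF f[unfolded has_vector_derivative_def] W]
    by (simp add: has_vector_derivative_def)
qed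

text \<open>
  Used for lines in the boundary: functions such as the unit normal are known along them, but not in a
  neighbourhood.
\<close>

lemma line_derivatives_eq:
  fixes F H :: "'a::real_normed_vector \<Rightarrow> 'b::real_normed_vector"
  assumes F: "(F has_derivative F') (at p)" and H: "(H has_derivative H') (at p)"
    and ev: "eventually (\<lambda>t. F (p + t *\<^sub>R u) = H (p + t *\<^sub>R u)) (nhds (0::real))"
  shows "F' u = H' u"
proof -
  have "((\<lambda>t. H (p + t *\<^sub>R u)) has_vector_derivative F' u) (at 0)"
    by (rule has_vector_derivative_transform_nhds[OF has_vector_derivative_line[OF F] ev])
  then show ?thesis using has_vector_derivative_line[OF H, of u] vector_derivative_unique_at by blast
qed

lemma line_eventually_in_ball:
  fixes p u :: "'a::real_normed_vector"
  assumes "0 < r" shows "eventually (\<lambda>t. p + t *\<^sub>R u \<in> ball p r) (nhds (0::real))"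
proof -
  have "((\<lambda>t. p + t *\<^sub>R u) \<longlongrightarrow> p + 0 *\<^sub>R u) (nhds 0)" by (intro tendsto_intros filterlim_ident)
  from topological_tendstoD[OF this, of "ball p r"] assms show ?thesis by simp
qed

locale analytic_riemannian = analytic_atlas M A
  for M :: "'m topology" and A :: "('m, 'n::finite) chart set" +
  fixes g :: "('m, 'n) metric"
  assumes inner: "\<And>x. x \<in> topspace M \<Longrightarrow> inner_product_on_tangent_space A g x"
    and metric_analytic: "\<And>c. c \<in> A \<Longrightarrow> real_analytic_on (chart_image c) (metric_matrix A g c)"
begin

abbreviation gmat :: "('m, 'n) chart \<Rightarrow> real^'n \<Rightarrow> real^'n^'n" where
  "gmat c y \<equiv> metric_matrix A g c y"

abbreviation chr :: "('m, 'n) chart \<Rightarrow> real^'n \<Rightarrow> real^'n \<Rightarrow> real^'n \<Rightarrow> real^'n" where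
  "chr c y \<equiv> christoffel_vec A g c y"

definition mderiv :: "('m, 'n) chart \<Rightarrow> real^'n \<Rightarrow> real^'n \<Rightarrow> real^'n^'n" where
  "mderiv c y h = frechet_derivative (gmat c) (at y within chart_image c) h"

lemma
  assumes "x \<in> topspace M"
  shows metric_linear: "\<lbrakk>u \<in> tangent_space A x; v \<in> tangent_space A x; w \<in> tangent_space A x\<rbrakk> \<Longrightarrow>
      g x (\<lambda>c. a *\<^sub>R u c + b *\<^sub>R v c) w = a * g x u w + b * g x v w"
    and metric_sym: "\<lbrakk>v \<in> tangent_space A x; w \<in> tangent_space A x\<rbrakk> \<Longrightarrow> g x v w = g x w v"
    and metric_pos: "\<lbrakk>v \<in> tangent_space A x; v \<noteq> (\<lambda>_. 0)\<rbrakk> \<Longrightarrow> 0 < g x v v"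
  using inner[OF assms] unfolding inner_product_on_tangent_space_def by (fast, fast, fast)

text \<open>
  Bilinearity of \<open>g\<close> on the tangent space gives the expansion in the basis of coordinate vectors.
\<close>

lemma metric_in_coords:
  assumes c: "c \<in> A" "x \<in> fst c" and v: "v \<in> tangent_space A x" and w: "w \<in> tangent_space A x"
  shows "g x v w = gform (gmat c (snd c x)) (v c) (w c)"
proof -
  define B where "B = (\<lambda>u w. g x (coord_vector A x c u) (coord_vector A x c w))"
  have x: "x \<in> topspace M" using c chart_domain_subset by blast
  note cv = coord_vector_in_tangent_space[OF c]
  have lin: "B (a *\<^sub>R u + b *\<^sub>R u') w = a * B u w + b * B u' w" for a b u u' w
  proof -
    have "B (a *\<^sub>R u + b *\<^sub>R u') w
      = g x (\<lambda>d. a *\<^sub>R coord_vector A x c u d + b *\<^sub>R coord_vector A x c u' d) (coord_vector A x c w)"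
      unfolding B_def coord_vector_lincomb[OF c] ..
    also have "\<dots> = a * B u w + b * B u' w" unfolding B_def by (intro metric_linear[OF x] cv)
    finally show ?thesis .
  qed
  have sym: "B u w = B w u" for u w unfolding B_def by (intro metric_sym[OF x] cv)
  have l1: "linear (\<lambda>u. B u w)" for w
    using lin[of 1 _ 1] lin[of _ _ 0] by (intro linearI) auto
  have ex: "B u w = (\<Sum>i\<in>UNIV. u $ i * B (axis i 1) w)" for u w
  proof -
    have "u = (\<Sum>i\<in>UNIV. u $ i *\<^sub>R axis i 1)" by (simp add: axis_expansion)
    then have "B u w = B (\<Sum>i\<in>UNIV. u $ i *\<^sub>R axis i 1) w" by simp
    also have "\<dots> = (\<Sum>i\<in>UNIV. u $ i * B (axis i 1) w)"
      by (simp add: linear_sum[OF l1] linear_cmul[OF l1])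
    finally show ?thesis .
  qed
  have ex2: "B u w = (\<Sum>j\<in>UNIV. w $ j * B u (axis j 1))" for u w
  proof -
    have "B u w = B w u" by (rule sym)
    also have "\<dots> = (\<Sum>j\<in>UNIV. w $ j * B (axis j 1) u)" by (rule ex)
    also have "\<dots> = (\<Sum>j\<in>UNIV. w $ j * B u (axis j 1))"
      by (intro sum.cong refl arg_cong2[where f = "(*)"] sym)
    finally show ?thesis .
  qed
  have "g x v w = B (v c) (w c)" unfolding B_def coord_vector_of_tangent[OF v c] coord_vector_of_tangent[OF w c] ..
  also have "\<dots> = (\<Sum>i\<in>UNIV. v c $ i * B (axis i 1) (w c))" by (rule ex)
  also have "\<dots> = (\<Sum>i\<in>UNIV. v c $ i * (\<Sum>j\<in>UNIV. w c $ j * B (axis i 1) (axis j 1)))"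
    by (intro sum.cong refl arg_cong2[where f = "(*)"] ex2)
  also have "\<dots> = gform (gmat c (snd c x)) (v c) (w c)"
    unfolding gform_sum metric_matrix_def using c
    by (simp add: B_def sum_distrib_left ac_simps)
  finally show ?thesis .
qed

lemma gmat_entry:
  assumes "c \<in> A" "x \<in> fst c"
  shows "gmat c (snd c x) $ i $ j = g x (coord_vector A x c (axis i 1)) (coord_vector A x c (axis j 1))"
  using assms by (simp add: metric_matrix_def)

lemma gmat_posdef:
  assumes c: "c \<in> A" "x \<in> fst c" shows "posdef (gmat c (snd c x))"
proof -
  have x: "x \<in> topspace M" using c chart_domain_subset by blast
  note cv = coord_vector_in_tangent_space[OF c]
  have "0 < gform (gmat c (snd c x)) u u" if "u \<noteq> 0" for u
  proof -
    have "coord_vector A x c u \<noteq> (\<lambda>_. 0)" using that coord_vector_self[OF c, of u] by auto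
    then have "0 < g x (coord_vector A x c u) (coord_vector A x c u)" by (intro metric_pos[OF x] cv)
    then show ?thesis using metric_in_coords[OF c cv cv, of u u] c by simp
  qed
  then show ?thesis unfolding posdef_def gmat_entry[OF c] using metric_sym[OF x cv cv] by simp
qed

text \<open>
  Both sides are the metric at \<open>x\<close> of the same pair of tangent vectors.
\<close>

lemma metric_change:
  assumes c: "c \<in> A" "x \<in> fst c" and d: "d \<in> A" "x \<in> fst d"
  shows "gform (gmat d (snd d x)) (transition_deriv c d x u) (transition_deriv c d x w) = gform (gmat c (snd c x)) u w"
proof -
  note cv = coord_vector_in_tangent_space[OF c]
  have "g x (coord_vector A x c u) (coord_vector A x c w) = gform (gmat c (snd c x)) u w"
    using metric_in_coords[OF c cv cv] c by simp
  moreover have "g x (coord_vector A x c u) (coord_vector A x c w)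
     = gform (gmat d (snd d x)) (transition_deriv c d x u) (transition_deriv c d x w)"
    using metric_in_coords[OF d cv cv] d by (simp add: coord_vector_apply)
  ultimately show ?thesis by simp
qed

lemma metric_series:
  assumes c: "c \<in> A" "x \<in> fst c"
  obtains r b where "converges r b" "half_space \<inter> ball (snd c x) r \<subseteq> chart_image c"
    "\<And>y. y \<in> half_space \<inter> ball (snd c x) r \<Longrightarrow> gmat c y = psum b (y - snd c x)"
    "\<And>y. y \<in> half_space \<inter> ball (snd c x) r \<Longrightarrow> mderiv c y = dsum b (y - snd c x)"
proof -
  have xc: "snd c x \<in> chart_image c" using c by blast
  obtain r b where r: "converges r b" "half_space \<inter> ball (snd c x) r \<subseteq> chart_image c"
    "\<And>y. y \<in> half_space \<inter> ball (snd c x) r \<Longrightarrow> gmat c y = psum b (y - snd c x)"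
    by (rule real_analytic_local_series[OF metric_analytic[OF c(1)] chart_image_openin[OF c(1)] xc]) blast
  show thesis
  proof (rule that[OF r])
    fix y assume "y \<in> half_space \<inter> ball (snd c x) r"
    then show "mderiv c y = dsum b (y - snd c x)"
      unfolding mderiv_def[abs_def] using has_derivative_local_series(2)[OF chart_image_openin[OF c(1)] r] by simp
  qed
qed

lemma gmat_has_derivative:
  assumes c: "c \<in> A" "x \<in> fst c"
  shows "(gmat c has_derivative mderiv c (snd c x)) (at (snd c x) within chart_image c)"
proof -
  obtain r b where r: "converges r b" "half_space \<inter> ball (snd c x) r \<subseteq> chart_image c"
    "\<And>y. y \<in> half_space \<inter> ball (snd c x) r \<Longrightarrow> gmat c y = psum b (y - snd c x)"
    by (rule metric_series[OF c]) blast
  have y: "snd c x \<in> half_space \<inter> ball (snd c x) r"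
    using chart_in_half_space[OF c] converges_radius_pos[OF r(1)] by auto
  show ?thesis unfolding mderiv_def[abs_def]
    using has_derivative_local_series[OF chart_image_openin[OF c(1)] r y] by simp
qed

lemma mderiv_pderiv:
  assumes c: "c \<in> A" "x \<in> fst c"
  shows "mderiv c (snd c x) h $ i $ j = (\<Sum>l\<in>UNIV. h $ l * metric_pderiv A g c (snd c x) l i j)"
proof -
  have lin: "linear (mderiv c (snd c x))" using gmat_has_derivative[OF c] has_derivative_linear by blast
  have "mderiv c (snd c x) h = mderiv c (snd c x) (\<Sum>l\<in>UNIV. h $ l *\<^sub>R axis l 1)"
    by (simp add: axis_expansion)
  also have "\<dots> = (\<Sum>l\<in>UNIV. h $ l *\<^sub>R mderiv c (snd c x) (axis l 1))"
    by (simp add: linear_sum[OF lin] linear_cmul[OF lin])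
  finally show ?thesis by (simp add: metric_pderiv_def mderiv_def)
qed

lemma gform_commute_mderiv:
  assumes c: "c \<in> A" "x \<in> fst c"
  shows "gform (mderiv c (snd c x) h) u w = gform (mderiv c (snd c x) h) w u"
proof -
  have L: "((\<lambda>y. gform (gmat c y) u w) has_derivative
      (\<lambda>h. gform (mderiv c (snd c x) h) u w)) (at (snd c x) within chart_image c)" for u w
    using has_derivative_gform[OF gmat_has_derivative[OF c] has_derivative_const has_derivative_const]
    by (simp add: gform_simps)
  have xc: "snd c x \<in> chart_image c" using c by blast
  have "((\<lambda>y. gform (gmat c y) u w) has_derivative
      (\<lambda>h. gform (mderiv c (snd c x) h) w u)) (at (snd c x) within chart_image c)"
    by (rule has_derivative_transform[OF xc _ L[of w u]]) (use gform_commute[OF gmat_posdef[OF c(1)]] in auto)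
  from half_space_derivative_unique[OF chart_image_openin[OF c(1)] xc L[of u w] this] show ?thesis by (rule fun_cong)
qed

text \<open>
  The Koszul formula for coordinate fields, whose Lie brackets vanish. It replaces computations with
  the inverse metric by identities between bilinear forms.
\<close>

lemma koszul:
  assumes c: "c \<in> A" "x \<in> fst c"
  defines "y \<equiv> snd c x"
  shows "2 * gform (gmat c y) (chr c y u w) e =
    gform (mderiv c y u) w e + gform (mderiv c y w) u e - gform (mderiv c y e) u w"
proof -
  let ?p = "metric_pderiv A g c y"
  define X where "X = (\<lambda>i j l. ?p i j l + ?p j i l - ?p l i j)"
  define q :: "real^'n" where "q = (\<chi> l. (1/2) * (\<Sum>i\<in>UNIV. \<Sum>j\<in>UNIV. X i j l * u $ i * w $ j))"
  have "chr c y u w = matrix_inv (gmat c y) *v q"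
  proof (subst vec_eq_iff, rule allI)
    fix k
    have "chr c y u w $ k = (\<Sum>i\<in>UNIV. \<Sum>j\<in>UNIV. \<Sum>l\<in>UNIV. matrix_inv (gmat c y) $ k $ l * ((1/2) * (X i j l * u $ i * w $ j)))"
      unfolding christoffel_vec_def christoffel_def X_def
      by (simp add: sum_distrib_left sum_distrib_right ac_simps)
    also have "\<dots> = (\<Sum>i\<in>UNIV. \<Sum>l\<in>UNIV. \<Sum>j\<in>UNIV. matrix_inv (gmat c y) $ k $ l * ((1/2) * (X i j l * u $ i * w $ j)))"
      by (intro sum.cong refl sum.swap)
    also have "\<dots> = (\<Sum>l\<in>UNIV. \<Sum>i\<in>UNIV. \<Sum>j\<in>UNIV. matrix_inv (gmat c y) $ k $ l * ((1/2) * (X i j l * u $ i * w $ j)))"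
      by (rule sum.swap)
    also have "\<dots> = (matrix_inv (gmat c y) *v q) $ k"
      by (simp only: matrix_vector_mult_def q_def vec_lambda_beta sum_distrib_left)
    finally show "chr c y u w $ k = (matrix_inv (gmat c y) *v q) $ k" .
  qed
  then have "2 * gform (gmat c y) (chr c y u w) e = 2 * (q \<bullet> e)"
    using gform_matrix_inv[OF gmat_posdef[OF c]] by (simp add: y_def)
  also have "\<dots> = (\<Sum>l\<in>UNIV. \<Sum>i\<in>UNIV. \<Sum>j\<in>UNIV. X i j l * u $ i * w $ j * e $ l)"
    by (simp add: inner_vec_def q_def sum_distrib_left sum_distrib_right)
  also have "\<dots> = (\<Sum>l\<in>UNIV. \<Sum>i\<in>UNIV. \<Sum>j\<in>UNIV. ?p i j l * u $ i * w $ j * e $ l)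
      + (\<Sum>l\<in>UNIV. \<Sum>i\<in>UNIV. \<Sum>j\<in>UNIV. ?p j i l * u $ i * w $ j * e $ l)
      - (\<Sum>l\<in>UNIV. \<Sum>i\<in>UNIV. \<Sum>j\<in>UNIV. ?p l i j * u $ i * w $ j * e $ l)"
    unfolding X_def by (simp add: sum.distrib sum_subtractf algebra_simps)
  also have "(\<Sum>l\<in>UNIV. \<Sum>i\<in>UNIV. \<Sum>j\<in>UNIV. ?p i j l * u $ i * w $ j * e $ l) = gform (mderiv c y u) w e"
  proof -
    have "(\<Sum>l\<in>UNIV. \<Sum>i\<in>UNIV. \<Sum>j\<in>UNIV. ?p i j l * u $ i * w $ j * e $ l)
      = (\<Sum>l\<in>UNIV. \<Sum>j\<in>UNIV. \<Sum>i\<in>UNIV. ?p i j l * u $ i * w $ j * e $ l)"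
      by (intro sum.cong refl sum.swap)
    also have "\<dots> = (\<Sum>j\<in>UNIV. \<Sum>l\<in>UNIV. \<Sum>i\<in>UNIV. ?p i j l * u $ i * w $ j * e $ l)" by (rule sum.swap)
    also have "\<dots> = gform (mderiv c y u) w e"
      unfolding gform_sum y_def mderiv_pderiv[OF c] by (simp add: sum_distrib_left ac_simps)
    finally show ?thesis .
  qed
  also have "(\<Sum>l\<in>UNIV. \<Sum>i\<in>UNIV. \<Sum>j\<in>UNIV. ?p j i l * u $ i * w $ j * e $ l) = gform (mderiv c y w) u e"
  proof -
    have "(\<Sum>l\<in>UNIV. \<Sum>i\<in>UNIV. \<Sum>j\<in>UNIV. ?p j i l * u $ i * w $ j * e $ l)
      = (\<Sum>i\<in>UNIV. \<Sum>l\<in>UNIV. \<Sum>j\<in>UNIV. ?p j i l * u $ i * w $ j * e $ l)" by (rule sum.swap)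
    also have "\<dots> = gform (mderiv c y w) u e"
      unfolding gform_sum y_def mderiv_pderiv[OF c] by (simp add: sum_distrib_left ac_simps)
    finally show ?thesis .
  qed
  also have "(\<Sum>l\<in>UNIV. \<Sum>i\<in>UNIV. \<Sum>j\<in>UNIV. ?p l i j * u $ i * w $ j * e $ l) = gform (mderiv c y e) u w"
  proof -
    have "(\<Sum>l\<in>UNIV. \<Sum>i\<in>UNIV. \<Sum>j\<in>UNIV. ?p l i j * u $ i * w $ j * e $ l)
      = (\<Sum>i\<in>UNIV. \<Sum>l\<in>UNIV. \<Sum>j\<in>UNIV. ?p l i j * u $ i * w $ j * e $ l)" by (rule sum.swap)
    also have "\<dots> = (\<Sum>i\<in>UNIV. \<Sum>j\<in>UNIV. \<Sum>l\<in>UNIV. ?p l i j * u $ i * w $ j * e $ l)"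
      by (intro sum.cong refl sum.swap)
    also have "\<dots> = gform (mderiv c y e) u w"
      unfolding gform_sum y_def mderiv_pderiv[OF c] by (simp add: sum_distrib_left ac_simps)
    finally show ?thesis .
  qed
  finally show ?thesis .
qed

text \<open>
  The product rule applied to \<open>metric_change\<close> as an identity between functions of the base point.
\<close>

lemma metric_change_deriv:
  assumes c: "c \<in> A" "x \<in> fst c" and d: "d \<in> A" "x \<in> fst d"
    and rep: "converges r a" "\<And>x'. x' \<in> fst c \<Longrightarrow> snd c x' \<in> ball (snd c x) r \<Longrightarrow>
       x' \<in> fst d \<and> snd d x' = psum a (snd c x' - snd c x) \<and>
       transition_deriv c d x' = dsum a (snd c x' - snd c x)"
  shows "gform (mderiv d (snd d x) (dsum a 0 h)) (dsum a 0 u) (dsum a 0 w)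
      + gform (gmat d (snd d x)) (ddsum a 0 h u) (dsum a 0 w)
      + gform (gmat d (snd d x)) (dsum a 0 u) (ddsum a 0 h w) = gform (mderiv c (snd c x) h) u w"
proof -
  let ?p = "snd c x"
  have r0: "0 < r" by (rule converges_radius_pos[OF rep(1)])
  obtain s where s: "0 < s" "half_space \<inter> ball ?p s \<subseteq> chart_image c"
    using half_space_openin_ball[OF chart_image_openin[OF c(1)]] c by blast
  define t where "t = min r s"
  let ?S = "half_space \<inter> ball ?p t"
  have t: "0 < t" "t \<le> r" "t \<le> s" using r0 s by (auto simp: t_def)
  have S: "openin (top_of_set half_space) ?S" by (auto simp: openin_open)
  have pS: "?p \<in> ?S" using chart_in_half_space[OF c] t by simp
  have pt: "\<exists>x'. x' \<in> fst c \<and> y = snd c x' \<and> snd c x' \<in> ball ?p r" if "y \<in> ?S" for y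
    using that s t by fastforce
  have d1: "((\<lambda>y. psum a (y - ?p)) has_derivative dsum a 0) (at ?p within ?S)"
    using has_derivative_psum'[OF rep(1), of ?p ?p] r0 by simp
  have "(gmat d has_derivative mderiv d (snd d x)) (at (psum a (?p - ?p)) within (\<lambda>y. psum a (y - ?p)) ` ?S)"
  proof (rule has_derivative_subset)
    show "(gmat d has_derivative mderiv d (snd d x)) (at (psum a (?p - ?p)) within chart_image d)"
      using gmat_has_derivative[OF d] rep(2)[OF c(2)] r0 by simp
    show "(\<lambda>y. psum a (y - ?p)) ` ?S \<subseteq> chart_image d"
    proof
      fix z assume "z \<in> (\<lambda>y. psum a (y - ?p)) ` ?S"
      then obtain y where y: "y \<in> ?S" "z = psum a (y - ?p)" by blast
      with pt rep(2) show "z \<in> chart_image d" by (metis imageI)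
    qed
  qed
  from diff_chain_within[OF d1 this]
  have d2: "((\<lambda>y. gmat d (psum a (y - ?p))) has_derivative (\<lambda>h. mderiv d (snd d x) (dsum a 0 h))) (at ?p within ?S)"
    by (simp add: o_def)
  have d3: "((\<lambda>y. dsum a (y - ?p) v) has_derivative (\<lambda>h. ddsum a 0 h v)) (at ?p within ?S)" for v
    using has_derivative_dsum[OF rep(1), of ?p ?p] r0 by simp
  have L: "((\<lambda>y. gform (gmat d (psum a (y - ?p))) (dsum a (y - ?p) u) (dsum a (y - ?p) w)) has_derivative
      (\<lambda>h. gform (mderiv d (snd d x) (dsum a 0 h)) (dsum a 0 u) (dsum a 0 w)
      + gform (gmat d (snd d x)) (ddsum a 0 h u) (dsum a 0 w)
      + gform (gmat d (snd d x)) (dsum a 0 u) (ddsum a 0 h w))) (at ?p within ?S)"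
    using has_derivative_gform[OF d2 d3 d3, of u w] rep(2)[OF c(2)] r0 by simp
  have "((\<lambda>y. gform (gmat c y) u w) has_derivative (\<lambda>h. gform (mderiv c ?p h) u w + gform (gmat c ?p) 0 w + gform (gmat c ?p) u 0)) (at ?p within ?S)"
    by (intro has_derivative_gform has_derivative_const has_derivative_subset[OF gmat_has_derivative[OF c]]) (use s t in auto)
  then have R: "((\<lambda>y. gform (gmat c y) u w) has_derivative (\<lambda>h. gform (mderiv c ?p h) u w)) (at ?p within ?S)"
    by (simp add: gform_simps)
  have "((\<lambda>y. gform (gmat c y) u w) has_derivative
      (\<lambda>h. gform (mderiv d (snd d x) (dsum a 0 h)) (dsum a 0 u) (dsum a 0 w)
      + gform (gmat d (snd d x)) (ddsum a 0 h u) (dsum a 0 w)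
      + gform (gmat d (snd d x)) (dsum a 0 u) (ddsum a 0 h w))) (at ?p within ?S)"
  proof (rule has_derivative_transform[OF pS _ L])
    fix y assume "y \<in> ?S"
    then obtain x' where x': "x' \<in> fst c" "y = snd c x'" "snd c x' \<in> ball ?p r" using pt by blast
    note r' = rep(2)[OF x'(1,3)]
    show "gform (gmat c y) u w = gform (gmat d (psum a (y - ?p))) (dsum a (y - ?p) u) (dsum a (y - ?p) w)"
      using metric_change[OF c(1) x'(1) d(1), of u w] r' x'(2) by simp
  qed
  from half_space_derivative_unique[OF S pS this R] show ?thesis by (rule fun_cong)
qed

text \<open>
  Insert \<open>metric_change_deriv\<close> in the three terms of the Koszul formula. By the symmetry of the second
  differential of the coordinate change, all its occurrences cancel except for two equal ones.
\<close>

lemma christoffel_change: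
  assumes c: "c \<in> A" "x \<in> fst c" and d: "d \<in> A" "x \<in> fst d"
    and rep: "converges r a" "\<And>x'. x' \<in> fst c \<Longrightarrow> snd c x' \<in> ball (snd c x) r \<Longrightarrow>
       x' \<in> fst d \<and> snd d x' = psum a (snd c x' - snd c x) \<and>
       transition_deriv c d x' = dsum a (snd c x' - snd c x)"
  shows "chr d (snd d x) (dsum a 0 u) (dsum a 0 w) = dsum a 0 (chr c (snd c x) u w) - ddsum a 0 u w"
proof (rule posdef_eqI[OF gmat_posdef[OF d]])
  fix e'
  let ?G = "gform (gmat d (snd d x))" and ?T = "dsum a 0" and ?S = "ddsum a 0"
  have T: "transition_deriv c d x = ?T" using rep(2)[OF c(2)] converges_radius_pos[OF rep(1)] by simp
  define e where "e = transition_deriv d c x e'"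
  have e': "e' = ?T e" unfolding e_def T[symmetric] using transition_deriv_inverse[OF d c] by simp
  note D = metric_change_deriv[OF c d rep]
  have "2 * ?G (chr d (snd d x) (?T u) (?T w)) (?T e) =
      gform (mderiv d (snd d x) (?T u)) (?T w) (?T e) + gform (mderiv d (snd d x) (?T w)) (?T u) (?T e)
      - gform (mderiv d (snd d x) (?T e)) (?T u) (?T w)" by (rule koszul[OF d])
  also have "\<dots> = (gform (mderiv c (snd c x) u) w e + gform (mderiv c (snd c x) w) u e - gform (mderiv c (snd c x) e) u w)
      - 2 * ?G (?S u w) (?T e)"
    using D[of u w e] D[of w u e] D[of e u w] gform_commute[OF gmat_posdef[OF d], of "?T w" "?S u e"]
      ddsum_commute[of a 0 w u] ddsum_commute[of a 0 u e] ddsum_commute[of a 0 e w] by simp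
  also have "\<dots> = 2 * gform (gmat c (snd c x)) (chr c (snd c x) u w) e - 2 * ?G (?S u w) (?T e)"
    using koszul[OF c, of u w e] by simp
  also have "gform (gmat c (snd c x)) (chr c (snd c x) u w) e = ?G (?T (chr c (snd c x) u w)) (?T e)"
    using metric_change[OF c d] by (simp add: T)
  finally show "?G (chr d (snd d x) (?T u) (?T w)) e' = ?G (?T (chr c (snd c x) u w) - ?S u w) e'"
    unfolding e' by (simp add: gform_simps)
qed

subsection \<open>The inward unit normal\<close>

text \<open>
  The inverse metric applied to the covector \<open>dy\<^sub>n\<close>, divided by its length.
\<close>

definition normal_coords :: "('m, 'n) chart \<Rightarrow> real^'n \<Rightarrow> real^'n" where
  "normal_coords c y = (let q = matrix_inv (gmat c y) *v axis normal_index 1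
     in inverse (sqrt (q $ normal_index)) *\<^sub>R q)"

lemma inv_axis_pos:
  assumes "posdef G"
  shows "0 < (matrix_inv G *v axis k 1) $ k"
proof -
  let ?q = "matrix_inv G *v axis k 1"
  have "G *v ?q = axis k 1"
    by (simp add: matrix_vector_mul_assoc matrix_inv_right[OF posdef_invertible[OF assms]])
  then have "?q \<noteq> 0" by (metis axis_eq_0_iff matrix_vector_mult_0_right zero_neq_one)
  then have "0 < gform G ?q ?q" using assms by (simp add: posdef_def)
  then show ?thesis by (simp add: gform_matrix_inv[OF assms] inner_axis')
qed

lemma normal_coords_props:
  assumes c: "c \<in> A" "x \<in> fst c"
  obtains \<mu> where "0 < \<mu>" "\<And>w. gform (gmat c (snd c x)) (normal_coords c (snd c x)) w = \<mu> * w $ normal_index"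
    "gform (gmat c (snd c x)) (normal_coords c (snd c x)) (normal_coords c (snd c x)) = 1"
    "0 < normal_coords c (snd c x) $ normal_index"
proof -
  let ?G = "gmat c (snd c x)" and ?n = "normal_index :: 'n"
  define q where "q = matrix_inv ?G *v axis ?n 1"
  note pd = gmat_posdef[OF c]
  have qn: "0 < q $ ?n" unfolding q_def by (rule inv_axis_pos[OF pd])
  have N: "normal_coords c (snd c x) = inverse (sqrt (q $ ?n)) *\<^sub>R q" by (simp add: normal_coords_def q_def Let_def)
  have gw: "gform ?G q w = w $ ?n" for w unfolding q_def by (simp add: gform_matrix_inv[OF pd] inner_axis')
  show thesis
  proof (rule that[of "inverse (sqrt (q $ ?n))"])
    show "0 < inverse (sqrt (q $ ?n))" using qn by simp
    show "gform ?G (normal_coords c (snd c x)) w = inverse (sqrt (q $ ?n)) * w $ ?n" for w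
      unfolding N by (simp add: gform_simps gw)
    have "inverse (sqrt (q $ ?n)) * (inverse (sqrt (q $ ?n)) * q $ ?n) = q $ ?n / (sqrt (q $ ?n))\<^sup>2"
      by (simp add: field_simps power2_eq_square)
    also have "\<dots> = 1" using qn by simp
    finally show "gform ?G (normal_coords c (snd c x)) (normal_coords c (snd c x)) = 1"
      unfolding N by (simp add: gform_simps gw)
    show "0 < normal_coords c (snd c x) $ ?n" unfolding N using qn by simp
  qed
qed

lemma boundary_tangent_iff:
  assumes c: "c \<in> A" "x \<in> fst c" and bd: "snd c x $ normal_index = 0" and v: "v \<in> tangent_space A x"
  shows "v \<in> boundary_tangent_space A x \<longleftrightarrow> v c $ normal_index = 0"
proof
  assume vc: "v c $ normal_index = 0"
  have "v d $ normal_index = 0" if d: "d \<in> A" "x \<in> fst d" for d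
    using transition_deriv_normal[OF c d bd] tangent_space_change[OF v c d] vc by (metis mult_zero_right)
  with v show "v \<in> boundary_tangent_space A x" by (simp add: boundary_tangent_space_def)
qed (use c in \<open>auto simp: boundary_tangent_space_def\<close>)

text \<open>
  A vector orthogonal to the boundary represents a multiple of \<open>dy\<^sub>n\<close>; the unit length fixes the
  multiple up to sign and the inward direction fixes the sign. Positivity of the normal component in
  all other charts is \<open>transition_deriv_normal\<close>.
\<close>

lemma inward_normal_eq:
  assumes c: "c \<in> A" "x \<in> fst c" and bd: "snd c x $ normal_index = 0"
  shows "inward_normal A g x = coord_vector A x c (normal_coords c (snd c x))"
proof -
  let ?n = "normal_index :: 'n" and ?G = "gmat c (snd c x)" and ?N = "normal_coords c (snd c x)"
  obtain \<mu> where \<mu>: "0 < \<mu>" "\<And>w. gform ?G ?N w = \<mu> * w $ ?n" "gform ?G ?N ?N = 1" "0 < ?N $ ?n"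
    using normal_coords_props[OF c] by metis
  note cv = coord_vector_in_tangent_space[OF c]
  show ?thesis unfolding inward_normal_def
  proof (rule the_equality, intro conjI ballI impI)
    show "coord_vector A x c ?N \<in> tangent_space A x" by (rule cv)
    show "g x (coord_vector A x c ?N) (coord_vector A x c ?N) = 1"
      using metric_in_coords[OF c cv cv] \<mu>(3) c by simp
    show "g x (coord_vector A x c ?N) w = 0" if w: "w \<in> boundary_tangent_space A x" for w
    proof -
      have wt: "w \<in> tangent_space A x" using w by (simp add: boundary_tangent_space_def)
      then have "w c $ ?n = 0" using w boundary_tangent_iff[OF c bd] by blast
      then show ?thesis using metric_in_coords[OF c cv wt] \<mu>(2) c by simp
    qed
    fix d assume d: "d \<in> A" "x \<in> fst d"
    obtain a where "0 < a" "\<And>u. transition_deriv c d x u $ ?n = a * u $ ?n"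
      using transition_deriv_normal[OF c d bd] by metis
    then show "0 < coord_vector A x c ?N d $ ?n" using \<mu>(4) d by (simp add: coord_vector_apply)
  next
    fix v assume v: "v \<in> tangent_space A x \<and> g x v v = 1 \<and> (\<forall>w\<in>boundary_tangent_space A x. g x v w = 0) \<and>
         (\<forall>c\<in>A. x \<in> fst c \<longrightarrow> 0 < v c $ ?n)"
    then have vt: "v \<in> tangent_space A x" by blast
    have z: "gform ?G (v c) w = 0" if "w $ ?n = 0" for w
    proof -
      have "coord_vector A x c w \<in> boundary_tangent_space A x"
        using boundary_tangent_iff[OF c bd cv, of w] that c by simp
      then have "g x v (coord_vector A x c w) = 0" using v by blast
      then show ?thesis using metric_in_coords[OF c vt cv] c by simp
    qed
    \<comment> \<open>The factor by which the covector of \<open>v\<close> differs from that of the normal.\<close>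
    define s where "s = gform ?G (v c) (axis ?n 1) / \<mu>"
    have "v c = s *\<^sub>R ?N"
    proof (rule posdef_eqI[OF gmat_posdef[OF c]])
      fix w
      have "gform ?G (v c) (w - (w $ ?n) *\<^sub>R axis ?n 1) = 0" by (rule z) (simp add: axis_def)
      then show "gform ?G (v c) w = gform ?G (s *\<^sub>R ?N) w"
        using \<mu>(1) by (simp add: gform_simps \<mu>(2) s_def)
    qed
    moreover have "s = 1"
    proof -
      have "0 < s * ?N $ ?n" using v c \<open>v c = s *\<^sub>R ?N\<close> by (metis vector_scaleR_component real_scaleR_def)
      then have "0 < s" using \<mu>(4) by (simp add: zero_less_mult_iff)
      moreover have "s * s = 1"
        using v metric_in_coords[OF c vt vt] \<open>v c = s *\<^sub>R ?N\<close> \<mu>(3) by (simp add: gform_simps)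
      ultimately show ?thesis by (metis abs_of_pos mult_1 power2_eq_square power2_eq_1_iff neg_less_0_iff_less less_asym zero_less_one)
    qed
    ultimately have "v c = ?N" by simp
    then show "v = coord_vector A x c ?N" using coord_vector_of_tangent[OF vt c] by simp
  qed
qed

text \<open>
  The metric matrix is given by a power series on a full ball around the point, although it is only
  defined on a half-ball, and Cramer's rule extends the normal with it.
\<close>

lemma normal_coords_extension:
  assumes c: "c \<in> A" "x \<in> fst c"
  obtains N' DN r where "0 < r" "(N' has_derivative DN) (at (snd c x))"
    "half_space \<inter> ball (snd c x) r \<subseteq> chart_image c"
    "\<And>y. y \<in> half_space \<inter> ball (snd c x) r \<Longrightarrow> normal_coords c y = N' y"
proof -
  let ?p = "snd c x" and ?n = "normal_index :: 'n"
  obtain r b where r: "converges r b" "half_space \<inter> ball ?p r \<subseteq> chart_image c"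
    "\<And>y. y \<in> half_space \<inter> ball ?p r \<Longrightarrow> gmat c y = psum b (y - ?p)"
    by (rule metric_series[OF c]) blast
  have r0: "0 < r" by (rule converges_radius_pos[OF r(1)])
  have ph: "?p \<in> half_space \<inter> ball ?p r" using chart_in_half_space[OF c] r0 by simp
  define B where "B = (\<lambda>y. psum b (y - ?p))"
  \<comment> \<open>The column of the inverse metric by Cramer's rule, meaningful for the extended metric \<open>B\<close> too.\<close>
  define q where "q = (\<lambda>y. \<chi> k. det (\<chi> i j. if j = k then axis ?n 1 $ i else B y $ i $ j) / det (B y))"
  define N' where "N' = (\<lambda>y. inverse (sqrt (q y $ ?n)) *\<^sub>R q y)"
  have qeq: "q y = matrix_inv (gmat c y) *v axis ?n 1" and pdy: "posdef (gmat c y)" and By: "B y = gmat c y"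
    if y: "y \<in> half_space \<inter> ball ?p r" for y
  proof -
    obtain x' where x': "x' \<in> fst c" "y = snd c x'" using y r(2) by blast
    show pd: "posdef (gmat c y)" unfolding x'(2) by (rule gmat_posdef[OF c(1) x'(1)])
    show e: "B y = gmat c y" using r(3)[OF y] by (simp add: B_def)
    show "q y = matrix_inv (gmat c y) *v axis ?n 1"
      unfolding q_def e by (simp add: vec_eq_iff matrix_inv_cramer[OF posdef_invertible[OF pd]])
  qed
  have detp: "det (B ?p) \<noteq> 0"
    using posdef_invertible[OF pdy[OF ph]] unfolding By[OF ph] by (simp add: invertible_det_nz)
  have Bd: "(\<lambda>y. B y $ i $ j) differentiable (at ?p)" for i j
  proof -
    have "(B has_derivative dsum b (?p - ?p)) (at ?p)" unfolding B_def
      by (rule has_derivative_psum'[OF r(1)]) (use r0 in simp)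
    then have "((\<lambda>y. B y $ i $ j) has_derivative (\<lambda>h. dsum b (?p - ?p) h $ i $ j)) (at ?p)"
      by (intro bounded_linear.has_derivative[OF bounded_linear_vec_nth])
    then show ?thesis by (auto simp: differentiable_def)
  qed
  have "(\<lambda>y. det (\<chi> i j. if j = k then axis ?n 1 $ i else B y $ i $ j)) differentiable (at ?p)" for k
  proof (rule differentiable_det)
    show "(\<lambda>y. (\<chi> i j. if j = k then axis ?n 1 $ i else B y $ i $ j) $ i $ j) differentiable (at ?p)" for i j
      by (cases "j = k") (simp_all add: Bd)
  qed
  moreover have "(\<lambda>y. det (B y)) differentiable (at ?p)"
    by (rule differentiable_det) (rule Bd)
  ultimately have qd: "q differentiable (at ?p)"
    unfolding q_def by (intro differentiable_vec_lambda differentiable_divide detp)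
  have qn: "0 < q ?p $ ?n" unfolding qeq[OF ph] by (rule inv_axis_pos[OF pdy[OF ph]])
  obtain Dq where Dq: "(q has_derivative Dq) (at ?p)" using qd by (auto simp: differentiable_def)
  have Dqn: "((\<lambda>y. q y $ ?n) has_derivative (\<lambda>h. Dq h $ ?n)) (at ?p)"
    by (rule bounded_linear.has_derivative[OF bounded_linear_vec_nth Dq])
  have "\<exists>D. ((\<lambda>y. inverse (sqrt (q y $ ?n))) has_derivative D) (at ?p)"
    by (rule exI, rule Deriv.has_derivative_inverse[OF _ has_derivative_real_sqrt[OF qn Dqn]]) (use qn in simp)
  then obtain Ds where "((\<lambda>y. inverse (sqrt (q y $ ?n))) has_derivative Ds) (at ?p)" by blast
  from has_derivative_scaleR[OF this Dq] obtain DN where DN: "(N' has_derivative DN) (at ?p)"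
    unfolding N'_def by blast
  show thesis
  proof (rule that[OF r0 DN r(2)])
    fix y assume "y \<in> half_space \<inter> ball ?p r"
    then show "normal_coords c y = N' y" by (simp add: normal_coords_def N'_def qeq Let_def)
  qed
qed

lemma normal_line:
  assumes c: "c \<in> A" "x \<in> fst c" and bd: "snd c x $ normal_index = 0" and u: "u $ normal_index = 0"
    and r: "0 < r" "(N' has_derivative DN) (at (snd c x))" "half_space \<inter> ball (snd c x) r \<subseteq> chart_image c"
      "\<And>y. y \<in> half_space \<inter> ball (snd c x) r \<Longrightarrow> normal_coords c y = N' y"
  shows "((\<lambda>t. inward_normal A g (chart_inv c (snd c x + t *\<^sub>R u)) c) has_vector_derivative DN u) (at 0)"
proof -
  let ?p = "snd c x"
  have 1: "((\<lambda>t. N' (?p + t *\<^sub>R u)) has_vector_derivative DN u) (at 0)"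
    by (rule has_vector_derivative_line[OF r(2)])
  have e: "eventually (\<lambda>t. ?p + t *\<^sub>R u \<in> ball ?p r) (nhds 0)"
    by (rule line_eventually_in_ball[OF r(1)])
  have "eventually (\<lambda>t. N' (?p + t *\<^sub>R u) = inward_normal A g (chart_inv c (?p + t *\<^sub>R u)) c) (nhds 0)"
    using e
  proof eventually_elim
    case (elim t)
    have y: "?p + t *\<^sub>R u \<in> half_space \<inter> ball ?p r" using elim bd u by (simp add: half_space_def)
    then have yc: "?p + t *\<^sub>R u \<in> chart_image c" using r(3) by blast
    let ?x = "chart_inv c (?p + t *\<^sub>R u)"
    have sx: "snd c ?x = ?p + t *\<^sub>R u" "?x \<in> fst c" using chart_inv_right[OF yc] chart_inv_in[OF yc] by auto
    have "inward_normal A g ?x = coord_vector A ?x c (normal_coords c (snd c ?x))"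
      by (rule inward_normal_eq[OF c(1) sx(2)]) (simp add: sx bd u)
    then have "inward_normal A g ?x c = normal_coords c (snd c ?x)" using coord_vector_self[OF c(1) sx(2)] by simp
    then show ?case using r(4)[OF y] sx(1) by simp
  qed
  then show ?thesis by (rule has_vector_derivative_transform_nhds[OF 1])
qed

subsection \<open>Convexity of the boundary in coordinates\<close>

text \<open>
  The components of the covariant derivative of the normal field are defined chart by chart. That they
  form a tangent vector is seen by differentiating \<open>N\<^sub>d = T N\<^sub>c\<close> along the boundary line with direction
  \<open>v\<close>, where \<open>T\<close> is the differential of the coordinate change: the second differential that arises
  cancels the one in \<open>christoffel_change\<close>.
\<close>

lemma normal_cov_deriv_coords:
  assumes c: "c \<in> A" "x \<in> fst c" and bd: "snd c x $ normal_index = 0"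
    and v: "v \<in> boundary_tangent_space A x"
    and N: "0 < s" "(N' has_derivative DN) (at (snd c x))" "half_space \<inter> ball (snd c x) s \<subseteq> chart_image c"
      "\<And>y. y \<in> half_space \<inter> ball (snd c x) s \<Longrightarrow> normal_coords c y = N' y"
  shows "normal_cov_deriv A g x v =
    coord_vector A x c (DN (v c) + chr c (snd c x) (v c) (normal_coords c (snd c x)))"
proof
  fix d
  let ?p = "snd c x" and ?n = "normal_index :: 'n"
  let ?N = "normal_coords c ?p"
  have vt: "v \<in> tangent_space A x" using v by (simp add: boundary_tangent_space_def)
  have vc: "v c $ ?n = 0" using v boundary_tangent_iff[OF c bd vt] by simp
  have ph: "?p \<in> half_space" by (rule chart_in_half_space[OF c])
  show "normal_cov_deriv A g x v d = coord_vector A x c (DN (v c) + chr c ?p (v c) ?N) d"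
  proof (cases "d \<in> A \<and> x \<in> fst d")
    case False then show ?thesis by (auto simp: normal_cov_deriv_def coord_vector_def)
  next
    case True
    then have d: "d \<in> A" "x \<in> fst d" by auto
    have bdd: "snd d x $ ?n = 0" by (rule boundary_chart_independent[OF c d bd])
    have vd: "v d $ ?n = 0" using v d by (simp add: boundary_tangent_space_def)
    obtain r a where r: "converges r a" and rx: "\<And>x'. x' \<in> fst c \<Longrightarrow> snd c x' \<in> ball ?p r \<Longrightarrow>
       x' \<in> fst d \<and> snd d x' = psum a (snd c x' - ?p) \<and> transition_deriv c d x' = dsum a (snd c x' - ?p)"
      by (rule coord_change_series[OF c(1) d(1) c(2) d(2)]) blast
    have r0: "0 < r" by (rule converges_radius_pos[OF r])
    have rx0: "snd d x = psum a 0" "transition_deriv c d x = dsum a 0" using rx[OF c(2)] r0 by auto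
    obtain Nd DNd sd where Nd: "0 < sd" "(Nd has_derivative DNd) (at (snd d x))"
      "half_space \<inter> ball (snd d x) sd \<subseteq> chart_image d"
      "\<And>y. y \<in> half_space \<inter> ball (snd d x) sd \<Longrightarrow> normal_coords d y = Nd y"
      by (rule normal_coords_extension[OF d]) blast
    have vdc: "v d = dsum a 0 (v c)" using tangent_space_change[OF vt c d] rx0 by simp
    have pd: "((\<lambda>y. psum a (y - ?p)) has_derivative dsum a 0) (at ?p)"
      using has_derivative_psum'[OF r, of ?p ?p] r0 by simp
    have F: "((\<lambda>y. Nd (psum a (y - ?p))) has_derivative (\<lambda>h. DNd (dsum a 0 h))) (at ?p)"
      using diff_chain_at[OF pd, of Nd DNd] Nd(2) rx0 by (simp add: o_def)
    have H: "((\<lambda>y. dsum a (y - ?p) (N' y)) has_derivative (\<lambda>h. ddsum a 0 h (N' ?p) + dsum a 0 (DN h))) (at ?p)"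
      using has_derivative_dsum_arg[OF r _ N(2), of ?p] r0 by simp
    have "isCont (\<lambda>y. psum a (y - ?p)) ?p" using pd has_derivative_continuous by blast
    then have "((\<lambda>y. psum a (y - ?p)) \<longlongrightarrow> psum a (?p - ?p)) (nhds ?p)"
      unfolding isCont_def by (subst (asm) tendsto_at_iff_tendsto_nhds)
    from topological_tendstoD[OF this open_ball, of "snd d x" sd]
    have "eventually (\<lambda>y. psum a (y - ?p) \<in> ball (snd d x) sd) (nhds ?p)"
      using Nd(1) rx0 by simp
    then obtain W where W: "open W" "?p \<in> W" "\<And>y. y \<in> W \<Longrightarrow> psum a (y - ?p) \<in> ball (snd d x) sd"
      unfolding eventually_nhds by blast
    then obtain \<rho> where \<rho>: "0 < \<rho>" "ball ?p \<rho> \<subseteq> W" by (meson openE)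
    have ev: "eventually (\<lambda>t. Nd (psum a (?p + t *\<^sub>R v c - ?p)) = dsum a (?p + t *\<^sub>R v c - ?p) (N' (?p + t *\<^sub>R v c))) (nhds 0)"
      using line_eventually_in_ball[OF r0, of ?p "v c"] line_eventually_in_ball[OF N(1), of ?p "v c"]
        line_eventually_in_ball[OF \<rho>(1), of ?p "v c"]
    proof eventually_elim
      case (elim t)
      let ?y = "?p + t *\<^sub>R v c"
      have yh: "?y \<in> half_space" using ph vc by (simp add: half_space_def)
      then have yc: "?y \<in> chart_image c" using N(3) elim by blast
      define x' where "x' = chart_inv c ?y"
      have x': "x' \<in> fst c" "snd c x' = ?y" using chart_inv_in[OF yc] chart_inv_right[OF yc] by (auto simp: x'_def)
      have dx': "x' \<in> fst d" "snd d x' = psum a (?y - ?p)" "transition_deriv c d x' = dsum a (?y - ?p)"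
        using rx[OF x'(1)] x'(2) elim by auto
      have bx: "snd c x' $ ?n = 0" using x' bd vc by simp
      have bdx: "snd d x' $ ?n = 0" by (rule boundary_chart_independent[OF c(1) x'(1) d(1) dx'(1) bx])
      have "coord_vector A x' c (normal_coords c (snd c x')) d = coord_vector A x' d (normal_coords d (snd d x')) d"
        using inward_normal_eq[OF c(1) x'(1) bx] inward_normal_eq[OF d(1) dx'(1) bdx] by simp
      then have "transition_deriv c d x' (normal_coords c (snd c x')) = normal_coords d (snd d x')"
        using d(1) dx'(1) by (simp add: coord_vector_apply transition_deriv_self)
      moreover have "normal_coords c (snd c x') = N' ?y" unfolding x'(2) using N(4) yh elim by blast
      moreover have "normal_coords d (snd d x') = Nd (psum a (?y - ?p))"
        unfolding dx'(2)[symmetric]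
        by (rule Nd(4)) (use chart_in_half_space[OF d(1) dx'(1)] W(3)[of ?y] \<rho>(2) elim dx'(2) in auto)
      ultimately show ?case using dx'(3) by simp
    qed
    have rel: "DNd (v d) = ddsum a 0 (v c) (N' ?p) + dsum a 0 (DN (v c))"
      unfolding vdc by (rule line_derivatives_eq[OF F H ev])
    have Np: "N' ?p = ?N" using N(4)[of ?p] N(1) ph by simp
    have nd: "inward_normal A g x d = dsum a 0 ?N"
      using inward_normal_eq[OF c bd] d rx0 by (simp add: coord_vector_apply)
    have "vector_derivative (\<lambda>t. inward_normal A g (chart_inv d (snd d x + t *\<^sub>R v d)) d) (at 0) = DNd (v d)"
      by (rule vector_derivative_at[OF normal_line[OF d bdd vd Nd]])
    then have "normal_cov_deriv A g x v d = DNd (v d) + chr d (snd d x) (v d) (inward_normal A g x d)"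
      using True by (simp add: normal_cov_deriv_def)
    also have "chr d (snd d x) (v d) (inward_normal A g x d) = dsum a 0 (chr c ?p (v c) ?N) - ddsum a 0 (v c) ?N"
      unfolding nd vdc by (rule christoffel_change[OF c d r rx])
    also have "DNd (v d) + (dsum a 0 (chr c ?p (v c) ?N) - ddsum a 0 (v c) ?N) = dsum a 0 (DN (v c) + chr c ?p (v c) ?N)"
      unfolding rel Np by (simp add: linear_add[OF linear_dsum])
    also have "\<dots> = coord_vector A x c (DN (v c) + chr c ?p (v c) ?N) d"
      using d rx0 by (simp add: coord_vector_apply)
    finally show ?thesis .
  qed
qed

text \<open>
  Differentiating \<open>g(\<nu>, v) = 0\<close> along the boundary line with direction \<open>v\<close> and using the Koszul formula
  gives \<open>- g(\<nabla>\<^sub>v \<nu>, v) = g(\<nu>, \<Gamma>(v, v))\<close>.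
\<close>

lemma second_fundamental_form_coords:
  assumes c: "c \<in> A" "x \<in> fst c" and bd: "snd c x $ normal_index = 0"
    and v: "v \<in> boundary_tangent_space A x"
  shows "second_fundamental_form A g x v v =
    gform (gmat c (snd c x)) (normal_coords c (snd c x)) (chr c (snd c x) (v c) (v c))"
proof -
  let ?p = "snd c x" and ?n = "normal_index :: 'n"
  let ?G = "gmat c ?p" and ?N = "normal_coords c ?p"
  have vt: "v \<in> tangent_space A x" using v by (simp add: boundary_tangent_space_def)
  have vc: "v c $ ?n = 0" using v boundary_tangent_iff[OF c bd vt] by simp
  have ph: "?p \<in> half_space" by (rule chart_in_half_space[OF c])
  obtain N' DN s where N: "0 < s" "(N' has_derivative DN) (at ?p)" "half_space \<inter> ball ?p s \<subseteq> chart_image c"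
      "\<And>y. y \<in> half_space \<inter> ball ?p s \<Longrightarrow> normal_coords c y = N' y"
    by (rule normal_coords_extension[OF c]) blast
  obtain r b where r: "converges r b" "half_space \<inter> ball ?p r \<subseteq> chart_image c"
    "\<And>y. y \<in> half_space \<inter> ball ?p r \<Longrightarrow> gmat c y = psum b (y - ?p)"
    "\<And>y. y \<in> half_space \<inter> ball ?p r \<Longrightarrow> mderiv c y = dsum b (y - ?p)"
    by (rule metric_series[OF c]) blast
  have r0: "0 < r" by (rule converges_radius_pos[OF r(1)])
  have Np: "N' ?p = ?N" using N(4)[of ?p] N(1) ph by simp
  have Gp: "psum b 0 = ?G" "dsum b 0 = mderiv c ?p" using r(3,4)[of ?p] r0 ph by auto
  have "((\<lambda>y. psum b (y - ?p)) has_derivative mderiv c ?p) (at ?p)"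
    using has_derivative_psum'[OF r(1), of ?p ?p] r0 Gp by simp
  from has_derivative_gform[OF this N(2) has_derivative_const[of "v c"]]
  have D: "((\<lambda>y. gform (psum b (y - ?p)) (N' y) (v c)) has_derivative
      (\<lambda>h. gform (mderiv c ?p h) ?N (v c) + gform ?G (DN h) (v c))) (at ?p)"
    by (simp add: Gp Np gform_simps)
  have ev: "eventually (\<lambda>t. gform (psum b (?p + t *\<^sub>R v c - ?p)) (N' (?p + t *\<^sub>R v c)) (v c) = 0) (nhds 0)"
    using line_eventually_in_ball[OF r0, of ?p "v c"] line_eventually_in_ball[OF N(1), of ?p "v c"]
  proof eventually_elim
    case (elim t)
    let ?y = "?p + t *\<^sub>R v c"
    have yh: "?y \<in> half_space" using ph vc by (simp add: half_space_def)
    then have yc: "?y \<in> chart_image c" using N(3) elim by blast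
    then obtain x' where x': "x' \<in> fst c" "snd c x' = ?y" by auto
    have "gform (gmat c (snd c x')) (normal_coords c (snd c x')) (v c) = 0"
      using normal_coords_props[OF c(1) x'(1)] vc by (metis mult_zero_right)
    then show ?case unfolding x'(2) using r(3)[of ?y] N(4)[of ?y] yh elim by auto
  qed
  have E: "gform (mderiv c ?p (v c)) ?N (v c) + gform ?G (DN (v c)) (v c) = 0"
    by (rule line_derivatives_eq[OF D has_derivative_const ev])
  let ?X = "DN (v c) + chr c ?p (v c) ?N"
  have nc: "normal_cov_deriv A g x v = coord_vector A x c ?X" by (rule normal_cov_deriv_coords[OF c bd v N])
  have "second_fundamental_form A g x v v = - gform ?G ?X (v c)"
    unfolding second_fundamental_form_def nc
    using metric_in_coords[OF c coord_vector_in_tangent_space[OF c] vt] c by simp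
  also have "\<dots> = gform (mderiv c ?p (v c)) ?N (v c) - gform ?G (chr c ?p (v c) ?N) (v c)"
    using E by (simp add: gform_simps)
  also have "\<dots> = gform ?G (chr c ?p (v c) (v c)) ?N"
    using koszul[OF c, of "v c" ?N "v c"] koszul[OF c, of "v c" "v c" ?N]
      gform_commute_mderiv[OF c, of "v c" "v c" ?N] by simp
  finally show ?thesis using gform_commute[OF gmat_posdef[OF c]] by simp
qed

text \<open>
  Since \<open>g(\<nu>, \<cdot>)\<close> is a positive multiple of \<open>dy\<^sub>n\<close>, strict convexity is positivity of the normal
  component of \<open>\<Gamma>(v, v)\<close>; so a geodesic with this velocity has an acceleration that points out of
  the half-space.
\<close>

lemma strictly_convex_coords:
  assumes c: "c \<in> A" "x \<in> fst c" and sc: "strictly_convex_boundary_at M A g x"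
    and v: "v \<in> tangent_space A x" "v c $ normal_index = 0" "v \<noteq> (\<lambda>_. 0)"
  shows "0 < chr c (snd c x) (v c) (v c) $ normal_index"
proof -
  have bd: "snd c x $ normal_index = 0" using sc mfd_boundary_iff[OF c] by (simp add: strictly_convex_boundary_at_def)
  have vb: "v \<in> boundary_tangent_space A x" using boundary_tangent_iff[OF c bd v(1)] v(2) by simp
  then have "0 < second_fundamental_form A g x v v" using sc v(3) by (simp add: strictly_convex_boundary_at_def)
  moreover obtain \<mu> where "0 < \<mu>" "\<And>w. gform (gmat c (snd c x)) (normal_coords c (snd c x)) w = \<mu> * w $ normal_index"
    using normal_coords_props[OF c] by metis
  ultimately show ?thesis
    unfolding second_fundamental_form_coords[OF c bd vb] by (simp add: zero_less_mult_iff)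
qed

end

section \<open>Local Lipschitz continuity of the connection\<close>

text \<open>
  This property at a single point is preserved by all operations that build the Christoffel symbols
  from the metric and its derivatives.
\<close>

definition loclip :: "('a::real_normed_vector \<Rightarrow> real) \<Rightarrow> 'a \<Rightarrow> bool" where
  "loclip f p \<longleftrightarrow> (\<exists>r>0. \<exists>L\<ge>0. \<forall>x\<in>ball p r. \<forall>y\<in>ball p r. \<bar>f x - f y\<bar> \<le> L * norm (x - y))"

lemma loclipI:
  assumes "0 < r" "0 \<le> L" "\<And>x y. x \<in> ball p r \<Longrightarrow> y \<in> ball p r \<Longrightarrow> \<bar>f x - f y\<bar> \<le> L * norm (x - y)"
  shows "loclip f p"
  unfolding loclip_def using assms by blast

lemma loclipE:
  assumes "loclip f p"
  obtains r L where "0 < r" "0 \<le> L" "\<And>x y. x \<in> ball p r \<Longrightarrow> y \<in> ball p r \<Longrightarrow> \<bar>f x - f y\<bar> \<le> L * norm (x - y)"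
  using assms unfolding loclip_def by blast

lemma loclip_const: "loclip (\<lambda>_. k) p"
  unfolding loclip_def by (rule exI[of _ 1]) auto

lemma loclip_add:
  assumes "loclip f p" "loclip h p" shows "loclip (\<lambda>x. f x + h x) p"
proof -
  obtain r L where r: "0 < r" "0 \<le> L" "\<And>x y. x \<in> ball p r \<Longrightarrow> y \<in> ball p r \<Longrightarrow> \<bar>f x - f y\<bar> \<le> L * norm (x - y)"
    using assms(1) by (rule loclipE) blast
  obtain s K where s: "0 < s" "0 \<le> K" "\<And>x y. x \<in> ball p s \<Longrightarrow> y \<in> ball p s \<Longrightarrow> \<bar>h x - h y\<bar> \<le> K * norm (x - y)"
    using assms(2) by (rule loclipE) blast
  show ?thesis
  proof (rule loclipI[of "min r s" "L + K"])
    fix x y assume "x \<in> ball p (min r s)" "y \<in> ball p (min r s)"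
    then have "\<bar>f x - f y\<bar> \<le> L * norm (x - y)" "\<bar>h x - h y\<bar> \<le> K * norm (x - y)" using r(3) s(3) by auto
    then show "\<bar>f x + h x - (f y + h y)\<bar> \<le> (L + K) * norm (x - y)" by (simp add: distrib_right)
  qed (use r s in auto)
qed

lemma loclip_bounded:
  assumes "loclip f p"
  obtains r B where "0 < r" "0 \<le> B" "\<And>x. x \<in> ball p r \<Longrightarrow> \<bar>f x\<bar> \<le> B"
proof -
  obtain r L where r: "0 < r" "0 \<le> L" "\<And>x y. x \<in> ball p r \<Longrightarrow> y \<in> ball p r \<Longrightarrow> \<bar>f x - f y\<bar> \<le> L * norm (x - y)"
    using assms by (rule loclipE) blast
  show thesis
  proof (rule that[of r "\<bar>f p\<bar> + L * r"])
    fix x assume x: "x \<in> ball p r"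
    have "\<bar>f x - f p\<bar> \<le> L * norm (x - p)" using r x by simp
    also have "\<dots> \<le> L * r" using x r(2) by (intro mult_left_mono) (auto simp: dist_norm norm_minus_commute)
    finally show "\<bar>f x\<bar> \<le> \<bar>f p\<bar> + L * r" by linarith
  qed (use r in auto)
qed

lemma loclip_mult:
  assumes "loclip f p" "loclip h p" shows "loclip (\<lambda>x. f x * h x) p"
proof -
  obtain r L where r: "0 < r" "0 \<le> L" "\<And>x y. x \<in> ball p r \<Longrightarrow> y \<in> ball p r \<Longrightarrow> \<bar>f x - f y\<bar> \<le> L * norm (x - y)"
    using assms(1) by (rule loclipE) blast
  obtain s K where s: "0 < s" "0 \<le> K" "\<And>x y. x \<in> ball p s \<Longrightarrow> y \<in> ball p s \<Longrightarrow> \<bar>h x - h y\<bar> \<le> K * norm (x - y)"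
    using assms(2) by (rule loclipE) blast
  obtain r' B where B: "0 < r'" "0 \<le> B" "\<And>x. x \<in> ball p r' \<Longrightarrow> \<bar>f x\<bar> \<le> B"
    using assms(1) by (rule loclip_bounded) blast
  obtain s' C where C: "0 < s'" "0 \<le> C" "\<And>x. x \<in> ball p s' \<Longrightarrow> \<bar>h x\<bar> \<le> C"
    using assms(2) by (rule loclip_bounded) blast
  define \<rho> where "\<rho> = min (min r s) (min r' s')"
  show ?thesis
  proof (rule loclipI[of \<rho> "L * C + B * K"])
    fix x y assume "x \<in> ball p \<rho>" "y \<in> ball p \<rho>"
    then have *: "\<bar>f x - f y\<bar> \<le> L * norm (x - y)" "\<bar>h x - h y\<bar> \<le> K * norm (x - y)" "\<bar>f y\<bar> \<le> B" "\<bar>h x\<bar> \<le> C"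
      using r(3) s(3) B(3) C(3) by (auto simp: \<rho>_def)
    have "f x * h x - f y * h y = (f x - f y) * h x + f y * (h x - h y)" by (simp add: algebra_simps)
    then have "\<bar>f x * h x - f y * h y\<bar> \<le> \<bar>f x - f y\<bar> * \<bar>h x\<bar> + \<bar>f y\<bar> * \<bar>h x - h y\<bar>"
      by (metis abs_mult abs_triangle_ineq)
    also have "\<dots> \<le> (L * norm (x - y)) * C + B * (K * norm (x - y))"
      using * r s B C by (intro add_mono mult_mono) auto
    finally show "\<bar>f x * h x - f y * h y\<bar> \<le> (L * C + B * K) * norm (x - y)" by (simp add: algebra_simps)
  qed (use r s B C in \<open>auto simp: \<rho>_def\<close>)
qed

lemma loclip_inverse:
  assumes "loclip f p" "f p \<noteq> 0" shows "loclip (\<lambda>x. inverse (f x)) p"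
proof -
  obtain r L where r: "0 < r" "0 \<le> L" "\<And>x y. x \<in> ball p r \<Longrightarrow> y \<in> ball p r \<Longrightarrow> \<bar>f x - f y\<bar> \<le> L * norm (x - y)"
    using assms(1) by (rule loclipE) blast
  define a where "a = \<bar>f p\<bar> / 2"
  have a: "a > 0" using assms(2) by (simp add: a_def)
  define \<rho> where "\<rho> = min r (a / (L + 1))"
  have \<rho>: "0 < \<rho>" "\<rho> \<le> r" using r a by (auto simp: \<rho>_def)
  have big: "a \<le> \<bar>f x\<bar>" if x: "x \<in> ball p \<rho>" for x
  proof -
    have "\<bar>f x - f p\<bar> \<le> L * norm (x - p)" using r x \<rho> by auto
    also have "\<dots> \<le> (L + 1) * (a / (L + 1))"
      using x r(2) a by (intro mult_mono) (auto simp: dist_norm norm_minus_commute \<rho>_def)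
    also have "\<dots> = a" using r(2) by simp
    finally have "\<bar>f x - f p\<bar> \<le> a" .
    then show ?thesis unfolding a_def by linarith
  qed
  show ?thesis
  proof (rule loclipI[of \<rho> "L / (a * a)"])
    fix x y assume xy: "x \<in> ball p \<rho>" "y \<in> ball p \<rho>"
    note bx = big[OF xy(1)] and by' = big[OF xy(2)]
    have "inverse (f x) - inverse (f y) = (f y - f x) / (f x * f y)"
      using bx by' a by (simp add: field_simps)
    then have "\<bar>inverse (f x) - inverse (f y)\<bar> = \<bar>f x - f y\<bar> / (\<bar>f x\<bar> * \<bar>f y\<bar>)"
      by (simp add: abs_mult abs_minus_commute)
    also have "\<dots> \<le> (L * norm (x - y)) / (a * a)"
      using r(3)[of x y] xy \<rho> bx by' a by (intro frac_le mult_mono mult_pos_pos) auto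
    finally show "\<bar>inverse (f x) - inverse (f y)\<bar> \<le> L / (a * a) * norm (x - y)" by simp
  qed (use \<rho> r a in auto)
qed

lemma loclip_sum: "(\<And>i. i \<in> I \<Longrightarrow> loclip (f i) p) \<Longrightarrow> loclip (\<lambda>x. \<Sum>i\<in>I. f i x) p"
proof (induction I rule: infinite_finite_induct)
  case (insert i I)
  have "loclip (\<lambda>x. f i x + (\<Sum>i\<in>I. f i x)) p" by (rule loclip_add) (use insert in auto)
  then show ?case using insert.hyps by simp
qed (simp_all add: loclip_const)

lemma loclip_prod: "(\<And>i. i \<in> I \<Longrightarrow> loclip (f i) p) \<Longrightarrow> loclip (\<lambda>x. \<Prod>i\<in>I. f i x) p"
proof (induction I rule: infinite_finite_induct)
  case (insert i I)
  have "loclip (\<lambda>x. f i x * (\<Prod>i\<in>I. f i x)) p" by (rule loclip_mult) (use insert in auto)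
  then show ?case using insert.hyps by simp
qed (simp_all add: loclip_const)

lemma loclip_diff: "loclip f p \<Longrightarrow> loclip h p \<Longrightarrow> loclip (\<lambda>x. f x - h x) p"
proof -
  assume "loclip f p" "loclip h p"
  then have "loclip (\<lambda>x. f x + (-1) * h x) p" by (rule loclip_add[OF _ loclip_mult[OF loclip_const]])
  then show ?thesis by simp
qed

lemma loclip_linear:
  assumes "bounded_linear f" shows "loclip f p"
proof -
  interpret bounded_linear f by fact
  obtain K where "0 \<le> K" "\<And>x. norm (f x) \<le> norm x * K" using nonneg_bounded by blast
  then show ?thesis
    by (intro loclipI[of 1 K]) (auto simp: diff[symmetric] mult.commute)
qed

lemma loclip_compose_linear:
  assumes f: "loclip f (l p)" and l: "bounded_linear l" shows "loclip (\<lambda>x. f (l x)) p"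
proof -
  interpret l: bounded_linear l by fact
  obtain r L where r: "0 < r" "0 \<le> L" "\<And>x y. x \<in> ball (l p) r \<Longrightarrow> y \<in> ball (l p) r \<Longrightarrow> \<bar>f x - f y\<bar> \<le> L * norm (x - y)"
    using f by (rule loclipE) blast
  obtain K where K: "0 < K" "\<And>x. norm (l x) \<le> norm x * K" using l.pos_bounded by blast
  have lb: "l x \<in> ball (l p) r" if "x \<in> ball p (r / K)" for x
  proof -
    have "dist (l p) (l x) \<le> norm (p - x) * K" unfolding dist_norm l.diff[symmetric] by (rule K(2))
    also have "\<dots> < r / K * K" using that K(1) by (intro mult_strict_right_mono) (auto simp: dist_norm)
    finally show ?thesis using K(1) by simp
  qed
  show ?thesis
  proof (rule loclipI[of "r / K" "L * K"])
    fix x y assume "x \<in> ball p (r / K)" "y \<in> ball p (r / K)"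
    then have "\<bar>f (l x) - f (l y)\<bar> \<le> L * norm (l x - l y)" using r(3) lb by blast
    also have "\<dots> \<le> L * (norm (x - y) * K)" unfolding l.diff[symmetric] using r(2) K(2) by (intro mult_left_mono)
    finally show "\<bar>f (l x) - f (l y)\<bar> \<le> L * K * norm (x - y)" by (simp add: ac_simps)
  qed (use r K in auto)
qed

lemma loclip_psum:
  fixes b :: "('n::finite \<Rightarrow> nat) \<Rightarrow> 'b::banach" and l :: "'b \<Rightarrow> real"
  assumes b: "converges r b" and l: "bounded_linear l"
  shows "loclip (\<lambda>y. l (psum b (y - p))) p"
proof -
  interpret l: bounded_linear l by fact
  have r: "0 < r" by (rule converges_radius_pos[OF b])
  have "continuous_on (cball 0 (r/2)) (psum (coeff_deriv i b))" for i
    by (rule continuous_on_subset[OF continuous_on_psum[OF converges_coeff_deriv[OF b]]]) (use r in auto)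
  then have "continuous_on (cball 0 (r/2)) (\<lambda>x. \<Sum>i\<in>UNIV. norm (psum (coeff_deriv i b) x))"
    by (intro continuous_intros)
  then have "bounded ((\<lambda>x. \<Sum>i\<in>UNIV. norm (psum (coeff_deriv i b) x)) ` cball 0 (r/2))"
    by (rule compact_imp_bounded[OF compact_continuous_image[OF _ compact_cball]])
  then obtain C where C: "\<And>x. x \<in> cball 0 (r/2) \<Longrightarrow> norm (\<Sum>i\<in>UNIV. norm (psum (coeff_deriv i b) x)) \<le> C"
    unfolding bounded_iff by (metis imageI)
  have C0: "0 \<le> C" using C[of 0] r by (auto intro: order_trans[OF norm_ge_zero])
  obtain K where K: "0 < K" "\<And>x. norm (l x) \<le> norm x * K" using l.pos_bounded by blast
  show ?thesis
  proof (rule loclipI[of "r/2" "C * K"])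
    fix x y assume xy: "x \<in> ball p (r/2)" "y \<in> ball p (r/2)"
    have "norm (psum b (x - p) - psum b (y - p)) \<le> C * norm (x - y)"
    proof (rule differentiable_bound[where S = "ball p (r/2)" and f' = "\<lambda>z. dsum b (z - p)"])
      fix z assume z: "z \<in> ball p (r/2)"
      show "((\<lambda>y. psum b (y - p)) has_derivative dsum b (z - p)) (at z within ball p (r/2))"
        by (rule has_derivative_psum'[OF b]) (use z r in auto)
      show "onorm (dsum b (z - p)) \<le> C"
      proof (rule onorm_le)
        fix h :: "real^'n"
        have "norm (dsum b (z - p) h) \<le> (\<Sum>i\<in>UNIV. norm h * norm (psum (coeff_deriv i b) (z - p)))"
          unfolding dsum_def using component_le_norm_cart[of h]
          by (intro sum_norm_le) (auto intro!: mult_right_mono)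
        also have "\<dots> = (\<Sum>i\<in>UNIV. norm (psum (coeff_deriv i b) (z - p))) * norm h"
          by (simp add: sum_distrib_left mult.commute)
        also have "\<dots> \<le> C * norm h"
          using C[of "z - p"] z by (intro mult_right_mono) (auto simp: dist_norm norm_minus_commute)
        finally show "norm (dsum b (z - p) h) \<le> C * norm h" .
      qed
    qed (use xy in auto)
    then have "norm (psum b (x - p) - psum b (y - p)) * K \<le> C * norm (x - y) * K" using K(1) by simp
    then show "\<bar>l (psum b (x - p)) - l (psum b (y - p))\<bar> \<le> C * K * norm (x - y)"
      using K(2)[of "psum b (x - p) - psum b (y - p)"] by (simp add: l.diff ac_simps)
  qed (use r C0 K in auto)
qed

lemma loclip_det:
  fixes G :: "'a::real_normed_vector \<Rightarrow> real^'n^'n::finite"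
  assumes "\<And>i j. loclip (\<lambda>y. G y $ i $ j) p"
  shows "loclip (\<lambda>y. det (G y)) p"
  unfolding det_def by (intro loclip_sum loclip_mult loclip_const loclip_prod assms)

context analytic_riemannian
begin

text \<open>
  Extending the metric by its power series to a full ball and the inverse metric by Cramer's rule yields
  functions to which the calculus of \<open>loclip\<close> applies.
\<close>

lemma christoffel_loclip:
  assumes c: "c \<in> A" "x \<in> fst c"
  obtains r \<Gamma> where "0 < r" "half_space \<inter> ball (snd c x) r \<subseteq> chart_image c"
    "\<And>y k i j. y \<in> half_space \<inter> ball (snd c x) r \<Longrightarrow> christoffel A g c y k i j = \<Gamma> k i j y"
    "\<And>k i j. loclip (\<Gamma> k i j) (snd c x)"
proof -
  let ?p = "snd c x"
  obtain r b where r: "converges r b" "half_space \<inter> ball ?p r \<subseteq> chart_image c"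
    "\<And>y. y \<in> half_space \<inter> ball ?p r \<Longrightarrow> gmat c y = psum b (y - ?p)"
    "\<And>y. y \<in> half_space \<inter> ball ?p r \<Longrightarrow> mderiv c y = dsum b (y - ?p)"
    by (rule metric_series[OF c]) blast
  have r0: "0 < r" by (rule converges_radius_pos[OF r(1)])
  have ph: "?p \<in> half_space \<inter> ball ?p r" using chart_in_half_space[OF c] r0 by simp
  define B where "B = (\<lambda>y. psum b (y - ?p))"
  define P where "P = (\<lambda>l i j y. psum (coeff_deriv l b) (y - ?p) $ i $ j)"
  define Q where "Q = (\<lambda>k l y. det (\<chi> i j. if j = k then axis l 1 $ i else B y $ i $ j) * inverse (det (B y)))"
  define \<Gamma> where "\<Gamma> = (\<lambda>k i j y. (1/2) * (\<Sum>l\<in>UNIV. Q k l y * (P i j l y + P j i l y - P l i j y)))"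
  have pdy: "posdef (B y)" and By: "gmat c y = B y" if y: "y \<in> half_space \<inter> ball ?p r" for y
  proof -
    show e: "gmat c y = B y" using r(3)[OF y] by (simp add: B_def)
    obtain x' where x': "x' \<in> fst c" "y = snd c x'" using y r(2) by blast
    show "posdef (B y)" unfolding e[symmetric] unfolding x'(2) by (rule gmat_posdef[OF c(1) x'(1)])
  qed
  have bl: "bounded_linear (\<lambda>X::real^'n^'n. X $ i $ j)" for i j
    by (intro bounded_linear_compose[OF bounded_linear_vec_nth] bounded_linear_vec_nth)
  have BL: "loclip (\<lambda>y. B y $ i $ j) ?p" for i j
    unfolding B_def by (rule loclip_psum[OF r(1) bl])
  have PL: "loclip (P l i j) ?p" for l i j
    unfolding P_def by (rule loclip_psum[OF converges_coeff_deriv[OF r(1)] bl])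
  have QL: "loclip (Q k l) ?p" for k l
    unfolding Q_def
  proof (intro loclip_mult loclip_inverse loclip_det)
    show "loclip (\<lambda>y. (\<chi> i j. if j = k then axis l 1 $ i else B y $ i $ j) $ i $ j) ?p" for i j
      by (cases "j = k") (simp_all add: loclip_const BL)
    show "loclip (\<lambda>y. B y $ i $ j) ?p" for i j by (rule BL)
    show "det (B ?p) \<noteq> 0" using posdef_invertible[OF pdy[OF ph]] by (simp add: invertible_det_nz)
  qed
  show thesis
  proof (rule that[of r \<Gamma>, OF r0 r(2)])
    show "loclip (\<Gamma> k i j) ?p" for k i j
      unfolding \<Gamma>_def by (intro loclip_mult loclip_const loclip_sum loclip_add loclip_diff QL PL)
    fix y k i j assume y: "y \<in> half_space \<inter> ball ?p r"
    have "matrix_inv (gmat c y) $ k $ l = Q k l y" for l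
    proof -
      have "matrix_inv (B y) $ k $ l = (matrix_inv (B y) *v axis l 1) $ k"
        by (simp add: matrix_vector_mult_basis column_def)
      then show ?thesis
        using matrix_inv_cramer[OF posdef_invertible[OF pdy[OF y]], of "axis l 1" k] By[OF y]
        by (simp add: Q_def field_simps)
    qed
    moreover have "metric_pderiv A g c y l i j = P l i j y" for l i j
    proof -
      have "metric_pderiv A g c y l i j = mderiv c y (axis l 1) $ i $ j"
        by (simp add: metric_pderiv_def mderiv_def)
      also have "\<dots> = P l i j y" unfolding r(4)[OF y] by (simp add: dsum_axis P_def)
      finally show ?thesis .
    qed
    ultimately show "christoffel A g c y k i j = \<Gamma> k i j y"
      by (simp add: christoffel_def \<Gamma>_def)
  qed
qed

text \<open>
  The half-ball of positions and the ball of velocities, of the same radius \<open>r\<close>, on which the geodesic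
  equation can be solved and on which the acceleration differs little from that of the velocity \<open>u\<close>
  at \<open>x\<close>.
\<close>

lemma acceleration_box:
  assumes c: "c \<in> A" "x \<in> fst c" and \<epsilon>: "0 < \<epsilon>"
  obtains r L where "0 < r" "0 \<le> L" "half_space \<inter> cball (snd c x) r \<subseteq> chart_image c"
    "\<And>y y' w w'. \<lbrakk>y \<in> half_space \<inter> cball (snd c x) r; y' \<in> half_space \<inter> cball (snd c x) r;
       w \<in> cball u r; w' \<in> cball u r\<rbrakk> \<Longrightarrow>
       norm (chr c y w w - chr c y' w' w') \<le> L * norm ((y, w) - (y', w'))"
    "\<And>y w. \<lbrakk>y \<in> half_space \<inter> cball (snd c x) r; w \<in> cball u r\<rbrakk> \<Longrightarrow>
       norm (chr c y w w - chr c (snd c x) u u) \<le> \<epsilon>"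
proof -
  let ?p = "snd c x"
  obtain r1 \<Gamma> where r1: "0 < r1" "half_space \<inter> ball ?p r1 \<subseteq> chart_image c"
    and \<Gamma>: "\<And>y k i j. y \<in> half_space \<inter> ball ?p r1 \<Longrightarrow> christoffel A g c y k i j = \<Gamma> k i j y"
    and \<Gamma>L: "\<And>k i j. loclip (\<Gamma> k i j) ?p"
    by (rule christoffel_loclip[OF c]) blast
  define F where "F = (\<lambda>k (z::(real^'n) \<times> (real^'n)). \<Sum>i\<in>UNIV. \<Sum>j\<in>UNIV. \<Gamma> k i j (fst z) * snd z $ i * snd z $ j)"
  have "loclip (F k) (?p, u)" for k
    unfolding F_def
  proof (intro loclip_sum loclip_mult)
    show "loclip (\<lambda>z. \<Gamma> k i j (fst z)) (?p, u)" for i j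
      by (rule loclip_compose_linear[OF _ bounded_linear_fst]) (simp add: \<Gamma>L)
    show "loclip (\<lambda>z. snd z $ i) (?p, u)" for i
      by (rule loclip_linear[OF bounded_linear_compose[OF bounded_linear_vec_nth bounded_linear_snd]])
    show "loclip (\<lambda>z. snd z $ i) (?p, u)" for i
      by (rule loclip_linear[OF bounded_linear_compose[OF bounded_linear_vec_nth bounded_linear_snd]])
  qed
  then have "\<exists>r L. 0 < r \<and> 0 \<le> L \<and> (\<forall>z\<in>ball (?p, u) r. \<forall>z'\<in>ball (?p, u) r. \<bar>F k z - F k z'\<bar> \<le> L * norm (z - z'))" for k
    unfolding loclip_def by blast
  then obtain R LL where R: "\<And>k. 0 < R k" "\<And>k. 0 \<le> LL k"
    "\<And>k z z'. z \<in> ball (?p, u) (R k) \<Longrightarrow> z' \<in> ball (?p, u) (R k) \<Longrightarrow> \<bar>F k z - F k z'\<bar> \<le> LL k * norm (z - z')"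
    by metis
  define L where "L = (\<Sum>k\<in>UNIV. LL k)"
  have L: "0 \<le> L" unfolding L_def by (intro sum_nonneg R)
  define r where "r = min (min (r1 / 2) (Min (range R) / 4)) (\<epsilon> / (4 * (L + 1)))"
  have MinR: "0 < Min (range R)" using R(1) by simp
  have r: "0 < r" "r < r1" "\<And>k. 2 * r < R k" "4 * (L + 1) * r \<le> \<epsilon>"
  proof -
    show "0 < r" using r1 MinR \<epsilon> L by (simp add: r_def)
    have "r \<le> r1 / 2" unfolding r_def by (rule order_trans[OF min.cobounded1 min.cobounded1])
    then show "r < r1" using r1 by linarith
    fix k have "Min (range R) \<le> R k" by simp
    moreover have "r \<le> Min (range R) / 4" unfolding r_def by (rule order_trans[OF min.cobounded1 min.cobounded2])
    ultimately show "2 * r < R k" using MinR by linarith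
  next
    have "r \<le> \<epsilon> / (4 * (L + 1))" unfolding r_def by (rule min.cobounded2)
    then show "4 * (L + 1) * r \<le> \<epsilon>" using L by (simp add: field_simps)
  qed
  have zb: "(y, w) \<in> ball (?p, u) (R k)" if "y \<in> cball ?p r" "w \<in> cball u r" for y w k
  proof -
    have "dist (?p, u) (y, w) \<le> dist ?p y + dist u w"
      unfolding dist_Pair_Pair by (rule sqrt_sum_squares_le_sum) auto
    then show ?thesis using that r(3)[of k] by simp
  qed
  have eq: "chr c y w w $ k = F k (y, w)" if "y \<in> half_space \<inter> cball ?p r" for y w k
  proof -
    have "y \<in> half_space \<inter> ball ?p r1" using that r(2) by auto
    then show ?thesis by (simp add: christoffel_vec_def F_def \<Gamma>)
  qed
  have lip: "norm (chr c y w w - chr c y' w' w') \<le> L * norm ((y, w) - (y', w'))"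
    if "y \<in> half_space \<inter> cball ?p r" "y' \<in> half_space \<inter> cball ?p r" "w \<in> cball u r" "w' \<in> cball u r" for y y' w w'
  proof -
    have "norm (chr c y w w - chr c y' w' w') \<le> (\<Sum>k\<in>UNIV. \<bar>(chr c y w w - chr c y' w' w') $ k\<bar>)"
      by (rule norm_le_l1_cart)
    also have "\<dots> \<le> (\<Sum>k\<in>UNIV. LL k * norm ((y, w) - (y', w')))"
      using that R(3)[OF zb zb] by (intro sum_mono) (simp add: eq)
    finally show ?thesis by (simp add: L_def sum_distrib_right)
  qed
  show thesis
  proof (rule that[OF r(1) L _ lip])
    show "half_space \<inter> cball ?p r \<subseteq> chart_image c" using r1(2) r(2) by fastforce
    fix y w assume y: "y \<in> half_space \<inter> cball ?p r" and w: "w \<in> cball u r"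
    have "norm (chr c y w w - chr c ?p u u) \<le> L * norm ((y, w) - (?p, u))"
      by (rule lip) (use y w r(1) chart_in_half_space[OF c] in auto)
    also have "norm ((y, w) - (?p, u)) \<le> norm (y - ?p) + norm (w - u)"
      by (metis diff_Pair norm_Pair_le)
    also have "\<dots> \<le> 2 * r" using y w by (simp add: dist_norm norm_minus_commute)
    also have "L * (2 * r) \<le> 4 * (L + 1) * r" using L r(1) by (simp add: algebra_simps)
    also have "\<dots> \<le> \<epsilon>" by (rule r(4))
    finally show "norm (chr c y w w - chr c ?p u u) \<le> \<epsilon>" using L by (simp add: mult_left_mono)
  qed auto
qed

section \<open>Geodesics in charts\<close>

text \<open>
  A solution of the geodesic equation in one chart solves it in every other chart: differentiating
  twice the image of the curve under the coordinate change produces exactly the second differential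
  that \<open>christoffel_change\<close> removes.
\<close>

lemma geodesic_of_coords:
  assumes c: "c \<in> A" and yc: "\<And>t. t \<in> I \<Longrightarrow> y t \<in> chart_image c"
    and y: "\<And>t. t \<in> I \<Longrightarrow> (y has_vector_derivative w t) (at t within I)"
    and w: "\<And>t. t \<in> I \<Longrightarrow> (w has_vector_derivative - chr c (y t) (w t) (w t)) (at t within I)"
  shows "geodesic_on M A g I (\<lambda>t. chart_inv c (y t)) (\<lambda>t. coord_vector A (chart_inv c (y t)) c (w t))"
  unfolding geodesic_on_def
proof (intro conjI ballI impI)
  have contY: "continuous_on I y"
    using y by (meson continuous_on_eq_continuous_within has_vector_derivative_continuous)
  have "continuous_map (top_of_set I) (top_of_set (chart_image c)) y"
    using contY yc by (auto simp: continuous_map_in_subtopology)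
  from continuous_map_compose[OF this chart_inv_continuous[OF c]]
  show "continuous_map (top_of_set I) M (\<lambda>t. chart_inv c (y t))" by (simp add: o_def)
  fix t assume t: "t \<in> I"
  let ?x = "chart_inv c (y t)"
  have x: "?x \<in> fst c" "snd c ?x = y t" using chart_inv_in[OF yc[OF t]] chart_inv_right[OF yc[OF t]] by auto
  show "coord_vector A ?x c (w t) \<in> tangent_space A ?x" by (rule coord_vector_in_tangent_space[OF c x(1)])
  fix d assume d: "d \<in> A" "?x \<in> fst d"
  obtain r a where ra: "converges r a" and rx: "\<And>x'. x' \<in> fst c \<Longrightarrow> snd c x' \<in> ball (snd c ?x) r \<Longrightarrow>
     x' \<in> fst d \<and> snd d x' = psum a (snd c x' - snd c ?x) \<and> transition_deriv c d x' = dsum a (snd c x' - snd c ?x)"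
    by (rule coord_change_series[OF c d(1) x(1) d(2)]) blast
  have r0: "0 < r" by (rule converges_radius_pos[OF ra])
  have tr: "transition_deriv c d ?x = dsum a 0" using rx[OF x(1)] r0 by simp
  have "\<exists>\<delta>>0. \<forall>s\<in>I. dist s t < \<delta> \<longrightarrow> dist (y s) (y t) < r"
    using contY t r0 unfolding continuous_on_iff by blast
  then obtain \<delta> where \<delta>: "0 < \<delta>" "\<And>s. s \<in> I \<Longrightarrow> dist s t < \<delta> \<Longrightarrow> dist (y s) (y t) < r" by blast
  have near: "chart_inv c (y s) \<in> fst d \<and> snd d (chart_inv c (y s)) = psum a (y s - y t)
      \<and> transition_deriv c d (chart_inv c (y s)) = dsum a (y s - y t)" if "s \<in> I" "dist s t < \<delta>" for s
    using rx[OF chart_inv_in[OF yc[OF that(1)]]] chart_inv_right[OF yc[OF that(1)]] \<delta>(2)[OF that] x(2)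
    by (simp add: dist_commute)
  have ps: "((\<lambda>s. psum b (y s - y t)) has_vector_derivative dsum b 0 (w t)) (at t within I)"
    if b: "converges r b" for b :: "('n \<Rightarrow> nat) \<Rightarrow> real^'n"
  proof -
    have "((\<lambda>z. psum b (z - y t)) has_derivative dsum b 0) (at (y t) within y ` I)"
      using has_derivative_psum'[OF b, of "y t" "y t"] r0 by simp
    from vector_derivative_diff_chain_within[OF y[OF t] this] show ?thesis by (simp add: o_def)
  qed
  have 1: "((\<lambda>s. psum a (y s - y t)) has_vector_derivative coord_vector A ?x c (w t) d) (at t within I)"
    using ps[OF ra] d tr by (simp add: coord_vector_apply)
  show "((\<lambda>s. snd d (chart_inv c (y s))) has_vector_derivative coord_vector A ?x c (w t) d) (at t within I)"
    by (rule has_vector_derivative_transform_within[OF 1 \<delta>(1) t]) (use near in auto)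
  have "((\<lambda>s. \<Sum>i\<in>UNIV. w s $ i *\<^sub>R psum (coeff_deriv i a) (y s - y t)) has_vector_derivative
      (\<Sum>i\<in>UNIV. w t $ i *\<^sub>R dsum (coeff_deriv i a) 0 (w t) + (- chr c (y t) (w t) (w t)) $ i *\<^sub>R psum (coeff_deriv i a) (y t - y t))) (at t within I)"
    by (intro has_vector_derivative_sum has_vector_derivative_scaleR ps converges_coeff_deriv ra)
      (use bounded_linear.has_vector_derivative[OF bounded_linear_vec_nth w[OF t]]
        in \<open>simp add: has_real_derivative_iff_has_vector_derivative\<close>)
  then have 2: "((\<lambda>s. dsum a (y s - y t) (w s)) has_vector_derivative
      ddsum a 0 (w t) (w t) + dsum a 0 (- chr c (y t) (w t) (w t))) (at t within I)"
    by (simp add: dsum_def[of a] ddsum_def sum.distrib sum_subtractf sum_negf)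
  have "chr d (snd d ?x) (dsum a 0 (w t)) (dsum a 0 (w t)) = dsum a 0 (chr c (snd c ?x) (w t) (w t)) - ddsum a 0 (w t) (w t)"
    by (rule christoffel_change[OF c x(1) d ra rx])
  then have e: "ddsum a 0 (w t) (w t) + dsum a 0 (- chr c (y t) (w t) (w t))
      = - chr d (snd d ?x) (coord_vector A ?x c (w t) d) (coord_vector A ?x c (w t) d)"
    using d tr x(2) by (simp add: coord_vector_apply linear_neg[OF linear_dsum])
  show "((\<lambda>s. coord_vector A (chart_inv c (y s)) c (w s) d) has_vector_derivative
      - chr d (snd d ?x) (coord_vector A ?x c (w t) d) (coord_vector A ?x c (w t) d)) (at t within I)"
    by (rule has_vector_derivative_transform_within[OF 2[unfolded e] \<delta>(1) t])
      (use near d(1) in \<open>auto simp: coord_vector_apply\<close>)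
qed

end

section \<open>Short geodesics near a strictly convex boundary point\<close>

lemma closed_half_space: "closed half_space"
  unfolding half_space_def by (rule closed_halfspace_component_ge_cart)

lemma convex_half_space: "convex (half_space :: (real^'n::finite) set)"
proof -
  have "half_space = {x :: real^'n. axis normal_index 1 \<bullet> x \<ge> 0}"
    by (auto simp: half_space_def inner_axis')
  moreover have "convex {x :: real^'n. axis normal_index 1 \<bullet> x \<ge> 0}" by (rule convex_halfspace_ge)
  ultimately show ?thesis by metis
qed

lemma norm_fst_le': "norm (fst z) \<le> norm z" and norm_snd_le': "norm (snd z) \<le> norm z"
  for z :: "'a::real_normed_vector \<times> 'b::real_normed_vector"
  by (metis norm_fst_le prod.collapse, metis norm_snd_le prod.collapse)

context analytic_riemannian
begin

text \<open>
  The vector field of the geodesic equation with position and velocity projected to \<open>K1\<close> and \<open>K2\<close>. As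
  projections to closed convex sets are nonexpansive, the field is globally Lipschitz if the
  acceleration is Lipschitz on \<open>K1 \<times> K2\<close>; in particular it is defined beyond the boundary of the
  half-space.
\<close>

definition geodesic_field ::
  "('m, 'n) chart \<Rightarrow> (real^'n) set \<Rightarrow> (real^'n) set \<Rightarrow> (real^'n) \<times> (real^'n) \<Rightarrow> (real^'n) \<times> (real^'n)" where
  "geodesic_field c K1 K2 z = (snd z,
     - chr c (closest_point K1 (fst z)) (closest_point K2 (snd z)) (closest_point K2 (snd z)))"

lemma geodesic_field_inside:
  "fst z \<in> K1 \<Longrightarrow> snd z \<in> K2 \<Longrightarrow> geodesic_field c K1 K2 z = (snd z, - chr c (fst z) (snd z) (snd z))"
  by (simp add: geodesic_field_def closest_point_self)

lemma geodesic_field_lipschitz: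
  assumes K: "convex K1" "closed K1" "K1 \<noteq> {}" "convex K2" "closed K2" "K2 \<noteq> {}"
    and L: "0 \<le> L" "\<And>y y' w w'. \<lbrakk>y \<in> K1; y' \<in> K1; w \<in> K2; w' \<in> K2\<rbrakk> \<Longrightarrow>
       norm (chr c y w w - chr c y' w' w') \<le> L * norm ((y, w) - (y', w'))"
  shows "norm (geodesic_field c K1 K2 z - geodesic_field c K1 K2 z') \<le> (1 + 2 * L) * norm (z - z')"
proof -
  define y w y' w' where "y = closest_point K1 (fst z)" and "w = closest_point K2 (snd z)"
    and "y' = closest_point K1 (fst z')" and "w' = closest_point K2 (snd z')"
  have "norm (geodesic_field c K1 K2 z - geodesic_field c K1 K2 z')
      = norm (snd z - snd z', chr c y' w' w' - chr c y w w)"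
    by (simp add: geodesic_field_def y_def w_def y'_def w'_def)
  also have "\<dots> \<le> norm (snd z - snd z') + norm (chr c y' w' w' - chr c y w w)" by (rule norm_Pair_le)
  also have "\<dots> \<le> norm (z - z') + L * (2 * norm (z - z'))"
  proof (rule add_mono)
    show "norm (snd z - snd z') \<le> norm (z - z')" using norm_snd_le'[of "z - z'"] by simp
    have "norm (chr c y' w' w' - chr c y w w) \<le> L * norm ((y', w') - (y, w))"
      using K by (intro L(2)) (simp_all add: y_def w_def y'_def w'_def closest_point_in_set)
    also have "\<dots> \<le> L * (2 * norm (z - z'))"
    proof (rule mult_left_mono[OF _ L(1)])
      have "dist y' y \<le> dist (fst z') (fst z)" unfolding y_def y'_def by (rule closest_point_lipschitz[OF K(1-3)])
      moreover have "dist w' w \<le> dist (snd z') (snd z)" unfolding w_def w'_def by (rule closest_point_lipschitz[OF K(4-6)])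
      moreover have "norm ((y', w') - (y, w)) \<le> dist y' y + dist w' w"
        unfolding dist_norm diff_Pair by (rule norm_Pair_le)
      ultimately show "norm ((y', w') - (y, w)) \<le> 2 * norm (z - z')"
        using norm_fst_le'[of "z' - z"] norm_snd_le'[of "z' - z"] by (simp add: dist_norm norm_minus_commute)
    qed
    finally show "norm (chr c y' w' w' - chr c y w w) \<le> L * (2 * norm (z - z'))" .
  qed
  also have "\<dots> = (1 + 2 * L) * norm (z - z')" by (simp add: algebra_simps)
  finally show ?thesis .
qed

text \<open>
  The acceleration is bounded by \<open>B\<close> everywhere, so solutions that start in the middle of the box do not
  leave the two balls for a time that is independent of the initial data. They may leave the
  half-space.
\<close>

lemma short_solutions:
  assumes r: "0 < r" and p: "p \<in> half_space"
    and L: "0 \<le> L" "\<And>y y' w w'. \<lbrakk>y \<in> half_space \<inter> cball p r; y' \<in> half_space \<inter> cball p r;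
       w \<in> cball u r; w' \<in> cball u r\<rbrakk> \<Longrightarrow> norm (chr c y w w - chr c y' w' w') \<le> L * norm ((y, w) - (y', w'))"
    and B: "0 \<le> B" "\<And>y w. \<lbrakk>y \<in> half_space \<inter> cball p r; w \<in> cball u r\<rbrakk> \<Longrightarrow> norm (chr c y w w) \<le> B"
  obtains T where "0 < T"
    "\<And>q v. \<lbrakk>q \<in> ball p (r/4); v \<in> ball u (r/4)\<rbrakk> \<Longrightarrow>
      \<exists>z. z 0 = (q, v) \<and>
        (\<forall>t\<in>{0..T}. (z has_vector_derivative geodesic_field c (half_space \<inter> cball p r) (cball u r) (z t)) (at t within {0..T}) \<and>
           fst (z t) \<in> ball p r \<and> snd (z t) \<in> ball u r \<and>
           norm (fst (z t) - q) \<le> (norm u + r) * t)"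
proof -
  let ?K1 = "half_space \<inter> cball p r" and ?K2 = "cball u r"
  let ?F = "geodesic_field c ?K1 ?K2"
  have K: "convex ?K1" "closed ?K1" "?K1 \<noteq> {}" "convex ?K2" "closed ?K2" "?K2 \<noteq> {}"
    using r p by (auto intro: convex_Int convex_half_space closed_Int closed_half_space)
  define C where "C = norm u + r"
  have C: "0 < C" using r by (simp add: C_def add_nonneg_pos)
  \<comment> \<open>The three bounds serve the contraction property, the velocity and the position, in this order.\<close>
  define T where "T = min (1 / (2 * (1 + 2 * L))) (min (r / (2 * (B + 1))) (r / (2 * C)))"
  have T: "0 < T" using r L B C by (simp add: T_def)
  have T1: "(1 + 2 * L) * T < 1"
  proof -
    have "T \<le> 1 / (2 * (1 + 2 * L))" unfolding T_def by (rule min.cobounded1)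
    then have "(1 + 2 * L) * T \<le> (1 + 2 * L) * (1 / (2 * (1 + 2 * L)))" using L by (intro mult_left_mono) auto
    also have "\<dots> = 1/2" using L by simp
    finally show ?thesis by simp
  qed
  have T2: "B * T \<le> r / 2"
  proof -
    have "T \<le> r / (2 * (B + 1))" unfolding T_def by (rule order_trans[OF min.cobounded2 min.cobounded1])
    then have "(B + 1) * T \<le> (B + 1) * (r / (2 * (B + 1)))" using B by (intro mult_left_mono) auto
    also have "\<dots> = r / 2"
    proof -
      have "b * (r / (2 * b)) = r / 2" if "b \<noteq> 0" for b :: real using that by simp
      from this[of "B + 1"] show ?thesis using B(1) by linarith
    qed
    finally show ?thesis using T by (simp add: algebra_simps)
  qed
  have T3: "C * T \<le> r / 2"
  proof -
    have "T \<le> r / (2 * C)" unfolding T_def by (rule order_trans[OF min.cobounded2 min.cobounded2])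
    then have "C * T \<le> C * (r / (2 * C))" using C by (intro mult_left_mono) auto
    then show ?thesis using C by simp
  qed
  show thesis
  proof (rule that[OF T])
    fix q v assume q: "q \<in> ball p (r/4)" and v: "v \<in> ball u (r/4)"
    have lip: "norm (?F z - ?F z') \<le> (1 + 2 * L) * norm (z - z')" for z z'
      by (rule geodesic_field_lipschitz[OF K L])
    have "(1 + 2 * L)-lipschitz_on UNIV ?F"
      using lip L by (intro lipschitz_onI) (auto simp: dist_norm)
    then have "continuous_on UNIV ?F" by (rule lipschitz_on_continuous_on)
    then have cF: "continuous_on ({0..T} \<times> UNIV) (\<lambda>(t::real, z). ?F z)"
      unfolding case_prod_beta by (rule continuous_on_compose2) (auto intro: continuous_intros)
    obtain z where z0: "z 0 = (q, v)"
      and z: "\<And>t. t \<in> {0..T} \<Longrightarrow> (z has_vector_derivative ?F (z t)) (at t within {0..T})"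
      using ode_exists[of T "1 + 2 * L" "\<lambda>t z. ?F z" "(q, v)"] T T1 L cF lip by auto
    have dfst: "((\<lambda>t. fst (z t)) has_vector_derivative snd (z t)) (at t within {0..T})"
      and dsnd: "((\<lambda>t. snd (z t)) has_vector_derivative snd (?F (z t))) (at t within {0..T})" if "t \<in> {0..T}" for t
      using bounded_linear.has_vector_derivative[OF bounded_linear_fst z[OF that]]
        bounded_linear.has_vector_derivative[OF bounded_linear_snd z[OF that]]
      by (simp_all add: geodesic_field_def)
    have acc: "norm (snd (?F y)) \<le> B" for y
      using B(2)[OF closest_point_in_set[OF K(2,3)] closest_point_in_set[OF K(5,6)]]
      by (simp add: geodesic_field_def)
    have w: "norm (snd (z t) - v) \<le> B * t" if t: "t \<in> {0..T}" for t
    proof -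
      have "norm ((\<lambda>t. snd (z t)) t - (\<lambda>t. snd (z t)) 0) \<le> B * t - B * 0"
      proof (rule bound_from_derivative_bound[where D' = "\<lambda>t. snd (?F (z t))" and I = "\<lambda>t. B * t" and I' = "\<lambda>_. B"])
        fix s assume "s \<in> {0..t}"
        then show "((\<lambda>t. snd (z t)) has_vector_derivative snd (?F (z s))) (at s within {0..t})"
          using t by (intro has_vector_derivative_within_subset[OF dsnd]) auto
        show "((\<lambda>t. B * t) has_vector_derivative B) (at s within {0..t})"
          by (auto intro!: derivative_eq_intros simp: has_real_derivative_iff_has_vector_derivative[symmetric])
      qed (use t acc in auto)
      then show ?thesis by (simp add: z0)
    qed
    have wb: "snd (z t) \<in> ball u (3 * r / 4)" if t: "t \<in> {0..T}" for t
    proof -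
      have "norm (snd (z t) - u) \<le> norm (snd (z t) - v) + norm (v - u)"
        using norm_triangle_ineq[of "snd (z t) - v" "v - u"] by simp
      moreover have "B * t \<le> B * T" using t B(1) by (intro mult_left_mono) auto
      moreover have "norm (v - u) < r / 4" using v by (simp add: dist_norm norm_minus_commute)
      ultimately have "norm (snd (z t) - u) < 3 * r / 4" using w[OF t] T2 by linarith
      then show ?thesis by (simp add: dist_norm norm_minus_commute)
    qed
    have wC: "norm (snd (z t)) \<le> C" if t: "t \<in> {0..T}" for t
    proof -
      have "norm (snd (z t)) \<le> norm u + norm (snd (z t) - u)"
        using norm_triangle_ineq[of u "snd (z t) - u"] by simp
      then show ?thesis using wb[OF t] r by (simp add: C_def dist_norm norm_minus_commute)
    qed
    have y: "norm (fst (z t) - q) \<le> C * t" if t: "t \<in> {0..T}" for t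
    proof -
      have "norm ((\<lambda>t. fst (z t)) t - (\<lambda>t. fst (z t)) 0) \<le> C * t - C * 0"
      proof (rule bound_from_derivative_bound[where D' = "\<lambda>t. snd (z t)" and I = "\<lambda>t. C * t" and I' = "\<lambda>_. C"])
        fix s assume "s \<in> {0..t}"
        then show "((\<lambda>t. fst (z t)) has_vector_derivative snd (z s)) (at s within {0..t})"
          using t by (intro has_vector_derivative_within_subset[OF dfst]) auto
        show "((\<lambda>t. C * t) has_vector_derivative C) (at s within {0..t})"
          by (auto intro!: derivative_eq_intros simp: has_real_derivative_iff_has_vector_derivative[symmetric])
      qed (use t wC in auto)
      then show ?thesis by (simp add: z0)
    qed
    have yb: "fst (z t) \<in> ball p r" if t: "t \<in> {0..T}" for t
    proof -
      have "norm (fst (z t) - p) \<le> norm (fst (z t) - q) + norm (q - p)"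
        using norm_triangle_ineq[of "fst (z t) - q" "q - p"] by simp
      moreover have "C * t \<le> C * T" using t C by (intro mult_left_mono) auto
      moreover have "norm (q - p) < r / 4" using q by (simp add: dist_norm norm_minus_commute)
      ultimately have "norm (fst (z t) - p) < r" using y[OF t] T3 r by linarith
      then show ?thesis by (simp add: dist_norm norm_minus_commute)
    qed
    show "\<exists>z. z 0 = (q, v) \<and>
        (\<forall>t\<in>{0..T}. (z has_vector_derivative ?F (z t)) (at t within {0..T}) \<and>
           fst (z t) \<in> ball p r \<and> snd (z t) \<in> ball u r \<and> norm (fst (z t) - q) \<le> (norm u + r) * t)"
    proof (intro exI[of _ z] conjI ballI)
      fix t assume t: "t \<in> {0..T}"
      show "snd (z t) \<in> ball u r" using wb[OF t] r by simp
      show "norm (fst (z t) - q) \<le> (norm u + r) * t" using y[OF t] by (simp add: C_def)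
    qed (use z0 z yb in auto)
  qed
qed

lemma closed_contains_right_end:
  fixes C :: "real set"
  assumes "closed C" "{0..<s} \<subseteq> C" "0 < s" shows "s \<in> C"
proof -
  have "closure {0..<s} \<subseteq> C" using assms(1,2) by (rule closure_minimal[rotated])
  then show ?thesis using assms(3) by (auto simp: closure_atLeastLessThan)
qed

text \<open>
  The set of times up to which the two curves agree is closed because \<open>M\<close> is a Hausdorff space and the
  solution has its limit in the chart. It is open because the geodesic stays in the chart and in the
  box for a short time, where uniqueness of solutions applies.
\<close>

lemma geodesic_follows_solution:
  fixes \<gamma> :: "real \<Rightarrow> 'm"
  assumes c: "c \<in> A" and r: "0 < r" and box: "half_space \<inter> cball p r \<subseteq> chart_image c"
    and p: "p \<in> half_space"
    and L: "0 \<le> L" "\<And>y y' w w'. \<lbrakk>y \<in> half_space \<inter> cball p r; y' \<in> half_space \<inter> cball p r;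
       w \<in> cball u r; w' \<in> cball u r\<rbrakk> \<Longrightarrow> norm (chr c y w w - chr c y' w' w') \<le> L * norm ((y, w) - (y', w'))"
    and z: "\<And>t. t \<in> {0..T0} \<Longrightarrow>
      (z has_vector_derivative geodesic_field c (half_space \<inter> cball p r) (cball u r) (z t)) (at t within {0..T0})"
      "\<And>t. t \<in> {0..T0} \<Longrightarrow> fst (z t) \<in> ball p r" "\<And>t. t \<in> {0..T0} \<Longrightarrow> snd (z t) \<in> ball u r"
    and T0: "0 \<le> T0" and T: "0 \<le> T" and geo: "geodesic_on M A g {0..T} \<gamma> W"
    and init: "\<gamma> 0 \<in> fst c" "(snd c (\<gamma> 0), W 0 c) = z 0"
    and t: "t \<in> {0..min T T0}"
  shows "\<gamma> t \<in> fst c \<and> (snd c (\<gamma> t), W t c) = z t"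
proof -
  let ?K1 = "half_space \<inter> cball p r" and ?K2 = "cball u r"
  let ?F = "geodesic_field c ?K1 ?K2"
  define T' where "T' = min T T0"
  define Z where "Z = (\<lambda>t. (snd c (\<gamma> t), W t c))"
  define P where "P = (\<lambda>t. \<gamma> t \<in> fst c \<and> Z t = z t)"
  have T': "0 \<le> T'" "T' \<le> T" "T' \<le> T0" using T0 T by (auto simp: T'_def)
  have K: "convex ?K1" "closed ?K1" "?K1 \<noteq> {}" "convex ?K2" "closed ?K2" "?K2 \<noteq> {}"
    using r p by (auto intro: convex_Int convex_half_space closed_Int closed_half_space)
  have \<gamma>c: "continuous_map (top_of_set {0..T}) M \<gamma>" using geo by (simp add: geodesic_on_def)
  have Zd: "(Z has_vector_derivative (W t c, - chr c (snd c (\<gamma> t)) (W t c) (W t c))) (at t within {0..T})"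
    if "t \<in> {0..T}" "\<gamma> t \<in> fst c" for t
    unfolding Z_def using geo that c by (intro has_vector_derivative_Pair) (auto simp: geodesic_on_def)
  have zc: "continuous_on {0..T0} z"
    using z(1) by (meson continuous_on_eq_continuous_within has_vector_derivative_continuous)
  \<comment> \<open>Agreement before the time \<open>s\<close> extends to \<open>s\<close>.\<close>
  have stepA: "P s" if s: "s \<in> {0..T'}" "0 < s" and before: "\<And>t. t \<in> {0..<s} \<Longrightarrow> P t" for s
  proof -
    have sT: "{0..s} \<subseteq> {0..T}" "{0..s} \<subseteq> {0..T0}" using s T' by auto
    have zcs: "continuous_on {0..s} z" by (rule continuous_on_subset[OF zc sT(2)])
    then have fc: "continuous_on {0..s} (\<lambda>t. fst (z t))" and sc: "continuous_on {0..s} (\<lambda>t. snd (z t))"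
      by (auto intro: continuous_intros)
    have Pz: "fst (z t) = snd c (\<gamma> t)" "snd (z t) = W t c" "\<gamma> t \<in> fst c" if "t \<in> {0..<s}" for t
      using before[OF that] by (auto simp: P_def Z_def dest!: sym[of "(_, _)"])
    have "closed ({0..s} \<inter> (\<lambda>t. fst (z t)) -` half_space)"
      by (rule continuous_closed_preimage[OF fc _ closed_half_space]) simp
    then have "s \<in> {0..s} \<inter> (\<lambda>t. fst (z t)) -` half_space"
    proof (rule closed_contains_right_end)
      show "{0..<s} \<subseteq> {0..s} \<inter> (\<lambda>t. fst (z t)) -` half_space"
        using Pz chart_in_half_space[OF c] by auto
    qed (rule s)
    then have zs: "fst (z s) \<in> chart_image c" using box z(2)[of s] s T' by auto
    have yim: "fst (z t) \<in> chart_image c" if "t \<in> {0..s}" for t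
      using Pz[of t] zs that by (cases "t = s") auto
    have "continuous_map (top_of_set {0..s}) (top_of_set (chart_image c)) (\<lambda>t. fst (z t))"
      using fc yim by (auto simp: continuous_map_in_subtopology)
    from continuous_map_compose[OF this chart_inv_continuous[OF c]]
    have c2: "continuous_map (top_of_set {0..s}) M (\<lambda>t. chart_inv c (fst (z t)))" by (simp add: o_def)
    have c1: "continuous_map (top_of_set {0..s}) M \<gamma>"
      using continuous_map_from_subtopology_mono[OF \<gamma>c sT(1)] .
    have "closedin (top_of_set {0..s}) {t \<in> topspace (top_of_set {0..s}). \<gamma> t = chart_inv c (fst (z t))}"
      by (rule closedin_continuous_maps_eq[OF hausdorff c1 c2])
    then have "closed {t \<in> {0..s}. \<gamma> t = chart_inv c (fst (z t))}"
      using closedin_closed_trans[OF _ closed_atLeastAtMost] by simp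
    then have "s \<in> {t \<in> {0..s}. \<gamma> t = chart_inv c (fst (z t))}"
    proof (rule closed_contains_right_end)
      show "{0..<s} \<subseteq> {t \<in> {0..s}. \<gamma> t = chart_inv c (fst (z t))}" using Pz c by auto
    qed (rule s)
    then have gs: "\<gamma> s = chart_inv c (fst (z s))" by simp
    then have gsc: "\<gamma> s \<in> fst c" "snd c (\<gamma> s) = fst (z s)" using chart_inv_in[OF zs] chart_inv_right[OF zs] by auto
    have dom: "\<gamma> t \<in> fst c" if "t \<in> {0..s}" for t using Pz(3)[of t] gsc that by (cases "t = s") auto
    have "continuous (at t within {0..s}) Z" if t: "t \<in> {0..s}" for t
      using Zd[of t] dom[OF t] t sT(1) has_vector_derivative_continuous continuous_within_subset by blast
    then have Zc: "continuous_on {0..s} Z" by (simp add: continuous_on_eq_continuous_within)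
    have "closed {t \<in> {0..s}. Z t - z t = 0}"
      by (rule continuous_closed_preimage_constant) (auto intro!: continuous_intros Zc zcs)
    then have "s \<in> {t \<in> {0..s}. Z t - z t = 0}"
    proof (rule closed_contains_right_end)
      show "{0..<s} \<subseteq> {t \<in> {0..s}. Z t - z t = 0}" using before by (auto simp: P_def)
    qed (rule s)
    then show ?thesis using gsc by (simp add: P_def)
  qed
  \<comment> \<open>Agreement up to the time \<open>s\<close> extends a little beyond \<open>s\<close>.\<close>
  have stepB: "\<exists>\<epsilon>>0. s + \<epsilon> \<le> T' \<and> (\<forall>t\<in>{0..s+\<epsilon>}. P t)"
    if s: "0 \<le> s" "s < T'" and upto: "\<And>t. t \<in> {0..s} \<Longrightarrow> P t" for s
  proof -
    have Ps: "\<gamma> s \<in> fst c" "Z s = z s" using upto[of s] s by (auto simp: P_def)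
    have sT: "s \<in> {0..T}" "s \<in> {0..T0}" using s T' by auto
    have "openin (top_of_set {0..T}) {t \<in> topspace (top_of_set {0..T}). \<gamma> t \<in> fst c}"
      by (rule openin_continuous_map_preimage[OF \<gamma>c chart_openin[OF c]])
    then obtain \<epsilon>1 where \<epsilon>1: "0 < \<epsilon>1" "\<And>t. t \<in> {0..T} \<Longrightarrow> dist t s < \<epsilon>1 \<Longrightarrow> \<gamma> t \<in> fst c"
      using Ps(1) sT(1) unfolding openin_euclidean_subtopology_iff by auto
    define \<rho> where "\<rho> = min (r - norm (fst (z s) - p)) (r - norm (snd (z s) - u))"
    have \<rho>: "0 < \<rho>" using z(2,3)[OF sT(2)] by (simp add: \<rho>_def dist_norm norm_minus_commute)
    have "continuous (at s within {0..T}) Z" using Zd[OF sT(1) Ps(1)] has_vector_derivative_continuous by blast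
    then obtain \<epsilon>2 where \<epsilon>2: "0 < \<epsilon>2" "\<And>t. t \<in> {0..T} \<Longrightarrow> dist t s < \<epsilon>2 \<Longrightarrow> dist (Z t) (Z s) < \<rho>"
      using \<rho> unfolding continuous_within_eps_delta by meson
    define \<epsilon> where "\<epsilon> = min (T' - s) (min (\<epsilon>1 / 2) (\<epsilon>2 / 2))"
    have \<epsilon>: "0 < \<epsilon>" "s + \<epsilon> \<le> T'" "\<epsilon> < \<epsilon>1" "\<epsilon> < \<epsilon>2" using s \<epsilon>1(1) \<epsilon>2(1) by (auto simp: \<epsilon>_def min_def)
    have inside: "\<gamma> t \<in> fst c \<and> fst (Z t) \<in> ?K1 \<and> snd (Z t) \<in> ?K2" if t: "t \<in> {0..s+\<epsilon>}" for t
    proof (cases "t \<le> s")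
      case True
      then have Pt: "P t" and t0: "t \<in> {0..T0}" using upto t sT(2) by auto
      then have "fst (Z t) \<in> ball p r" "snd (Z t) \<in> ball u r" using z(2,3)[OF t0] by (auto simp: P_def)
      moreover have "\<gamma> t \<in> fst c" using Pt by (simp add: P_def)
      then have "fst (Z t) \<in> half_space" by (simp add: Z_def chart_in_half_space[OF c])
      ultimately show ?thesis using Pt by (auto simp: P_def)
    next
      case False
      then have tT: "t \<in> {0..T}" "dist t s < \<epsilon>1" "dist t s < \<epsilon>2" using t \<epsilon> T' s by (auto simp: dist_real_def)
      have g: "\<gamma> t \<in> fst c" using \<epsilon>1(2) tT by blast
      have d: "norm (Z t - z s) < \<rho>" using \<epsilon>2(2) tT Ps(2) by (simp add: dist_norm)
      have "norm (fst (Z t) - fst (z s)) < \<rho>" "norm (snd (Z t) - snd (z s)) < \<rho>"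
        using d norm_fst_le'[of "Z t - z s"] norm_snd_le'[of "Z t - z s"] by auto
      moreover have "norm (fst (Z t) - p) \<le> norm (fst (Z t) - fst (z s)) + norm (fst (z s) - p)"
        "norm (snd (Z t) - u) \<le> norm (snd (Z t) - snd (z s)) + norm (snd (z s) - u)"
        using norm_triangle_ineq[of "fst (Z t) - fst (z s)" "fst (z s) - p"]
          norm_triangle_ineq[of "snd (Z t) - snd (z s)" "snd (z s) - u"] by auto
      ultimately have "norm (fst (Z t) - p) \<le> r" "norm (snd (Z t) - u) \<le> r" unfolding \<rho>_def by linarith+
      moreover have "fst (Z t) \<in> half_space" using chart_in_half_space[OF c g] by (simp add: Z_def)
      ultimately show ?thesis using g by (simp add: dist_norm norm_minus_commute)
    qed
    have "Z t = z t" if t: "t \<in> {0..s+\<epsilon>}" for t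
    proof (rule ode_unique[where f = "\<lambda>t. ?F" and L = "1 + 2 * L" and a = 0 and b = "s + \<epsilon>"])
      show "Z 0 = z 0" using init by (simp add: Z_def)
      show "t \<in> {0..s+\<epsilon>}" by (rule t)
      fix t assume t: "t \<in> {0..s+\<epsilon>}"
      have sub: "{0..s+\<epsilon>} \<subseteq> {0..T}" "{0..s+\<epsilon>} \<subseteq> {0..T0}" using \<epsilon> T' by auto
      have "?F (Z t) = (W t c, - chr c (snd c (\<gamma> t)) (W t c) (W t c))"
        using geodesic_field_inside[of "Z t" ?K1 ?K2 c] inside[OF t] by (simp add: Z_def)
      then show "(Z has_vector_derivative ?F (Z t)) (at t within {0..s+\<epsilon>})"
        using has_vector_derivative_within_subset[OF Zd sub(1)] inside[OF t] t sub(1) by auto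
      show "(z has_vector_derivative ?F (z t)) (at t within {0..s+\<epsilon>})"
        using has_vector_derivative_within_subset[OF z(1) sub(2)] t sub(2) by auto
      show "norm (?F (Z t) - ?F (z t)) \<le> (1 + 2 * L) * norm (Z t - z t)"
        by (rule geodesic_field_lipschitz[OF K L])
    qed
    then have "\<forall>t\<in>{0..s+\<epsilon>}. P t" using inside by (simp add: P_def)
    then show ?thesis using \<epsilon> by blast
  qed
  define J where "J = {s \<in> {0..T'}. \<forall>t\<in>{0..s}. P t}"
  have P0: "P 0" using init by (simp add: P_def Z_def)
  have J0: "0 \<in> J" using T' P0 by (auto simp: J_def)
  have bdd: "bdd_above J" by (rule bdd_aboveI[of _ T']) (auto simp: J_def)
  define s0 where "s0 = Sup J"
  have s0: "0 \<le> s0" "s0 \<le> T'"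
  proof -
    show "0 \<le> s0" unfolding s0_def by (rule cSup_upper[OF J0 bdd])
    show "s0 \<le> T'" unfolding s0_def by (rule cSup_least) (use J0 in \<open>auto simp: J_def\<close>)
  qed
  have below: "P t" if "t \<in> {0..<s0}" for t
  proof -
    have "t < Sup J" "J \<noteq> {}" using that J0 by (auto simp: s0_def)
    then obtain s where "s \<in> J" "t < s" by (rule less_cSupE)
    then show ?thesis using that by (auto simp: J_def)
  qed
  have "P s0" using stepA[of s0] below s0 P0 by (cases "s0 = 0") auto
  then have upto: "P t" if "t \<in> {0..s0}" for t using below[of t] that by (cases "t = s0") auto
  have "s0 = T'"
  proof (rule ccontr)
    assume "s0 \<noteq> T'"
    then obtain \<epsilon> where "0 < \<epsilon>" "s0 + \<epsilon> \<le> T'" "\<forall>t\<in>{0..s0+\<epsilon>}. P t" using stepB[of s0] s0 upto by auto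
    then have "s0 + \<epsilon> \<in> J" using s0 by (auto simp: J_def)
    then have "s0 + \<epsilon> \<le> s0" unfolding s0_def by (rule cSup_upper[OF _ bdd])
    then show False using \<open>0 < \<epsilon>\<close> by simp
  qed
  then have "P t" using upto t by (simp add: T'_def)
  then show ?thesis by (simp add: P_def Z_def)
qed

text \<open>
  Let \<open>y\<close> be the position of the solution of the projected equation with initial data \<open>(x, v)\<close>. The second
  derivative of \<open>y $ normal_index\<close> is at most \<open>- \<kappa>\<close> everywhere, since projected points lie in the box.
  Hence \<open>y $ normal_index\<close> starts at 0, is positive up to its next zero \<open>\<tau>\<close>, and is negative
  afterwards. Up to time \<open>\<tau>\<close> the solution gives a geodesic; every geodesic with the same initial data
  follows the solution and so cannot survive time \<open>\<tau>\<close>.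
\<close>

lemma short_geodesic:
  assumes c: "c \<in> A" "x0 \<in> fst c" and u0: "u0 $ normal_index = 0"
    and convex: "0 < chr c (snd c x0) u0 u0 $ normal_index"
  obtains \<delta> \<kappa> C where "0 < \<delta>" "0 < \<kappa>" "0 \<le> C"
    "\<And>x v. \<lbrakk>x \<in> fst c; v \<in> tangent_space A x; snd c x $ normal_index = 0;
        norm (snd c x - snd c x0) < \<delta>; norm (v c - u0) < \<delta>; 0 < v c $ normal_index\<rbrakk> \<Longrightarrow>
      \<exists>\<tau> y. 0 < \<tau> \<and> \<kappa> * \<tau> \<le> 2 * v c $ normal_index \<and> forward_exit_time M A g (x, v) = ereal \<tau> \<and>
        continuous_on {0..\<tau>} y \<and>
        (\<forall>t\<in>{0..\<tau>}. y t \<in> chart_image c \<and> geodesic_point M A g (x, v) t = chart_inv c (y t) \<and>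
           norm (y t - snd c x) \<le> C * t) \<and>
        (\<forall>t. 0 < t \<and> t < \<tau> \<longrightarrow> 0 < y t $ normal_index)"
proof -
  let ?p = "snd c x0" and ?n = "normal_index :: 'n"
  define a where "a = chr c ?p u0 u0"
  define \<kappa> where "\<kappa> = a $ ?n / 2"
  have \<kappa>: "0 < \<kappa>" using convex by (simp add: \<kappa>_def a_def)
  obtain r L where r: "0 < r" and L: "0 \<le> L" and box: "half_space \<inter> cball ?p r \<subseteq> chart_image c"
    and lip: "\<And>y y' w w'. \<lbrakk>y \<in> half_space \<inter> cball ?p r; y' \<in> half_space \<inter> cball ?p r;
       w \<in> cball u0 r; w' \<in> cball u0 r\<rbrakk> \<Longrightarrow>
       norm (chr c y w w - chr c y' w' w') \<le> L * norm ((y, w) - (y', w'))"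
    and near: "\<And>y w. \<lbrakk>y \<in> half_space \<inter> cball ?p r; w \<in> cball u0 r\<rbrakk> \<Longrightarrow> norm (chr c y w w - a) \<le> \<kappa>"
    using acceleration_box[OF c \<kappa>, of u0] unfolding a_def by metis
  have p: "?p \<in> half_space" by (rule chart_in_half_space[OF c])
  let ?K1 = "half_space \<inter> cball ?p r" and ?K2 = "cball u0 r"
  let ?F = "geodesic_field c ?K1 ?K2"
  have K: "closed ?K1" "?K1 \<noteq> {}" "closed ?K2" "?K2 \<noteq> {}"
    using r p by (auto intro: closed_Int closed_half_space)
  have accB: "norm (chr c y w w) \<le> norm a + \<kappa>" if "y \<in> ?K1" "w \<in> ?K2" for y w
    using near[OF that] norm_triangle_ineq[of a "chr c y w w - a"] by simp
  have accn: "\<kappa> \<le> chr c y w w $ ?n" if "y \<in> ?K1" "w \<in> ?K2" for y w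
  proof -
    have "\<bar>(chr c y w w - a) $ ?n\<bar> \<le> \<kappa>" using near[OF that] component_le_norm_cart order_trans by blast
    moreover have "a $ ?n = 2 * \<kappa>" by (simp add: \<kappa>_def)
    ultimately show ?thesis by simp
  qed
  have B0: "0 \<le> norm a + \<kappa>" using \<kappa> by (simp add: add_nonneg_nonneg)
  obtain T where T: "0 < T" and sol: "\<And>q v. \<lbrakk>q \<in> ball ?p (r/4); v \<in> ball u0 (r/4)\<rbrakk> \<Longrightarrow>
      \<exists>z. z 0 = (q, v) \<and>
        (\<forall>t\<in>{0..T}. (z has_vector_derivative ?F (z t)) (at t within {0..T}) \<and>
           fst (z t) \<in> ball ?p r \<and> snd (z t) \<in> ball u0 r \<and>
           norm (fst (z t) - q) \<le> (norm u0 + r) * t)"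
    using short_solutions[OF r p L lip B0 accB] by blast
  define \<delta> where "\<delta> = min (r / 4) (\<kappa> * T / 4)"
  have \<delta>: "0 < \<delta>" using r \<kappa> T by (simp add: \<delta>_def)
  show thesis
  proof (rule that[OF \<delta> \<kappa>])
    show "0 \<le> norm u0 + r" using r by simp
    fix x v
    assume x: "x \<in> fst c" and v: "v \<in> tangent_space A x" and xb: "snd c x $ ?n = 0"
      and xd: "norm (snd c x - ?p) < \<delta>" and vd: "norm (v c - u0) < \<delta>" and vn: "0 < v c $ ?n"
    have "snd c x \<in> ball ?p (r/4)" "v c \<in> ball u0 (r/4)"
      using xd vd by (auto simp: \<delta>_def dist_norm norm_minus_commute)
    from sol[OF this] obtain z where z0: "z 0 = (snd c x, v c)"
      and z: "\<And>t. t \<in> {0..T} \<Longrightarrow> (z has_vector_derivative ?F (z t)) (at t within {0..T})"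
      and zb: "\<And>t. t \<in> {0..T} \<Longrightarrow> fst (z t) \<in> ball ?p r" "\<And>t. t \<in> {0..T} \<Longrightarrow> snd (z t) \<in> ball u0 r"
      and zC: "\<And>t. t \<in> {0..T} \<Longrightarrow> norm (fst (z t) - snd c x) \<le> (norm u0 + r) * t" by blast
    define y where "y = (\<lambda>t. fst (z t))"
    define w where "w = (\<lambda>t. snd (z t))"
    define yn where "yn = (\<lambda>t. y t $ ?n)"
    define wn where "wn = (\<lambda>t. w t $ ?n)"
    have yd: "(y has_vector_derivative w t) (at t within {0..T})"
      and wd: "(w has_vector_derivative snd (?F (z t))) (at t within {0..T})" if "t \<in> {0..T}" for t
      using bounded_linear.has_vector_derivative[OF bounded_linear_fst z[OF that]]
        bounded_linear.has_vector_derivative[OF bounded_linear_snd z[OF that]]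
      by (simp_all add: geodesic_field_def y_def w_def)
    have ynd: "(yn has_real_derivative wn t) (at t within {0..T})" if "t \<in> {0..T}" for t
      using bounded_linear.has_vector_derivative[OF bounded_linear_vec_nth yd[OF that]]
      by (simp add: yn_def wn_def has_real_derivative_iff_has_vector_derivative)
    have wnd: "(wn has_real_derivative snd (?F (z t)) $ ?n) (at t within {0..T})" if "t \<in> {0..T}" for t
      using bounded_linear.has_vector_derivative[OF bounded_linear_vec_nth wd[OF that]]
      by (simp add: wn_def has_real_derivative_iff_has_vector_derivative)
    have Fn: "snd (?F zz) $ ?n \<le> - \<kappa>" for zz
      using accn[OF closest_point_in_set[OF K(1,2)] closest_point_in_set[OF K(3,4)]]
      by (simp add: geodesic_field_def)
    have yc: "continuous_on {0..T} y"
      using yd by (meson continuous_on_eq_continuous_within has_vector_derivative_continuous)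
    have ync: "continuous_on {0..T} yn" using yc unfolding yn_def by (intro continuous_intros)
    have wnc: "continuous_on {0..T} wn"
      using wnd by (meson continuous_on_eq_continuous_within DERIV_continuous)
    have yn0: "yn 0 = 0" and wn0: "wn 0 = v c $ ?n" using z0 xb by (auto simp: yn_def wn_def y_def w_def)
    have wdec: "wn t + \<kappa> * t \<le> wn s + \<kappa> * s" if st: "0 \<le> s" "s \<le> t" "t \<le> T" for s t
    proof (rule DERIV_nonpos_imp_decreasing_open[of s t "\<lambda>t. wn t + \<kappa> * t"])
      show "continuous_on {s..t} (\<lambda>t. wn t + \<kappa> * t)"
        by (intro continuous_intros continuous_on_subset[OF wnc]) (use st in auto)
      fix b assume b: "s < b" "b < t"
      then have "(wn has_real_derivative snd (?F (z b)) $ ?n) (at b)"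
        using wnd[of b] st by (simp add: at_within_Icc_at)
      then have "((\<lambda>t. wn t + \<kappa> * t) has_real_derivative snd (?F (z b)) $ ?n + \<kappa>) (at b)"
        by (auto intro!: derivative_eq_intros)
      moreover have "snd (?F (z b)) $ ?n + \<kappa> \<le> 0" using Fn[of "z b"] by linarith
      ultimately show "\<exists>d. ((\<lambda>t. wn t + \<kappa> * t) has_real_derivative d) (at b) \<and> d \<le> 0" by blast
    qed (use st in auto)
    have yle: "yn t \<le> v c $ ?n * t - \<kappa> * t\<^sup>2 / 2" if t: "0 \<le> t" "t \<le> T" for t
    proof -
      have "yn t - (v c $ ?n * t - \<kappa> * t\<^sup>2 / 2) \<le> yn 0 - (v c $ ?n * 0 - \<kappa> * 0\<^sup>2 / 2)"
      proof (rule DERIV_nonpos_imp_decreasing_open[of 0 t "\<lambda>t. yn t - (v c $ ?n * t - \<kappa> * t\<^sup>2 / 2)"])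
        show "continuous_on {0..t} (\<lambda>t. yn t - (v c $ ?n * t - \<kappa> * t\<^sup>2 / 2))"
          by (intro continuous_intros continuous_on_subset[OF ync]) (use t in auto)
        fix b assume b: "0 < b" "b < t"
        then have "(yn has_real_derivative wn b) (at b)"
          using ynd[of b] t by (simp add: at_within_Icc_at)
        then have "((\<lambda>t. yn t - (v c $ ?n * t - \<kappa> * t\<^sup>2 / 2)) has_real_derivative wn b - (v c $ ?n - \<kappa> * b)) (at b)"
          by (auto intro!: derivative_eq_intros)
        moreover have "wn b - (v c $ ?n - \<kappa> * b) \<le> 0" using wdec[of 0 b] b t wn0 by simp
        ultimately show "\<exists>d. ((\<lambda>t. yn t - (v c $ ?n * t - \<kappa> * t\<^sup>2 / 2)) has_real_derivative d) (at b) \<and> d \<le> 0" by blast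
      qed (use t in auto)
      then show ?thesis by (simp add: yn0)
    qed
    have mean: "\<exists>\<xi>. s < \<xi> \<and> \<xi> < t \<and> yn t - yn s = wn \<xi> * (t - s)" if st: "0 \<le> s" "s < t" "t \<le> T" for s t
    proof -
      have "\<exists>\<xi>\<in>{s<..<t}. yn t - yn s = (\<lambda>h. h * wn \<xi>) (t - s)"
      proof (rule mvt[OF st(2)])
        show "continuous_on {s..t} yn" by (rule continuous_on_subset[OF ync]) (use st in auto)
        fix b assume b: "s < b" "b < t"
        then show "(yn has_derivative (\<lambda>h. h * wn b)) (at b)"
          using ynd[of b] st by (simp add: at_within_Icc_at has_field_derivative_def mult_commute_abs)
      qed (use greaterThanLessThan_iff in blast)
      then show ?thesis by (auto simp: mult.commute)
    qed
    \<comment> \<open>The exit time: the last time at which the solution is in the half-space.\<close>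
    define S where "S = {0..T} \<inter> yn -` {0..}"
    have Sc: "closed S" unfolding S_def by (rule continuous_closed_preimage[OF ync]) auto
    have S0: "0 \<in> S" using T yn0 by (simp add: S_def)
    have Sb: "bdd_above S" by (rule bdd_aboveI[of _ T]) (simp add: S_def)
    define \<tau> where "\<tau> = Sup S"
    have \<tau>S: "\<tau> \<in> S" unfolding \<tau>_def using closed_contains_Sup[of S] S0 Sb Sc by blast
    have after: "yn t < 0" if "\<tau> < t" "t \<le> T" for t
    proof (rule ccontr)
      assume "\<not> yn t < 0"
      then have "t \<in> S" using that \<tau>S by (auto simp: S_def)
      then have "t \<le> \<tau>" unfolding \<tau>_def by (rule cSup_upper[OF _ Sb])
      then show False using that by simp
    qed
    have \<tau>0: "0 < \<tau>"
    proof -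
      obtain d where d: "0 < d" "\<And>h. 0 < h \<Longrightarrow> 0 + h \<in> {0..T} \<Longrightarrow> h < d \<Longrightarrow> yn 0 < yn (0 + h)"
        using has_real_derivative_pos_inc_right[OF ynd[of 0]] T vn wn0 by auto
      define h where "h = min (d / 2) T"
      have "0 < h" "h < d" "h \<le> T" using d T by (auto simp: h_def min_def)
      then have "h \<in> S" using d(2)[of h] yn0 by (simp add: S_def)
      then have "h \<le> \<tau>" unfolding \<tau>_def by (rule cSup_upper[OF _ Sb])
      then show ?thesis using \<open>0 < h\<close> by simp
    qed
    have \<tau>T: "\<tau> \<le> T" "0 \<le> yn \<tau>" using \<tau>S by (auto simp: S_def)
    have \<tau>\<kappa>: "\<kappa> * \<tau> \<le> 2 * v c $ ?n"
    proof -
      have "0 \<le> v c $ ?n * \<tau> - \<kappa> * \<tau>\<^sup>2 / 2" using yle[of \<tau>] \<tau>T \<tau>0 by simp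
      then have "\<tau> * (\<kappa> * \<tau>) \<le> \<tau> * (2 * v c $ ?n)" by (simp add: power2_eq_square algebra_simps)
      then show ?thesis using \<tau>0 by simp
    qed
    have \<tau>ltT: "\<tau> < T"
    proof -
      have "v c $ ?n = (v c - u0) $ ?n" using u0 by simp
      also have "\<dots> \<le> norm (v c - u0)" using component_le_norm_cart[of "v c - u0" ?n] by simp
      also have "\<dots> < \<kappa> * T / 4" using vd by (simp add: \<delta>_def)
      finally have "2 * v c $ ?n < \<kappa> * T" using vn by linarith
      then have "\<kappa> * \<tau> < \<kappa> * T" using \<tau>\<kappa> by linarith
      then show ?thesis using \<kappa> by simp
    qed
    \<comment> \<open>Strict concavity: otherwise the mean value theorem would give a nonpositive slope followed by a
      nonnegative one.\<close>
    have pos: "0 < yn t" if t: "0 < t" "t < \<tau>" for t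
    proof (rule ccontr)
      assume "\<not> 0 < yn t"
      then have le: "yn t \<le> 0" by simp
      obtain \<xi>1 where \<xi>1: "0 < \<xi>1" "\<xi>1 < t" "yn t - yn 0 = wn \<xi>1 * (t - 0)" using mean[of 0 t] t \<tau>T by auto
      obtain \<xi>2 where \<xi>2: "t < \<xi>2" "\<xi>2 < \<tau>" "yn \<tau> - yn t = wn \<xi>2 * (\<tau> - t)" using mean[of t \<tau>] t \<tau>T by auto
      have "wn \<xi>1 * t \<le> 0" using \<xi>1 le yn0 by simp
      then have "wn \<xi>1 \<le> 0" using t(1) by (simp add: mult_le_0_iff)
      moreover have "0 \<le> wn \<xi>2 * (\<tau> - t)" using \<xi>2 le \<tau>T by simp
      then have "0 \<le> wn \<xi>2" using t(2) by (simp add: zero_le_mult_iff)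
      moreover have "wn \<xi>2 + \<kappa> * \<xi>2 \<le> wn \<xi>1 + \<kappa> * \<xi>1" using wdec[of \<xi>1 \<xi>2] \<xi>1 \<xi>2 \<tau>T by auto
      moreover have "\<kappa> * \<xi>1 < \<kappa> * \<xi>2" using \<kappa> \<xi>1 \<xi>2 by simp
      ultimately show False by linarith
    qed
    have yin: "y t \<in> ?K1" if t: "t \<in> {0..\<tau>}" for t
    proof -
      have "0 \<le> yn t" using pos[of t] yn0 \<tau>T(2) t by (cases "t = 0 \<or> t = \<tau>") (auto simp: less_imp_le)
      then show ?thesis using zb(1)[of t] t \<tau>T by (auto simp: yn_def y_def half_space_def less_imp_le)
    qed
    have win: "w t \<in> ?K2" if "t \<in> {0..\<tau>}" for t using zb(2)[of t] that \<tau>T by (auto simp: w_def less_imp_le)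
    let ?\<gamma> = "\<lambda>t. chart_inv c (y t)"
    let ?W = "\<lambda>t. coord_vector A (chart_inv c (y t)) c (w t)"
    have geo: "geodesic_from M A g (x, v) {0..t1} ?\<gamma>" if t1: "0 \<le> t1" "t1 \<le> \<tau>" for t1
      unfolding geodesic_from_def
    proof (intro exI[of _ ?W] conjI)
      have sub: "{0..t1} \<subseteq> {0..T}" using t1 \<tau>T by auto
      show "geodesic_on M A g {0..t1} ?\<gamma> ?W"
      proof (rule geodesic_of_coords[OF c(1)])
        fix t assume t: "t \<in> {0..t1}"
        then have t': "t \<in> {0..\<tau>}" "t \<in> {0..T}" using t1 \<tau>T by auto
        show "y t \<in> chart_image c" using yin[OF t'(1)] box by blast
        show "(y has_vector_derivative w t) (at t within {0..t1})"
          by (rule has_vector_derivative_within_subset[OF yd[OF t'(2)] sub])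
        have "snd (?F (z t)) = - chr c (y t) (w t) (w t)"
          using geodesic_field_inside[of "z t" ?K1 ?K2 c] yin[OF t'(1)] win[OF t'(1)] by (simp add: y_def w_def)
        then show "(w has_vector_derivative - chr c (y t) (w t) (w t)) (at t within {0..t1})"
          using has_vector_derivative_within_subset[OF wd[OF t'(2)] sub] by simp
      qed
      have "y 0 = snd c x" "w 0 = v c" using z0 by (auto simp: y_def w_def)
      then show "(?\<gamma> 0, ?W 0) = (x, v)" using c(1) x coord_vector_of_tangent[OF v c(1) x] by simp
    qed
    have follow: "\<gamma> t \<in> fst c \<and> snd c (\<gamma> t) = y t"
      if g1: "geodesic_from M A g (x, v) {0..T1} \<gamma>" and T1: "0 \<le> T1" and tt: "t \<in> {0..min T1 T}" for T1 \<gamma> t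
    proof -
      obtain W where W: "geodesic_on M A g {0..T1} \<gamma> W" "\<gamma> 0 = x" "W 0 = v"
        using g1 unfolding geodesic_from_def prod.inject by blast
      have "\<gamma> t \<in> fst c \<and> (snd c (\<gamma> t), W t c) = z t"
        by (rule geodesic_follows_solution[OF c(1) r box p L lip z zb _ T1 W(1) _ _ tt])
          (use T x W z0 in auto)
      then show ?thesis unfolding y_def by (metis fst_conv)
    qed
    have set: "{T1. 0 \<le> T1 \<and> (\<exists>\<gamma>. geodesic_from M A g (x, v) {0..T1} \<gamma>)} = {0..\<tau>}"
    proof (intro set_eqI iffI)
      fix T1 assume "T1 \<in> {0..\<tau>}"
      then show "T1 \<in> {T1. 0 \<le> T1 \<and> (\<exists>\<gamma>. geodesic_from M A g (x, v) {0..T1} \<gamma>)}" using geo by auto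
    next
      fix T1 assume "T1 \<in> {T1. 0 \<le> T1 \<and> (\<exists>\<gamma>. geodesic_from M A g (x, v) {0..T1} \<gamma>)}"
      then obtain \<gamma> where g: "0 \<le> T1" "geodesic_from M A g (x, v) {0..T1} \<gamma>" by blast
      show "T1 \<in> {0..\<tau>}"
      proof (rule ccontr)
        assume "T1 \<notin> {0..\<tau>}"
        define t where "t = min T1 T"
        have t: "\<tau> < t" "t \<le> T" "t \<in> {0..min T1 T}" using \<open>T1 \<notin> {0..\<tau>}\<close> g(1) \<tau>ltT T by (auto simp: t_def)
        have "\<gamma> t \<in> fst c" "snd c (\<gamma> t) = y t" using follow[OF g(2,1) t(3)] by auto
        then have "y t \<in> half_space" using chart_in_half_space[OF c(1)] by metis
        then show False using after[OF t(1,2)] by (simp add: yn_def half_space_def)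
      qed
    qed
    have exit: "forward_exit_time M A g (x, v) = ereal \<tau>"
      unfolding forward_exit_time_def set
    proof (rule antisym)
      show "Sup (ereal ` {0..\<tau>}) \<le> ereal \<tau>" by (rule Sup_least) auto
      show "ereal \<tau> \<le> Sup (ereal ` {0..\<tau>})" by (rule Sup_upper) (use \<tau>0 in auto)
    qed
    have pt: "geodesic_point M A g (x, v) t = ?\<gamma> t" if t: "t \<in> {0..\<tau>}" for t
    proof -
      have seg: "closed_segment 0 t = {0..t}" using t by (simp add: closed_segment_eq_real_ivl)
      show ?thesis unfolding geodesic_point_def seg
      proof (rule the_equality)
        show "\<exists>\<gamma>. geodesic_from M A g (x, v) {0..t} \<gamma> \<and> \<gamma> t = ?\<gamma> t" using geo[of t] t by auto
        fix x' assume "\<exists>\<gamma>. geodesic_from M A g (x, v) {0..t} \<gamma> \<and> \<gamma> t = x'"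
        then obtain \<gamma> where g: "geodesic_from M A g (x, v) {0..t} \<gamma>" "\<gamma> t = x'" by blast
        have "\<gamma> t \<in> fst c \<and> snd c (\<gamma> t) = y t" by (rule follow[OF g(1)]) (use t \<tau>T in auto)
        then show "x' = ?\<gamma> t" using g(2) c(1) by (metis chart_inv_left)
      qed
    qed
    show "\<exists>\<tau> y. 0 < \<tau> \<and> \<kappa> * \<tau> \<le> 2 * v c $ ?n \<and> forward_exit_time M A g (x, v) = ereal \<tau> \<and>
        continuous_on {0..\<tau>} y \<and>
        (\<forall>t\<in>{0..\<tau>}. y t \<in> chart_image c \<and> geodesic_point M A g (x, v) t = chart_inv c (y t) \<and>
           norm (y t - snd c x) \<le> (norm u0 + r) * t) \<and>
        (\<forall>t. 0 < t \<and> t < \<tau> \<longrightarrow> 0 < y t $ ?n)"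
    proof (intro exI[of _ \<tau>] exI[of _ y] conjI ballI allI impI)
      show "continuous_on {0..\<tau>} y" by (rule continuous_on_subset[OF yc]) (use \<tau>T in auto)
      fix t assume t: "t \<in> {0..\<tau>}"
      show "y t \<in> chart_image c" using yin[OF t] box by blast
      show "norm (y t - snd c x) \<le> (norm u0 + r) * t" using zC[of t] t \<tau>T by (simp add: y_def)
    qed (use \<tau>0 \<tau>\<kappa> exit pt pos in \<open>auto simp: yn_def\<close>)
  qed
qed

end

section \<open>Scattering data along short geodesics\<close>

lemma linear_ode_backward_unique:
  fixes A U V :: "real \<Rightarrow> complex^'N^'N::finite"
  assumes \<tau>: "0 \<le> \<tau>" and K: "\<And>t. t \<in> {0..\<tau>} \<Longrightarrow> norm (A t) \<le> K"
    and U: "\<And>t. t \<in> {0..\<tau>} \<Longrightarrow> (U has_vector_derivative - (A t ** U t)) (at t within {0..\<tau>})"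
    and V: "\<And>t. t \<in> {0..\<tau>} \<Longrightarrow> (V has_vector_derivative - (A t ** V t)) (at t within {0..\<tau>})"
    and eq: "U \<tau> = V \<tau>"
  shows "U 0 = V 0"
proof -
  interpret mm: bounded_bilinear "(**) :: complex^'N^'N::finite \<Rightarrow> complex^'N^'N \<Rightarrow> complex^'N^'N"
    by (rule bounded_bilinear_matrix_mult)
  obtain \<kappa> where \<kappa>: "0 < \<kappa>"
    "\<And>(A :: complex^'N^'N) B :: complex^'N^'N. norm (A ** B) \<le> \<kappa> * norm A * norm B"
    by (rule matrix_mult_norm_bound) blast
  have rev: "((\<lambda>s. X (\<tau> - s)) has_vector_derivative A (\<tau> - s) ** X (\<tau> - s)) (at s within {0..\<tau>})"
    if X: "\<And>t. t \<in> {0..\<tau>} \<Longrightarrow> (X has_vector_derivative - (A t ** X t)) (at t within {0..\<tau>})" and s: "s \<in> {0..\<tau>}"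
    for X :: "real \<Rightarrow> complex^'N^'N" and s
  proof -
    have "((\<lambda>t. \<tau> - t) has_vector_derivative -1) (at s within {0..\<tau>})"
      by (auto intro!: derivative_eq_intros)
    moreover have "(X has_vector_derivative - (A (\<tau> - s) ** X (\<tau> - s))) (at (\<tau> - s) within (\<lambda>t. \<tau> - t) ` {0..\<tau>})"
      by (rule has_vector_derivative_within_subset[OF X]) (use s in auto)
    ultimately have "(X \<circ> (\<lambda>t. \<tau> - t) has_vector_derivative (-1) *\<^sub>R - (A (\<tau> - s) ** X (\<tau> - s))) (at s within {0..\<tau>})"
      by (rule vector_diff_chain_within)
    then show ?thesis by (simp add: o_def)
  qed
  have "U (\<tau> - \<tau>) = V (\<tau> - \<tau>)"
  proof (rule ode_unique[where x = "\<lambda>s. U (\<tau> - s)" and y = "\<lambda>s. V (\<tau> - s)"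
        and f = "\<lambda>s X. A (\<tau> - s) ** X" and a = 0 and b = \<tau> and L = "\<kappa> * K" and t = \<tau>])
    fix s assume s: "s \<in> {0..\<tau>}"
    show "((\<lambda>s. U (\<tau> - s)) has_vector_derivative A (\<tau> - s) ** U (\<tau> - s)) (at s within {0..\<tau>})" by (rule rev[OF U s])
    show "((\<lambda>s. V (\<tau> - s)) has_vector_derivative A (\<tau> - s) ** V (\<tau> - s)) (at s within {0..\<tau>})" by (rule rev[OF V s])
    have "norm (A (\<tau> - s) ** U (\<tau> - s) - A (\<tau> - s) ** V (\<tau> - s)) \<le> \<kappa> * norm (A (\<tau> - s)) * norm (U (\<tau> - s) - V (\<tau> - s))"
      unfolding mm.diff_right[symmetric] by (rule \<kappa>(2))
    also have "\<dots> \<le> \<kappa> * K * norm (U (\<tau> - s) - V (\<tau> - s))"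
      using \<kappa>(1) K[of "\<tau> - s"] s by (intro mult_right_mono mult_left_mono) auto
    finally show "norm (A (\<tau> - s) ** U (\<tau> - s) - A (\<tau> - s) ** V (\<tau> - s)) \<le> \<kappa> * K * norm (U (\<tau> - s) - V (\<tau> - s))" .
  qed (use eq \<tau> in auto)
  then show ?thesis by simp
qed

text \<open>
  Uniqueness of the solution identifies the definite description with the initial value of a solution
  found by other means.
\<close>

lemma scattering_data_eq:
  fixes \<Phi> :: "'m \<Rightarrow> complex^'N^'N::finite" and A :: "('m, 'n::finite) chart set"
  assumes \<tau>: "0 \<le> \<tau>" "forward_exit_time M A g z = ereal \<tau>"
    and pt: "\<And>t. t \<in> {0..\<tau>} \<Longrightarrow> \<Phi> (geodesic_point M A g z t) = B t"
    and K: "\<And>t. t \<in> {0..\<tau>} \<Longrightarrow> norm (B t) \<le> K"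
    and U: "U \<tau> = mat 1" "\<And>t. t \<in> {0..\<tau>} \<Longrightarrow> (U has_vector_derivative - (B t ** U t)) (at t within {0..\<tau>})"
      "\<And>t. t \<in> {0..\<tau>} \<Longrightarrow> invertible (U t)"
  shows "scattering_data M A g \<Phi> z = U 0"
  unfolding scattering_data_def \<tau>(2) Let_def real_of_ereal.simps
proof (rule the_equality)
  show "\<exists>V. (\<forall>t\<in>{0..\<tau>}. invertible (V t) \<and>
      (V has_vector_derivative - (\<Phi> (geodesic_point M A g z t) ** V t)) (at t within {0..\<tau>})) \<and>
      V \<tau> = mat 1 \<and> U 0 = V 0"
    by (rule exI[of _ U]) (simp add: U pt)
  fix C assume "\<exists>V. (\<forall>t\<in>{0..\<tau>}. invertible (V t) \<and>
      (V has_vector_derivative - (\<Phi> (geodesic_point M A g z t) ** V t)) (at t within {0..\<tau>})) \<and>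
      V \<tau> = mat 1 \<and> C = V 0"
  then obtain V where V': "\<forall>t\<in>{0..\<tau>}. invertible (V t) \<and>
      (V has_vector_derivative - (\<Phi> (geodesic_point M A g z t) ** V t)) (at t within {0..\<tau>})"
    and V: "V \<tau> = mat 1" "C = V 0" by blast
  have Vd: "(V has_vector_derivative - (B t ** V t)) (at t within {0..\<tau>})" if "t \<in> {0..\<tau>}" for t
    using bspec[OF V' that] unfolding pt[OF that] by blast
  have "V 0 = U 0" by (rule linear_ode_backward_unique[OF \<tau>(1) K Vd U(2)]) (simp_all add: V U)
  then show "C = U 0" using V by simp
qed

lemma psum_diff:
  fixes a b :: "('n::finite \<Rightarrow> nat) \<Rightarrow> 'b::banach"
  assumes "converges r a" "converges r b"
  shows "converges r (\<lambda>\<alpha>. a \<alpha> - b \<alpha>)"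
    and "x \<in> ball 0 r \<Longrightarrow> psum (\<lambda>\<alpha>. a \<alpha> - b \<alpha>) x = psum a x - psum b x"
proof -
  have main: "((\<lambda>\<alpha>. monomial \<alpha> x *\<^sub>R (a \<alpha> - b \<alpha>)) has_sum (psum a x - psum b x)) UNIV" if "x \<in> ball 0 r" for x
  proof -
    have "((\<lambda>\<alpha>. monomial \<alpha> x *\<^sub>R a \<alpha>) has_sum psum a x) UNIV" "((\<lambda>\<alpha>. monomial \<alpha> x *\<^sub>R b \<alpha>) has_sum psum b x) UNIV"
      using assms that by (auto simp: converges_def psum_def)
    then have "((\<lambda>\<alpha>. monomial \<alpha> x *\<^sub>R a \<alpha> + - (monomial \<alpha> x *\<^sub>R b \<alpha>)) has_sum (psum a x + - psum b x)) UNIV"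
      by (intro has_sum_add) (simp_all add: has_sum_uminus)
    then show ?thesis by (simp add: scaleR_diff_right)
  qed
  show "converges r (\<lambda>\<alpha>. a \<alpha> - b \<alpha>)"
    unfolding converges_def summable_on_def using main converges_radius_pos[OF assms(1)] by blast
  show "x \<in> ball 0 r \<Longrightarrow> psum (\<lambda>\<alpha>. a \<alpha> - b \<alpha>) x = psum a x - psum b x"
    using main unfolding psum_def by (intro infsumI) simp
qed

lemma isCont_psum:
  fixes a :: "('n::finite \<Rightarrow> nat) \<Rightarrow> 'b::banach"
  assumes "converges r a" "x \<in> ball p r"
  shows "isCont (\<lambda>y. psum a (y - p)) x"
  using has_derivative_psum'[OF assms] has_derivative_continuous by blast

lemma isCont_dsum:
  fixes a :: "('n::finite \<Rightarrow> nat) \<Rightarrow> 'b::banach"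
  assumes "converges r a"
  shows "isCont (\<lambda>z. dsum a (fst z - p) (snd z)) (p, u)"
proof -
  have "isCont (\<lambda>z. psum (coeff_deriv i a) (fst z - p)) (p, u)" for i
    using isCont_o2[of "(p, u)" fst "\<lambda>y. psum (coeff_deriv i a) (y - p)"]
      isCont_psum[OF converges_coeff_deriv[OF assms], of p p i] converges_radius_pos[OF assms]
    by (simp add: isCont_fst)
  then show ?thesis unfolding dsum_def by (intro continuous_intros) auto
qed

context analytic_riemannian
begin

section \<open>Initial data near a glancing direction\<close>

text \<open>
  The topology of the tangent bundle is generated by open sets in the coordinates of all charts; by
  continuity of the coordinate changes and of their differentials, each of these sets contains a
  neighbourhood in the coordinates of the chart \<open>c\<close>.
\<close>

lemma tangent_bundle_neighborhood:
  assumes c: "c \<in> A" "x0 \<in> fst c" and v0: "v0 \<in> tangent_space A x0"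
    and W: "openin (tangent_bundle_topology A) W" "(x0, v0) \<in> W"
  shows "\<exists>\<epsilon>>0. \<forall>x v. x \<in> fst c \<and> v \<in> tangent_space A x \<and> norm (snd c x - snd c x0) < \<epsilon> \<and>
    norm (v c - v0 c) < \<epsilon> \<longrightarrow> (x, v) \<in> W"
proof -
  have "generate_topology_on {{(x, v). x \<in> fst c \<and> v \<in> tangent_space A x \<and> (snd c x, v c) \<in> W} | c W.
          c \<in> A \<and> open W} W"
    using W(1) unfolding tangent_bundle_topology_def openin_topology_generated_by_iff .
  then show ?thesis using W(2)
  proof induction
    case Empty then show ?case by simp
  next
    case (Int a b)
    then obtain e1 e2 where e: "0 < e1" "0 < e2"
      "\<And>x v. x \<in> fst c \<Longrightarrow> v \<in> tangent_space A x \<Longrightarrow> norm (snd c x - snd c x0) < e1 \<Longrightarrow> norm (v c - v0 c) < e1 \<Longrightarrow> (x, v) \<in> a"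
      "\<And>x v. x \<in> fst c \<Longrightarrow> v \<in> tangent_space A x \<Longrightarrow> norm (snd c x - snd c x0) < e2 \<Longrightarrow> norm (v c - v0 c) < e2 \<Longrightarrow> (x, v) \<in> b"
      by blast
    then show ?case by (intro exI[of _ "min e1 e2"]) auto
  next
    case (UN \<K>)
    then obtain k where "k \<in> \<K>" "(x0, v0) \<in> k" by blast
    with UN.IH[of k] show ?case by blast
  next
    case (Basis s)
    then obtain d O' where s: "s = {(x, v). x \<in> fst d \<and> v \<in> tangent_space A x \<and> (snd d x, v d) \<in> O'}"
      and d: "d \<in> A" "open O'" by blast
    have x0d: "x0 \<in> fst d" and O0: "(snd d x0, v0 d) \<in> O'" using Basis(2) s by auto
    let ?p = "snd c x0"
    obtain r a where ra: "converges r a" and rx: "\<And>x'. x' \<in> fst c \<Longrightarrow> snd c x' \<in> ball ?p r \<Longrightarrow>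
       x' \<in> fst d \<and> snd d x' = psum a (snd c x' - ?p) \<and> transition_deriv c d x' = dsum a (snd c x' - ?p)"
      by (rule coord_change_series[OF c(1) d(1) c(2) x0d]) blast
    have r0: "0 < r" by (rule converges_radius_pos[OF ra])
    define \<Theta> where "\<Theta> = (\<lambda>z. (psum a (fst z - ?p), dsum a (fst z - ?p) (snd z)))"
    have "isCont (\<lambda>z. psum a (fst z - ?p)) (?p, v0 c)"
      using isCont_o2[of "(?p, v0 c)" fst "\<lambda>y. psum a (y - ?p)"] isCont_psum[OF ra, of ?p ?p] r0 by (simp add: isCont_fst)
    then have "isCont \<Theta> (?p, v0 c)" unfolding \<Theta>_def by (intro isCont_Pair isCont_dsum[OF ra])
    moreover have "\<Theta> (?p, v0 c) = (snd d x0, v0 d)"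
      using rx[OF c(2)] r0 tangent_space_change[OF v0 c d(1) x0d] by (simp add: \<Theta>_def)
    ultimately have "(\<Theta> \<longlongrightarrow> (snd d x0, v0 d)) (nhds (?p, v0 c))"
      unfolding isCont_def tendsto_at_iff_tendsto_nhds by simp
    from topological_tendstoD[OF this d(2) O0]
    have "eventually (\<lambda>z. \<Theta> z \<in> O') (nhds (?p, v0 c))" .
    then obtain e where e: "0 < e" "\<And>z. dist z (?p, v0 c) < e \<Longrightarrow> \<Theta> z \<in> O'"
      unfolding eventually_nhds_metric by blast
    show ?case
    proof (intro exI[of _ "min r (e / 2)"] conjI allI impI)
      show "0 < min r (e / 2)" using r0 e by simp
      fix x v assume "x \<in> fst c \<and> v \<in> tangent_space A x \<and> norm (snd c x - ?p) < min r (e / 2) \<and> norm (v c - v0 c) < min r (e / 2)"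
      then have x: "x \<in> fst c" and v: "v \<in> tangent_space A x" and nr: "norm (snd c x - ?p) < r"
        and n1: "norm (snd c x - ?p) < e / 2" and n2: "norm (v c - v0 c) < e / 2" by auto
      have "snd c x \<in> ball ?p r" using nr by (simp add: dist_norm norm_minus_commute)
      note rr = rx[OF x this]
      have "dist (snd c x, v c) (?p, v0 c) \<le> norm (snd c x - ?p) + norm (v c - v0 c)"
        unfolding dist_norm diff_Pair by (rule norm_Pair_le)
      then have "dist (snd c x, v c) (?p, v0 c) < e" using n1 n2 by linarith
      from e(2)[OF this] have "(snd d x, dsum a (snd c x - ?p) (v c)) \<in> O'" using rr by (simp add: \<Theta>_def)
      moreover have "v d = dsum a (snd c x - ?p) (v c)" using tangent_space_change[OF v c(1) x d(1)] rr by simp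
      ultimately show "(x, v) \<in> s" using s rr v by simp
    qed
  qed
qed

lemma metric_inward_normal:
  assumes c: "c \<in> A" "x \<in> fst c" and bd: "snd c x $ normal_index = 0"
  obtains \<mu> where "0 < \<mu>" "\<And>v. v \<in> tangent_space A x \<Longrightarrow> g x v (inward_normal A g x) = \<mu> * v c $ normal_index"
proof -
  obtain \<mu> where \<mu>: "0 < \<mu>" "\<And>w. gform (gmat c (snd c x)) (normal_coords c (snd c x)) w = \<mu> * w $ normal_index"
    using normal_coords_props[OF c] by metis
  show thesis
  proof (rule that[OF \<mu>(1)])
    fix v assume v: "v \<in> tangent_space A x"
    have "g x v (inward_normal A g x) = gform (gmat c (snd c x)) (v c) (normal_coords c (snd c x))"
      unfolding inward_normal_eq[OF c bd]
      using metric_in_coords[OF c v coord_vector_in_tangent_space[OF c]] c by simp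
    also have "\<dots> = \<mu> * v c $ normal_index"
      unfolding gform_commute[OF gmat_posdef[OF c], of "v c"] by (rule \<mu>(2))
    finally show "g x v (inward_normal A g x) = \<mu> * v c $ normal_index" .
  qed
qed

lemma inward_boundaryI:
  assumes c: "c \<in> A" "x \<in> fst c" and bd: "snd c x $ normal_index = 0"
    and v: "v \<in> tangent_space A x" "g x v v = 1" "0 \<le> v c $ normal_index"
  shows "(x, v) \<in> inward_boundary M A g"
proof -
  obtain \<mu> where "0 < \<mu>" "g x v (inward_normal A g x) = \<mu> * v c $ normal_index"
    using metric_inward_normal[OF c bd] v(1) by metis
  then show ?thesis
    using v c chart_domain_subset[OF c(1)] mfd_boundary_iff[OF c] bd
    by (auto simp: inward_boundary_def unit_tangent_bundle_def)
qed

text \<open>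
  The inequalities that define the two parts of the boundary force \<open>g(v, \<nu>) = 0\<close>.
\<close>

lemma glancing_coords:
  assumes c: "c \<in> A" "x \<in> fst c" and z: "(x, v) \<in> glancing_boundary M A g"
  shows "snd c x $ normal_index = 0" "v \<in> tangent_space A x" "g x v v = 1" "v c $ normal_index = 0"
proof -
  have *: "v \<in> tangent_space A x" "g x v v = 1" "x \<in> mfd_boundary M A" "g x v (inward_normal A g x) = 0"
    using z by (auto simp: glancing_boundary_def inward_boundary_def outward_boundary_def unit_tangent_bundle_def)
  show bd: "snd c x $ normal_index = 0" using * mfd_boundary_iff[OF c] by simp
  show "v \<in> tangent_space A x" "g x v v = 1" by (rule *)+
  obtain \<mu> where "0 < \<mu>" "g x v (inward_normal A g x) = \<mu> * v c $ normal_index"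
    using metric_inward_normal[OF c bd] *(1) by metis
  then show "v c $ normal_index = 0" using *(4) by simp
qed

text \<open>
  Add a small multiple of the normal coordinate vector to the coordinates of \<open>v0\<close> and normalise in the metric
  at \<open>x\<close>. The size of the multiple can be chosen after \<open>x\<close>.
\<close>

lemma slightly_inward_vectors:
  assumes c: "c \<in> A" "x0 \<in> fst c" and v0: "v0 \<in> tangent_space A x0" "g x0 v0 v0 = 1" "v0 c $ normal_index = 0"
    and \<epsilon>: "0 < \<epsilon>"
  obtains \<delta> where "0 < \<delta>"
    "\<And>x \<eta>. \<lbrakk>x \<in> fst c; snd c x $ normal_index = 0; norm (snd c x - snd c x0) < \<delta>; 0 < \<eta>\<rbrakk> \<Longrightarrow>
      \<exists>v\<in>tangent_space A x. g x v v = 1 \<and> norm (v c - v0 c) < \<epsilon> \<and> 0 < v c $ normal_index \<and> v c $ normal_index < \<eta>"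
proof -
  let ?p = "snd c x0" and ?n = "normal_index :: 'n"
  obtain r b where r: "converges r b" "half_space \<inter> ball ?p r \<subseteq> chart_image c"
    "\<And>y. y \<in> half_space \<inter> ball ?p r \<Longrightarrow> gmat c y = psum b (y - ?p)"
    by (rule metric_series[OF c]) blast
  have r0: "0 < r" by (rule converges_radius_pos[OF r(1)])
  have ph: "?p \<in> half_space" by (rule chart_in_half_space[OF c])
  define u where "u = (\<lambda>s. v0 c + s *\<^sub>R axis ?n 1)"
  define q where "q = (\<lambda>z::(real^'n) \<times> real. gform (psum b (fst z - ?p)) (u (snd z)) (u (snd z)))"
  define f where "f = (\<lambda>z. inverse (sqrt (q z)) *\<^sub>R u (snd z))"
  have q0: "q (?p, 0) = 1"
    using metric_in_coords[OF c v0(1) v0(1)] v0(2) r(3)[of ?p] ph r0 by (simp add: q_def u_def)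
  have cu: "isCont (\<lambda>z::(real^'n) \<times> real. u (snd z)) (?p, 0)" unfolding u_def by (intro continuous_intros)
  have cb: "isCont (\<lambda>z::(real^'n) \<times> real. psum b (fst z - ?p)) (?p, 0)"
    using isCont_o2[of "(?p, 0::real)" fst "\<lambda>y. psum b (y - ?p)"] isCont_psum[OF r(1), of ?p ?p] r0 by (simp add: isCont_fst)
  have cq: "isCont q (?p, 0)"
    unfolding q_def gform_def
    by (intro continuous_inner cu bounded_bilinear.continuous[OF bounded_bilinear_matrix_vector_real] cb)
  have cf: "isCont f (?p, 0)"
    unfolding f_def by (intro continuous_scaleR cu continuous_at_within_inverse continuous_real_sqrt cq) (simp add: q0)
  have f0: "f (?p, 0) = v0 c" by (simp add: f_def q0 u_def)
  have "(f \<longlongrightarrow> v0 c) (nhds (?p, 0))"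
    using cf[unfolded isCont_def tendsto_at_iff_tendsto_nhds] by (simp only: f0)
  from tendstoD[OF this \<epsilon>] have "eventually (\<lambda>z. dist (f z) (v0 c) < \<epsilon>) (nhds (?p, 0))" .
  moreover have "(q \<longlongrightarrow> 1) (nhds (?p, 0))"
    using cq[unfolded isCont_def tendsto_at_iff_tendsto_nhds] by (simp only: q0)
  from topological_tendstoD[OF this, of "{1/4<..}"]
  have "eventually (\<lambda>z. q z \<in> {1/4<..}) (nhds (?p, 0))" by simp
  ultimately have "eventually (\<lambda>z. dist (f z) (v0 c) < \<epsilon> \<and> q z \<in> {1/4<..}) (nhds (?p, 0))" by (rule eventually_conj)
  then obtain e where e: "0 < e" "\<And>z. dist z (?p, 0) < e \<Longrightarrow> dist (f z) (v0 c) < \<epsilon> \<and> 1/4 < q z"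
    unfolding eventually_nhds_metric by auto
  show thesis
  proof (rule that[of "min r (e / 2)"])
    show "0 < min r (e / 2)" using r0 e by simp
    fix x and \<eta> :: real
    assume x: "x \<in> fst c" and bd: "snd c x $ ?n = 0" and xd: "norm (snd c x - ?p) < min r (e / 2)" and \<eta>: "0 < \<eta>"
    define s where "s = min (e / 4) (\<eta> / 4)"
    have s: "0 < s" "s < e / 2" "2 * s < \<eta>" using e(1) \<eta> by (auto simp: s_def min_def)
    have "dist (snd c x, s) (?p, 0) \<le> norm (snd c x - ?p) + norm (s - 0)"
      unfolding dist_norm diff_Pair by (rule norm_Pair_le)
    then have "dist (snd c x, s) (?p, 0) < e" using xd s by simp
    from e(2)[OF this] have fz: "norm (f (snd c x, s) - v0 c) < \<epsilon>" and qz: "1/4 < q (snd c x, s)" by (auto simp: dist_norm)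
    define Q where "Q = q (snd c x, s)"
    have sx: "snd c x \<in> half_space \<inter> ball ?p r" using chart_in_half_space[OF c(1) x] xd by (simp add: dist_norm norm_minus_commute)
    have Q: "Q = gform (gmat c (snd c x)) (u s) (u s)" using r(3)[OF sx] by (simp add: Q_def q_def)
    have fe: "f (snd c x, s) = inverse (sqrt Q) *\<^sub>R u s" by (simp add: f_def Q_def)
    have sq: "1/2 \<le> sqrt Q" using qz real_le_rsqrt[of "1/2" Q] by (simp add: Q_def power2_eq_square)
    have un: "u s $ ?n = s" using v0(3) by (simp add: u_def)
    define v where "v = coord_vector A x c (f (snd c x, s))"
    have vT: "v \<in> tangent_space A x" unfolding v_def by (rule coord_vector_in_tangent_space[OF c(1) x])
    have vc: "v c = inverse (sqrt Q) *\<^sub>R u s" unfolding v_def fe using coord_vector_self[OF c(1) x] by simp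
    have "g x v v = inverse (sqrt Q) * (inverse (sqrt Q) * Q)"
      using metric_in_coords[OF c(1) x vT vT] by (simp add: vc gform_simps Q)
    also have "\<dots> = Q / (sqrt Q)\<^sup>2" by (simp add: power2_eq_square field_simps)
    also have "\<dots> = 1" using qz by (simp add: Q_def)
    finally have "g x v v = 1" .
    moreover have "norm (v c - v0 c) < \<epsilon>" using fz by (simp add: vc fe)
    moreover have "0 < sqrt Q" using sq by linarith
    then have "0 < v c $ ?n" unfolding vc using s un by simp
    moreover have "v c $ ?n < \<eta>"
    proof -
      have "inverse (sqrt Q) \<le> inverse (1/2)" using sq by (intro le_imp_inverse_le) auto
      then have "inverse (sqrt Q) \<le> 2" by simp
      from mult_right_mono[OF this, of s] have "inverse (sqrt Q) * s \<le> 2 * s" using s(1) by simp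
      also have "\<dots> < \<eta>" by (rule s(3))
      finally show ?thesis by (simp add: vc un)
    qed
    ultimately show "\<exists>v\<in>tangent_space A x. g x v v = 1 \<and> norm (v c - v0 c) < \<epsilon> \<and> 0 < v c $ ?n \<and> v c $ ?n < \<eta>"
      using vT by blast
  qed
qed

section \<open>Identity theorem on the manifold\<close>

lemma chart_ball_openin:
  assumes "c \<in> A" shows "openin M {x \<in> fst c. snd c x \<in> ball p r}"
proof -
  have "openin (subtopology M (fst c)) {x \<in> topspace (subtopology M (fst c)). snd c x \<in> ball p r}"
    by (rule openin_continuous_map_preimage[OF chart_continuous[OF assms]]) simp
  then have "openin (subtopology M (fst c)) {x \<in> fst c. snd c x \<in> ball p r}"
    unfolding topspace_chart[OF assms] .
  then show ?thesis using openin_open_subtopology[OF chart_openin[OF assms]] by simp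
qed

lemma analytic_diff_series:
  fixes \<Phi> \<Psi> :: "'m \<Rightarrow> 'b::banach"
  assumes an: "real_analytic_map A \<Phi>" "real_analytic_map A \<Psi>" and c: "c \<in> A" "x \<in> fst c"
  obtains r a1 a2 where "converges r a1" "converges r a2" "half_space \<inter> ball (snd c x) r \<subseteq> chart_image c"
    "\<And>y. y \<in> half_space \<inter> ball (snd c x) r \<Longrightarrow> \<Phi> (chart_inv c y) = psum a1 (y - snd c x)"
    "\<And>y. y \<in> half_space \<inter> ball (snd c x) r \<Longrightarrow> \<Psi> (chart_inv c y) = psum a2 (y - snd c x)"
proof -
  have xc: "snd c x \<in> chart_image c" using c by blast
  have 1: "real_analytic_on (chart_image c) (\<Phi> \<circ> chart_inv c)" and 2: "real_analytic_on (chart_image c) (\<Psi> \<circ> chart_inv c)"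
    using an c by (auto simp: real_analytic_map_def)
  obtain r1 a1 where r1: "converges r1 a1" "half_space \<inter> ball (snd c x) r1 \<subseteq> chart_image c"
    "\<And>y. y \<in> half_space \<inter> ball (snd c x) r1 \<Longrightarrow> (\<Phi> \<circ> chart_inv c) y = psum a1 (y - snd c x)"
    by (rule real_analytic_local_series[OF 1 chart_image_openin[OF c(1)] xc]) blast
  obtain r2 a2 where r2: "converges r2 a2" "half_space \<inter> ball (snd c x) r2 \<subseteq> chart_image c"
    "\<And>y. y \<in> half_space \<inter> ball (snd c x) r2 \<Longrightarrow> (\<Psi> \<circ> chart_inv c) y = psum a2 (y - snd c x)"
    by (rule real_analytic_local_series[OF 2 chart_image_openin[OF c(1)] xc]) blast
  have pos: "0 < min r1 r2" using converges_radius_pos r1(1) r2(1) by auto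
  show thesis
  proof (rule that[of "min r1 r2" a1 a2])
    show "converges (min r1 r2) a1" by (rule converges_mono[OF r1(1) pos]) simp
    show "converges (min r1 r2) a2" by (rule converges_mono[OF r2(1) pos]) simp
    show "half_space \<inter> ball (snd c x) (min r1 r2) \<subseteq> chart_image c" using r1(2) by auto
    fix y assume "y \<in> half_space \<inter> ball (snd c x) (min r1 r2)"
    then show "\<Phi> (chart_inv c y) = psum a1 (y - snd c x)" "\<Psi> (chart_inv c y) = psum a2 (y - snd c x)"
      using r1(3)[of y] r2(3)[of y] by auto
  qed
qed

text \<open>
  Let \<open>Z\<close> be the interior of the set where the two maps agree. At a point \<open>x\<close> of its closure, consider
  the series of the difference in a chart. It vanishes on open sets of interior points of the
  half-space that accumulate at \<open>x\<close>, so all its coefficients are zero and \<open>x\<close> lies in \<open>Z\<close>.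
\<close>

lemma analytic_identity:
  fixes \<Phi> \<Psi> :: "'m \<Rightarrow> 'b::banach"
  assumes conn: "connected_space M" and an: "real_analytic_map A \<Phi>" "real_analytic_map A \<Psi>"
    and U0: "openin M U0" "U0 \<noteq> {}" "\<And>x. x \<in> U0 \<Longrightarrow> \<Phi> x = \<Psi> x"
    and x: "x \<in> topspace M"
  shows "\<Phi> x = \<Psi> x"
proof -
  let ?n = "normal_index :: 'n"
  define Z where "Z = \<Union>{U. openin M U \<and> (\<forall>x\<in>U. \<Phi> x = \<Psi> x)}"
  have Zo: "openin M Z" unfolding Z_def by (rule openin_Union) auto
  have Zeq: "\<Phi> x = \<Psi> x" if "x \<in> Z" for x using that by (auto simp: Z_def)
  have "M closure_of Z \<subseteq> Z"
  proof
    fix x assume xc: "x \<in> M closure_of Z"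
    then have "x \<in> topspace M" and meets: "\<And>T. x \<in> T \<Longrightarrow> openin M T \<Longrightarrow> \<exists>y. y \<in> Z \<and> y \<in> T"
      by (simp_all add: in_closure_of)
    then obtain c where c: "c \<in> A" "x \<in> fst c" using chart_exists by blast
    let ?p = "snd c x"
    obtain r a1 a2 where r: "converges r a1" "converges r a2" "half_space \<inter> ball ?p r \<subseteq> chart_image c"
      "\<And>y. y \<in> half_space \<inter> ball ?p r \<Longrightarrow> \<Phi> (chart_inv c y) = psum a1 (y - ?p)"
      "\<And>y. y \<in> half_space \<inter> ball ?p r \<Longrightarrow> \<Psi> (chart_inv c y) = psum a2 (y - ?p)"
      by (rule analytic_diff_series[OF an c]) blast
    have r0: "0 < r" by (rule converges_radius_pos[OF r(1)])
    define a where "a = (\<lambda>\<alpha>. a1 \<alpha> - a2 \<alpha>)"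
    note pd = psum_diff[OF r(1,2), folded a_def]
    obtain O' where O': "open O'" "snd c ` (fst c \<inter> Z) = half_space \<inter> O'"
      using chart_open_image[OF c(1) Zo] by (auto simp: openin_open)
    define V where "V = (\<lambda>y. - ?p + y) ` (O' \<inter> {y. 0 < y $ ?n})"
    have "a \<alpha> = 0" for \<alpha>
    proof (rule psum_zero_coeffs_zero[OF pd(1)])
      show "open V" unfolding V_def
        by (intro open_translation open_Int O'(1)) (rule open_halfspace_component_gt_cart)
      show "0 \<in> closure V" unfolding closure_approachable
      proof (intro allI impI)
        fix e :: real assume e: "0 < e"
        \<comment> \<open>A point of \<open>Z\<close> near \<open>x\<close> may lie on the boundary and is then moved inside.\<close>
        have "x \<in> {x' \<in> fst c. snd c x' \<in> ball ?p (e / 2)}" using c(2) e by simp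
        from meets[OF this chart_ball_openin[OF c(1)]]
        obtain x' where x': "x' \<in> Z" "x' \<in> fst c" "snd c x' \<in> ball ?p (e / 2)" by blast
        let ?y = "snd c x'"
        have yO: "?y \<in> half_space" "?y \<in> O'" using x' O'(2) by blast+
        obtain \<rho> where \<rho>: "0 < \<rho>" "ball ?y \<rho> \<subseteq> O'" using O'(1) yO by (meson openE)
        define s where "s = min (\<rho> / 2) (e / 2)"
        have s: "0 < s" "s < \<rho>" "s \<le> e / 2" using \<rho>(1) e by (auto simp: s_def min_def)
        let ?y' = "?y + s *\<^sub>R axis ?n 1"
        have "?y' \<in> O'" using \<rho>(2) s by (auto simp: dist_norm)
        moreover have "0 < ?y' $ ?n" using yO(1) s by (simp add: half_space_def)
        ultimately have "- ?p + ?y' \<in> V" unfolding V_def by blast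
        moreover have "dist (- ?p + ?y') 0 < e"
        proof -
          have "norm (- ?p + ?y') \<le> norm (?y - ?p) + norm (s *\<^sub>R (axis ?n 1 :: real^'n))"
            using norm_triangle_ineq[of "?y - ?p" "s *\<^sub>R axis ?n 1"] by (simp add: algebra_simps)
          also have "\<dots> < e" using x'(3) s by (simp add: dist_norm norm_minus_commute)
          finally show ?thesis by simp
        qed
        ultimately show "\<exists>y\<in>V. dist y 0 < e" by blast
      qed
      fix q assume q: "q \<in> V" "q \<in> ball 0 r"
      then obtain y where y: "y \<in> O'" "0 < y $ ?n" "q = - ?p + y" by (auto simp: V_def)
      have yh: "y \<in> half_space \<inter> ball ?p r" using y q by (simp add: half_space_def dist_norm norm_minus_commute)
      then have "y \<in> snd c ` (fst c \<inter> Z)" using O'(2) y by blast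
      then have "chart_inv c y \<in> Z" using c by auto
      then have "psum a1 (y - ?p) = psum a2 (y - ?p)" using Zeq r(4,5)[OF yh] by metis
      then show "psum a q = 0" using pd(2)[OF q(2)] y(3) by simp
    qed
    then have a0: "a = (\<lambda>_. 0)" by auto
    have "\<Phi> x' = \<Psi> x'" if x': "x' \<in> fst c" "snd c x' \<in> ball ?p r" for x'
    proof -
      have yh: "snd c x' \<in> half_space \<inter> ball ?p r" using x' chart_in_half_space[OF c(1)] by blast
      have "psum a1 (snd c x' - ?p) - psum a2 (snd c x' - ?p) = psum a (snd c x' - ?p)"
        using pd(2)[of "snd c x' - ?p"] x'(2) by (simp add: dist_norm norm_minus_commute)
      also have "\<dots> = 0" by (simp add: a0 psum_def)
      finally show ?thesis using r(4,5)[OF yh] c(1) x'(1) by simp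
    qed
    then have "{x' \<in> fst c. snd c x' \<in> ball ?p r} \<subseteq> Z"
      unfolding Z_def using chart_ball_openin[OF c(1), of ?p r] by blast
    then show "x \<in> Z" using c(2) r0 by auto
  qed
  then have "closedin M Z" using openin_subset[OF Zo] closure_of_subset_eq by blast
  moreover have "U0 \<subseteq> Z" unfolding Z_def using U0 by blast
  ultimately have "Z = topspace M" using Zo conn U0(2) unfolding connected_space_clopen_in by blast
  then show ?thesis using Zeq x by blast
qed

end

section \<open>Determination near the boundary point\<close>

context analytic_riemannian
begin

text \<open>
  The argument described at the beginning. The constants are chosen in this order: the point \<open>x1\<close>, which
  fixes \<open>H0\<close>; a radius \<open>\<rho>\<close> around \<open>x1\<close> on which the quotient \<open>h\<close> and both fields are nearly constant;
  a time \<open>\<theta>\<close> within which geodesics from \<open>x1\<close> stay in this ball and attenuation matrices stay near the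
  identity; and finally the vector \<open>v\<close>, whose normal component is so small that the exit time is
  below \<open>\<theta>\<close>.
\<close>

lemma boundary_determination:
  fixes \<Phi> \<Psi> :: "'m \<Rightarrow> complex^'N^'N::finite"
  assumes sc: "strictly_convex_boundary_at M A g x0"
    and z0: "(x0, v0) \<in> glancing_boundary M A g"
    and G: "neighborhood_in (tangent_bundle_topology A) (inward_boundary M A g) (x0, v0) G"
    and an: "real_analytic_map A \<Phi>" "real_analytic_map A \<Psi>"
    and eq: "\<And>z. z \<in> G \<Longrightarrow> scattering_data M A g \<Phi> z = scattering_data M A g \<Psi> z"
    and c: "c \<in> A" "x0 \<in> fst c"
  obtains U where "openin M U" "x0 \<in> U" "\<And>x. x \<in> U \<Longrightarrow> \<Phi> x = \<Psi> x"
proof -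
  let ?p = "snd c x0" and ?n = "normal_index :: 'n"
  note gl = glancing_coords[OF c z0]
  have v0nz: "v0 \<noteq> (\<lambda>_. 0)"
    using metric_in_coords[OF c gl(2) gl(2)] gl(3) by (auto simp: gform_simps)
  have convex: "0 < chr c ?p (v0 c) (v0 c) $ ?n"
    by (rule strictly_convex_coords[OF c sc gl(2,4) v0nz])
  obtain \<delta>1 \<kappa> C where \<delta>1: "0 < \<delta>1" and \<kappa>: "0 < \<kappa>" and C: "0 \<le> C"
    and geo: "\<And>x v. \<lbrakk>x \<in> fst c; v \<in> tangent_space A x; snd c x $ ?n = 0;
        norm (snd c x - ?p) < \<delta>1; norm (v c - v0 c) < \<delta>1; 0 < v c $ ?n\<rbrakk> \<Longrightarrow>
      \<exists>\<tau> y. 0 < \<tau> \<and> \<kappa> * \<tau> \<le> 2 * v c $ ?n \<and> forward_exit_time M A g (x, v) = ereal \<tau> \<and>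
        continuous_on {0..\<tau>} y \<and>
        (\<forall>t\<in>{0..\<tau>}. y t \<in> chart_image c \<and> geodesic_point M A g (x, v) t = chart_inv c (y t) \<and>
           norm (y t - snd c x) \<le> C * t) \<and>
        (\<forall>t. 0 < t \<and> t < \<tau> \<longrightarrow> 0 < y t $ ?n)"
    by (rule short_geodesic[OF c gl(4) convex]) blast
  obtain W0 W where W: "openin (tangent_bundle_topology A) W" "W0 = W \<inter> inward_boundary M A g" "(x0, v0) \<in> W0" "W0 \<subseteq> G"
    using G unfolding neighborhood_in_def openin_subtopology by blast
  have "(x0, v0) \<in> W" using W by blast
  from tangent_bundle_neighborhood[OF c gl(2) W(1) this] obtain \<epsilon>W where \<epsilon>W: "0 < \<epsilon>W"
    and inW: "\<And>x v. \<lbrakk>x \<in> fst c; v \<in> tangent_space A x; norm (snd c x - ?p) < \<epsilon>W; norm (v c - v0 c) < \<epsilon>W\<rbrakk> \<Longrightarrow> (x, v) \<in> W"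
    by blast
  define \<epsilon> where "\<epsilon> = min \<delta>1 \<epsilon>W"
  have \<epsilon>: "0 < \<epsilon>" "\<epsilon> \<le> \<delta>1" "\<epsilon> \<le> \<epsilon>W" using \<delta>1 \<epsilon>W by (auto simp: \<epsilon>_def)
  obtain \<delta>2 where \<delta>2: "0 < \<delta>2"
    and vec: "\<And>x \<eta>. \<lbrakk>x \<in> fst c; snd c x $ ?n = 0; norm (snd c x - ?p) < \<delta>2; 0 < \<eta>\<rbrakk> \<Longrightarrow>
      \<exists>v\<in>tangent_space A x. g x v v = 1 \<and> norm (v c - v0 c) < \<epsilon> \<and> 0 < v c $ ?n \<and> v c $ ?n < \<eta>"
    by (rule slightly_inward_vectors[OF c gl(2,3,4) \<epsilon>(1)]) blast
  obtain r a1 a2 where r: "converges r a1" "converges r a2" "half_space \<inter> ball ?p r \<subseteq> chart_image c"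
    and ser: "\<And>y. y \<in> half_space \<inter> ball ?p r \<Longrightarrow> \<Phi> (chart_inv c y) = psum a1 (y - ?p)"
      "\<And>y. y \<in> half_space \<inter> ball ?p r \<Longrightarrow> \<Psi> (chart_inv c y) = psum a2 (y - ?p)"
    by (rule analytic_diff_series[OF an c]) blast
  have r0: "0 < r" by (rule converges_radius_pos[OF r(1)])
  define a where "a = (\<lambda>\<alpha>. a1 \<alpha> - a2 \<alpha>)"
  note pd = psum_diff[OF r(1,2), folded a_def]
  have "a \<alpha>0 = 0" for \<alpha>0
  proof (rule ccontr)
    assume "a \<alpha>0 \<noteq> 0"
    then obtain k b where b: "converges r b" and fac: "\<And>x. x \<in> ball 0 r \<Longrightarrow> psum a x = (x $ ?n ^ k) *\<^sub>R psum b x"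
      and nz: "\<And>\<epsilon>. 0 < \<epsilon> \<Longrightarrow> \<exists>q. norm q < \<epsilon> \<and> q $ ?n = 0 \<and> psum b q \<noteq> 0"
      using psum_factor_hyperplane[OF pd(1), of \<alpha>0 ?n] by metis
    have "0 < min r (min \<delta>2 \<epsilon>)" using r0 \<delta>2 \<epsilon> by simp
    from nz[OF this] obtain q where q: "norm q < r" "norm q < \<delta>2" "norm q < \<epsilon>" "q $ ?n = 0" "psum b q \<noteq> 0" by auto
    \<comment> \<open>The boundary point at which the quotient of the difference by \<open>y $ normal_index ^ k\<close> is not zero.\<close>
    define y1 where "y1 = ?p + q"
    have y1: "y1 \<in> half_space \<inter> ball ?p r" using q gl(1) by (simp add: y1_def half_space_def dist_norm)
    then have y1c: "y1 \<in> chart_image c" using r(3) by blast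
    define x1 where "x1 = chart_inv c y1"
    have x1: "x1 \<in> fst c" "snd c x1 = y1" using chart_inv_in[OF y1c] chart_inv_right[OF y1c] by (auto simp: x1_def)
    have x1b: "snd c x1 $ ?n = 0" and x1d: "snd c x1 - ?p = q" using q(4) gl(1) by (auto simp: x1 y1_def)
    define H0 where "H0 = psum b q"
    obtain \<kappa>0 where \<kappa>0: "0 < \<kappa>0"
      "\<And>(A :: complex^'N^'N) B :: complex^'N^'N. norm (A ** B) \<le> \<kappa>0 * norm A * norm B"
      by (rule matrix_mult_norm_bound) blast
    obtain \<delta>i where \<delta>i: "0 < \<delta>i" "\<And>U :: complex^'N^'N. norm (U - mat 1) < \<delta>i \<Longrightarrow> invertible U"
      by (rule invertible_near_one) blast
    define n1 where "n1 = norm (mat 1 :: complex^'N^'N)"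
    have n1: "0 \<le> n1" by (simp add: n1_def)
    define h0 where "h0 = norm H0"
    have h0: "0 < h0" using q(5) by (simp add: h0_def H0_def)
    define K where "K = norm (psum a1 q) + norm (psum a2 q) + 1"
    have K: "0 < K" by (simp add: K_def add_nonneg_pos)
    define \<mu> where "\<mu> = h0 / (4 * \<kappa>0 * (n1 + 1))"
    have \<mu>: "0 < \<mu>" using h0 \<kappa>0 n1 by (simp add: \<mu>_def)
    have near: "\<exists>\<rho>>0. \<forall>y. dist y y1 < \<rho> \<longrightarrow> norm (psum d (y - ?p) - psum d q) < e"
      if "converges r d" "0 < e" for d :: "('n \<Rightarrow> nat) \<Rightarrow> complex^'N^'N" and e
    proof -
      have "isCont (\<lambda>y. psum d (y - ?p)) y1" by (rule isCont_psum[OF that(1)]) (use y1 in simp)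
      then show ?thesis using that(2) unfolding continuous_at_eps_delta
        by (auto simp: dist_norm y1_def)
    qed
    from near[OF b \<mu>] obtain \<rho>1 where \<rho>1: "0 < \<rho>1" "\<And>y. dist y y1 < \<rho>1 \<Longrightarrow> norm (psum b (y - ?p) - H0) < \<mu>"
      unfolding H0_def by blast
    from near[OF r(1), of 1] obtain \<rho>2 where \<rho>2: "0 < \<rho>2" "\<And>y. dist y y1 < \<rho>2 \<Longrightarrow> norm (psum a1 (y - ?p) - psum a1 q) < 1" by auto
    from near[OF r(2), of 1] obtain \<rho>3 where \<rho>3: "0 < \<rho>3" "\<And>y. dist y y1 < \<rho>3 \<Longrightarrow> norm (psum a2 (y - ?p) - psum a2 q) < 1" by auto
    define \<rho> where "\<rho> = min (min \<rho>1 \<rho>2) (min \<rho>3 (r - norm q))"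
    have \<rho>: "0 < \<rho>" "\<rho> \<le> \<rho>1" "\<rho> \<le> \<rho>2" "\<rho> \<le> \<rho>3" "\<rho> \<le> r - norm q" using \<rho>1 \<rho>2 \<rho>3 q by (auto simp: \<rho>_def)
    define \<eta> where "\<eta> = min 1 (min (\<delta>i / 2) (1 / (4 * \<kappa>0)))"
    have \<eta>: "0 < \<eta>" "\<eta> \<le> 1" "\<eta> < \<delta>i" "\<kappa>0 * \<eta> \<le> 1/4"
    proof -
      show "0 < \<eta>" using \<delta>i(1) \<kappa>0(1) by (simp add: \<eta>_def)
      show "\<eta> \<le> 1" unfolding \<eta>_def by (rule min.cobounded1)
      have "\<eta> \<le> \<delta>i / 2" unfolding \<eta>_def by (rule order_trans[OF min.cobounded2 min.cobounded1])
      then show "\<eta> < \<delta>i" using \<delta>i(1) by linarith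
      have "\<eta> \<le> 1 / (4 * \<kappa>0)" unfolding \<eta>_def by (rule order_trans[OF min.cobounded2 min.cobounded2])
      then show "\<kappa>0 * \<eta> \<le> 1/4" using \<kappa>0(1) by (simp add: field_simps)
    qed
    define X where "X = 2 * \<kappa>0 * K * n1"
    have X: "0 \<le> X" using \<kappa>0 K n1 by (simp add: X_def)
    define \<theta> where "\<theta> = min (\<rho> / (C + 1)) (min (1 / (12 * \<kappa>0 * K)) (\<eta> / (X + 1)))"
    have \<theta>: "0 < \<theta>" using \<rho> C \<kappa>0 K \<eta> X by (simp add: \<theta>_def)
    have \<theta>1: "C * \<theta> < \<rho>"
    proof -
      have "\<theta> \<le> \<rho> / (C + 1)" unfolding \<theta>_def by (rule min.cobounded1)
      then have "(C + 1) * \<theta> \<le> \<rho>" using C by (simp add: field_simps)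
      then show ?thesis using \<theta> by (simp add: algebra_simps)
    qed
    have \<theta>2: "\<kappa>0 * K * \<theta> \<le> 1 / 12"
    proof -
      have "\<theta> \<le> 1 / (12 * \<kappa>0 * K)" unfolding \<theta>_def by (rule order_trans[OF min.cobounded2 min.cobounded1])
      then show ?thesis using \<kappa>0(1) K by (simp add: field_simps)
    qed
    have \<theta>3: "X * \<theta> \<le> \<eta>"
    proof -
      have "\<theta> \<le> \<eta> / (X + 1)" unfolding \<theta>_def by (rule order_trans[OF min.cobounded2 min.cobounded2])
      then have "(X + 1) * \<theta> \<le> \<eta>" using X by (simp add: field_simps)
      then show ?thesis using \<theta> by (simp add: algebra_simps)
    qed
    \<comment> \<open>A unit vector at \<open>x1\<close> so close to the boundary directions that its geodesic lives for less
      than the time \<open>\<theta>\<close>.\<close>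
    have "0 < \<kappa> * \<theta> / 2" using \<kappa> \<theta> by simp
    then obtain v where v: "v \<in> tangent_space A x1" "g x1 v v = 1" "norm (v c - v0 c) < \<epsilon>" "0 < v c $ ?n" "v c $ ?n < \<kappa> * \<theta> / 2"
      using vec[OF x1(1) x1b, of "\<kappa> * \<theta> / 2"] q(2) x1d by auto
    have "(x1, v) \<in> W" using inW[OF x1(1) v(1)] v(3) q(3) x1d \<epsilon> by simp
    moreover have "(x1, v) \<in> inward_boundary M A g"
      by (rule inward_boundaryI[OF c(1) x1(1) x1b v(1,2)]) (use v(4) in simp)
    ultimately have zG: "(x1, v) \<in> G" using W by blast
    obtain \<tau> y where \<tau>: "0 < \<tau>" "\<kappa> * \<tau> \<le> 2 * v c $ ?n" "forward_exit_time M A g (x1, v) = ereal \<tau>"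
      and yc: "continuous_on {0..\<tau>} y"
      and y: "\<And>t. t \<in> {0..\<tau>} \<Longrightarrow> y t \<in> chart_image c"
        "\<And>t. t \<in> {0..\<tau>} \<Longrightarrow> geodesic_point M A g (x1, v) t = chart_inv c (y t)"
        "\<And>t. t \<in> {0..\<tau>} \<Longrightarrow> norm (y t - snd c x1) \<le> C * t"
      and ypos: "\<And>t. 0 < t \<Longrightarrow> t < \<tau> \<Longrightarrow> 0 < y t $ ?n"
      using geo[OF x1(1) v(1) x1b] v(3,4) q(3) x1d \<epsilon>(2) by auto
    have \<tau>\<theta>: "\<tau> < \<theta>"
    proof -
      have "\<kappa> * \<tau> < \<kappa> * \<theta>" using \<tau>(2) v(5) by simp
      then show ?thesis using \<kappa> by simp
    qed
    have ynear: "dist (y t) y1 < \<rho>" if t: "t \<in> {0..\<tau>}" for t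
    proof -
      have "dist (y t) y1 \<le> C * t" using y(3)[OF t] x1(2) by (simp add: dist_norm)
      also have "\<dots> \<le> C * \<theta>" using t \<tau>\<theta> C by (intro mult_left_mono) auto
      finally show ?thesis using \<theta>1 by simp
    qed
    have yh: "y t \<in> half_space" if "t \<in> {0..\<tau>}" for t
      using y(1)[OF that] openin_imp_subset[OF chart_image_openin[OF c(1)]] by blast
    have yr: "y t \<in> half_space \<inter> ball ?p r" if t: "t \<in> {0..\<tau>}" for t
    proof -
      have "dist ?p (y t) \<le> dist ?p y1 + dist y1 (y t)" by (rule dist_triangle)
      also have "dist ?p y1 = norm q" by (simp add: y1_def dist_norm)
      finally have "dist ?p (y t) < r" using ynear[OF t] \<rho>(5) by (simp add: dist_commute)
      then show ?thesis using yh[OF t] by simp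
    qed
    define A1 where "A1 = (\<lambda>t. psum a1 (y t - ?p))"
    define A2 where "A2 = (\<lambda>t. psum a2 (y t - ?p))"
    define H where "H = (\<lambda>t. psum b (y t - ?p))"
    have cont: "continuous_on {0..\<tau>} (\<lambda>t. psum d (y t - ?p))" if "converges r d" for d :: "('n \<Rightarrow> nat) \<Rightarrow> complex^'N^'N"
    proof (rule continuous_on_compose2[OF _ yc])
      show "continuous_on (ball ?p r) (\<lambda>y. psum d (y - ?p))"
        by (intro continuous_at_imp_continuous_on ballI isCont_psum[OF that])
      show "y ` {0..\<tau>} \<subseteq> ball ?p r" using yr by blast
    qed
    have A1K: "norm (A1 t) \<le> K" if t: "t \<in> {0..\<tau>}" for t
    proof -
      have "norm (A1 t - psum a1 q) < 1" unfolding A1_def using \<rho>2(2) ynear[OF t] \<rho>(3) by simp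
      moreover have "norm (A1 t) \<le> norm (psum a1 q) + norm (A1 t - psum a1 q)"
        using norm_triangle_ineq[of "psum a1 q" "A1 t - psum a1 q"] by simp
      moreover have "0 \<le> norm (psum a2 q)" by simp
      ultimately show ?thesis unfolding K_def by linarith
    qed
    have A2K: "norm (A2 t) \<le> K" if t: "t \<in> {0..\<tau>}" for t
    proof -
      have "norm (A2 t - psum a2 q) < 1" unfolding A2_def using \<rho>3(2) ynear[OF t] \<rho>(4) by simp
      moreover have "norm (A2 t) \<le> norm (psum a2 q) + norm (A2 t - psum a2 q)"
        using norm_triangle_ineq[of "psum a2 q" "A2 t - psum a2 q"] by simp
      moreover have "0 \<le> norm (psum a1 q)" by simp
      ultimately show ?thesis unfolding K_def by linarith
    qed
    have small: "\<kappa>0 * K * \<tau> \<le> 1 / 12"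
    proof -
      have "\<kappa>0 * K * \<tau> \<le> \<kappa>0 * K * \<theta>" using \<tau>\<theta> \<kappa>0 K by (intro mult_left_mono) auto
      then show ?thesis using \<theta>2 by linarith
    qed
    have small': "2 * \<kappa>0 * K * \<tau> * n1 \<le> \<eta>"
    proof -
      have "2 * \<kappa>0 * K * \<tau> * n1 = X * \<tau>" by (simp add: X_def)
      also have "\<dots> \<le> X * \<theta>" using \<tau>\<theta> X by (intro mult_left_mono) auto
      finally show ?thesis using \<theta>3 by linarith
    qed
    obtain U1 where U1: "U1 \<tau> = mat 1"
      "\<And>t. t \<in> {0..\<tau>} \<Longrightarrow> (U1 has_vector_derivative - (A1 t ** U1 t)) (at t within {0..\<tau>})"
      and U1n: "\<And>t. t \<in> {0..\<tau>} \<Longrightarrow> norm (U1 t - mat 1) \<le> 2 * \<kappa>0 * K * \<tau> * norm (mat 1 :: complex^'N^'N)"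
      by (rule linear_ode_terminal[OF \<kappa>0, of \<tau> A1 K]) (use \<tau> K A1K small cont[OF r(1)] in \<open>auto simp: A1_def\<close>)
    obtain U2 where U2: "U2 \<tau> = mat 1"
      "\<And>t. t \<in> {0..\<tau>} \<Longrightarrow> (U2 has_vector_derivative - (A2 t ** U2 t)) (at t within {0..\<tau>})"
      and U2n: "\<And>t. t \<in> {0..\<tau>} \<Longrightarrow> norm (U2 t - mat 1) \<le> 2 * \<kappa>0 * K * \<tau> * norm (mat 1 :: complex^'N^'N)"
      by (rule linear_ode_terminal[OF \<kappa>0, of \<tau> A2 K]) (use \<tau> K A2K small cont[OF r(2)] in \<open>auto simp: A2_def\<close>)
    have U1\<eta>: "norm (U1 t - mat 1) \<le> \<eta>" and U2\<eta>: "norm (U2 t - mat 1) \<le> \<eta>" if "t \<in> {0..\<tau>}" for t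
      using U1n[OF that] U2n[OF that] small' by (auto simp: n1_def)
    have S1: "scattering_data M A g \<Phi> (x1, v) = U1 0"
    proof (rule scattering_data_eq[OF _ \<tau>(3) _ A1K U1])
      show "\<Phi> (geodesic_point M A g (x1, v) t) = A1 t" if "t \<in> {0..\<tau>}" for t
        unfolding y(2)[OF that] A1_def by (rule ser(1)[OF yr[OF that]])
      show "invertible (U1 t)" if "t \<in> {0..\<tau>}" for t using \<delta>i(2) U1\<eta>[OF that] \<eta>(3) by simp
    qed (use \<tau> in auto)
    have S2: "scattering_data M A g \<Psi> (x1, v) = U2 0"
    proof (rule scattering_data_eq[OF _ \<tau>(3) _ A2K U2])
      show "\<Psi> (geodesic_point M A g (x1, v) t) = A2 t" if "t \<in> {0..\<tau>}" for t
        unfolding y(2)[OF that] A2_def by (rule ser(2)[OF yr[OF that]])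
      show "invertible (U2 t)" if "t \<in> {0..\<tau>}" for t using \<delta>i(2) U2\<eta>[OF that] \<eta>(3) by simp
    qed (use \<tau> in auto)
    interpret mm: bounded_bilinear "(**) :: complex^'N^'N::finite \<Rightarrow> complex^'N^'N \<Rightarrow> complex^'N^'N"
      by (rule bounded_bilinear_matrix_mult)
    show False
    proof (rule attenuation_distinguishes[where \<tau> = \<tau> and m = "\<lambda>t. y t $ ?n ^ k" and H = H
          and ?A1.0 = A1 and ?A2.0 = A2 and ?U1.0 = U1 and ?U2.0 = U2 and ?H0.0 = H0, OF \<kappa>0 \<tau>(1) _ A1K _ U1(2) U2(2)])
      show "0 \<le> K" using K by simp
      show "\<kappa>0 * K * \<tau> < 1/6" using small by simp
      show "continuous_on {0..\<tau>} (\<lambda>t. y t $ ?n ^ k)" by (intro continuous_intros yc)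
      show "0 \<le> y t $ ?n ^ k" if "t \<in> {0..\<tau>}" for t using yh[OF that] by (simp add: half_space_def)
      show "0 < y t $ ?n ^ k" if "0 < t" "t < \<tau>" for t using ypos[OF that] by simp
      show "H0 \<noteq> 0" using q(5) by (simp add: H0_def)
      show "U1 \<tau> = U2 \<tau>" by (simp add: U1 U2)
      show "U1 0 = U2 0" using eq[OF zG] S1 S2 by simp
      fix t assume t: "t \<in> {0..\<tau>}"
      have "y t - ?p \<in> ball 0 r" using yr[OF t] by (simp add: dist_norm norm_minus_commute)
      then show "A1 t - A2 t = y t $ ?n ^ k *\<^sub>R H t"
        using pd(2)[of "y t - ?p"] fac[of "y t - ?p"] gl(1) by (simp add: A1_def A2_def H_def)
      have HH: "norm (H t - H0) \<le> \<mu>" unfolding H_def using \<rho>1(2) ynear[OF t] \<rho>(2) by (simp add: less_imp_le)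
      have nU: "norm (U2 t) \<le> n1 + 1"
        using norm_triangle_ineq[of "mat 1" "U2 t - mat 1"] U2\<eta>[OF t] \<eta>(2) by (simp add: n1_def)
      have "H t ** U2 t - H0 = (H t - H0) ** U2 t + H0 ** (U2 t - mat 1)"
        by (simp add: mm.diff_left mm.diff_right)
      then have "norm (H t ** U2 t - H0) \<le> norm ((H t - H0) ** U2 t) + norm (H0 ** (U2 t - mat 1))"
        by (metis norm_triangle_ineq)
      also have "\<dots> \<le> \<kappa>0 * \<mu> * (n1 + 1) + \<kappa>0 * h0 * \<eta>"
      proof (rule add_mono)
        have "norm ((H t - H0) ** U2 t) \<le> \<kappa>0 * norm (H t - H0) * norm (U2 t)" by (rule \<kappa>0(2))
        also have "\<dots> \<le> \<kappa>0 * \<mu> * (n1 + 1)" using HH nU \<kappa>0(1) \<mu> by (intro mult_mono) auto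
        finally show "norm ((H t - H0) ** U2 t) \<le> \<kappa>0 * \<mu> * (n1 + 1)" .
        have "norm (H0 ** (U2 t - mat 1)) \<le> \<kappa>0 * norm H0 * norm (U2 t - mat 1)" by (rule \<kappa>0(2))
        also have "\<dots> \<le> \<kappa>0 * h0 * \<eta>" using U2\<eta>[OF t] \<kappa>0(1) by (intro mult_mono) (auto simp: h0_def)
        finally show "norm (H0 ** (U2 t - mat 1)) \<le> \<kappa>0 * h0 * \<eta>" .
      qed
      also have "\<kappa>0 * \<mu> * (n1 + 1) = h0 / 4"
      proof -
        have "\<kappa>0 \<noteq> 0" "n1 + 1 \<noteq> 0" using \<kappa>0(1) n1 by linarith+
        then show ?thesis by (simp add: \<mu>_def divide_simps)
      qed
      also have "\<kappa>0 * h0 * \<eta> \<le> h0 / 4"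
        using mult_left_mono[OF \<eta>(4), of h0] h0 by (simp add: ac_simps)
      finally show "norm (H t ** U2 t - H0) \<le> norm H0 / 2" by (simp add: h0_def)
    qed
  qed
  then have a0: "a = (\<lambda>_. 0)" by auto
  show thesis
  proof (rule that[OF chart_ball_openin[OF c(1), of ?p r]])
    show "x0 \<in> {x \<in> fst c. snd c x \<in> ball ?p r}" using c r0 by simp
    fix x assume x: "x \<in> {x \<in> fst c. snd c x \<in> ball ?p r}"
    then have xh: "snd c x \<in> half_space \<inter> ball ?p r" using chart_in_half_space[OF c(1)] by blast
    have "psum a1 (snd c x - ?p) - psum a2 (snd c x - ?p) = psum a (snd c x - ?p)"
      using pd(2)[of "snd c x - ?p"] x by (simp add: dist_norm norm_minus_commute)
    also have "\<dots> = 0" by (simp add: a0 psum_def)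
    finally show "\<Phi> x = \<Psi> x" using ser[OF xh] c(1) x by simp
  qed
qed

end

theorem corollary1p9:
  fixes M :: "'m topology"
    and A :: "('m, 'n::finite) chart set"
    and g :: "('m, 'n) metric"
    and x\<^sub>0 :: 'm
    and v\<^sub>0 :: "('m, 'n) tangent_vector"
    and G :: "('m \<times> ('m, 'n) tangent_vector) set"
    and \<Phi> \<Psi> :: "'m \<Rightarrow> complex^'N^'N::finite"
  assumes "CARD('n) \<ge> 2"
    and "real_analytic_riemannian_manifold M A g"
    and "compact_space M"
    and "connected_space M"
    and "oriented_atlas A"
    and "strictly_convex_boundary_at M A g x\<^sub>0"
    and "(x\<^sub>0, v\<^sub>0) \<in> glancing_boundary M A g"
    and "neighborhood_in (tangent_bundle_topology A) (inward_boundary M A g) (x\<^sub>0, v\<^sub>0) G"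
    and "\<forall>z\<in>G. admissible M A g z"
    and "higgs_field A \<Phi>" and "real_analytic_map A \<Phi>"
    and "higgs_field A \<Psi>" and "real_analytic_map A \<Psi>"
    and "\<forall>z\<in>G. scattering_data M A g \<Phi> z = scattering_data M A g \<Psi> z"
  shows "\<forall>x\<in>topspace M. \<Phi> x = \<Psi> x"
proof
  interpret analytic_riemannian M A g
    using assms(2) by unfold_locales
      (auto simp: real_analytic_riemannian_manifold_def real_analytic_manifold_def)
  fix x assume x: "x \<in> topspace M"
  have "x\<^sub>0 \<in> topspace M" using assms(6) by (simp add: strictly_convex_boundary_at_def mfd_boundary_def)
  then obtain c where c: "c \<in> A" "x\<^sub>0 \<in> fst c" using chart_exists by blast
  obtain U where U: "openin M U" "x\<^sub>0 \<in> U" "\<And>x. x \<in> U \<Longrightarrow> \<Phi> x = \<Psi> x"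
    by (rule boundary_determination[OF assms(6,7,8,11,13) _ c]) (use assms(14) in blast)+
  show "\<Phi> x = \<Psi> x"
    by (rule analytic_identity[OF assms(4,11,13) U(1) _ U(3) x]) (use U(2) in auto)
qed

end
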